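(* Let $Q$ be a stably Gelfand quantale, let $G$ be a localic étale groupoid, and let $q:Q\to\mathcal O(G)$ be a map of involutive quantales. Then $b:=q^*(e)$ is a projection of $Q$ (where $e$ is the multiplicative unit of $\mathcal O(G)$), and there is a unique map of unital involutive quantales $k:\mathcal O(\mathcal G_b(Q))\to\mathcal O(G)$ such that $k\circ p_b=q$. Moreover, $k$ is a surjection if $q$ is.
   Context: An involutive quantale is a complete lattice $Q$ with an associative multiplication that preserves arbitrary joins in each variable and a join-preserving involution satisfying $a^{**}=a$ and $(ab)^*=b^*a^*$; it is unital if it has a multiplicative unit $e$. A homomorphism of involutive quantales preserves arbitrary joins, multiplication and involution. A map of involutive quantales $p:Q\to R$ is, by definition, a homomorphism of involutive quantales $p^*:R\to Q$ in the opposite direction (so $(k\circ p)^*=p^*\circ k^*$); it is a map of unital involutive quantales if $Q,R$ are unital and $p^*$ preserves the unit; it is a surjection if $p^*$ is injective. $Q$ is stably Gelfand if for every $a\in Q$, $aa^*a\le a$ implies $aa^*a=a$. A projection of $Q$ is an element $b$ with $b^2=b=b^*$. For a projection $b$, $\mathcal I_b(Q)=\{s\in Q\mid s^*s\le b,\ ss^*\le b,\ sb\le s,\ bs\le s\}$; for $Q$ stably Gelfand this is a pseudogroup under the multiplication of $Q$ (with inverse $s^{-1}=s^*$, unit $b$, and natural order and compatible joins as in $Q$). Here a pseudogroup is a complete and infinitely distributive inverse semigroup: every compatible subset $Y$ (i.e. $st^{-1}$ and $s^{-1}t$ are idempotent for all $s,t\in Y$; $Y$ may be empty) has a join, and multiplication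 distributes over existing joins. For a pseudogroup $S$, $\mathcal L^{\vee}(S)$ is the set of compatible ideals of $S$, i.e. downwards closed subsets $J\subset S$ with $\bigvee Y\in J$ for every (possibly empty) compatible $Y\subset J$, ordered by inclusion. It is a unital involutive quantale: $J^*=\{s^{-1}\mid s\in J\}$, $JK$ is the least compatible ideal containing $\{st\mid s\in J,\ t\in K\}$, and the unit is the set $E(S)$ of idempotents. A localic étale groupoid $G$ is an internal groupoid in the category of locales, with locale of objects $G_0$ and of arrows $G_1$, whose domain map is a local homeomorphism. $\mathcal O(G)$ denotes the frame of $G_1$ regarded as a unital involutive quantale: the multiplication is the composite of the canonical map $\mathcal O(G_1)\otimes\mathcal O(G_1)\to\mathcal O(G_1\times_{G_0}G_1)$ with the direct image $m_!$ (left adjoint of $m^*$) of the multiplication map $m$, the involution is given by the inversion map of $G$, and the unit is $e=u_!(1)$, the image of the unit map $u:G_0\to G_1$. The quantales $\mathcal O(G)$ are, up to isomorphism, exactly the quantales $\mathcal L^{\vee}(S)$ for pseudogroups $S$. $\mathcal G_b(Q)$ denotes the localic étale groupoid corresponding to the pseudogroup $\mathcal I_b(Q)$, so that $\mathcal O(\mathcal G_b(Q))=\mathcal L^{\vee}(\mathcal I_b(Q))$. The map $p_b:Q\to\mathcal O(\mathcal G_b(Q))$ is defined by $p_b^*=\varphi_b$, where $\varphi_b:\mathcal L^{\vee}(\mathcal I_b(Q))\to Q$ is the homomorphism of involutive quantales $\varphi_b(J)=\bigvee J$ (join in $Q$). *)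

theory Defs
  imports "HOL-Algebra.Group"
begin

section \<open>Involutive quantales\<close>

record 'a iquantale = "'a gorder" +
  qmult :: "'a \<Rightarrow> 'a \<Rightarrow> 'a" (infixl \<open>\<cdot>\<index>\<close> 70)
  qstar :: "'a \<Rightarrow> 'a"

record 'a uiquantale = "'a iquantale" +
  qunit :: 'a

locale involutive_quantale = complete_lattice Q for Q (structure) +
  assumes qmult_closed: "\<lbrakk>a \<in> carrier Q; b \<in> carrier Q\<rbrakk> \<Longrightarrow> a \<cdot> b \<in> carrier Q"
    and qstar_closed: "a \<in> carrier Q \<Longrightarrow> qstar Q a \<in> carrier Q"
    and qmult_assoc: "\<lbrakk>a \<in> carrier Q; b \<in> carrier Q; c \<in> carrier Q\<rbrakk> \<Longrightarrow> (a \<cdot> b) \<cdot> c = a \<cdot> (b \<cdot> c)"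
    and qmult_Sup: "\<lbrakk>a \<in> carrier Q; X \<subseteq> carrier Q\<rbrakk> \<Longrightarrow> a \<cdot> (\<Squnion>X) = \<Squnion>((\<lambda>x. a \<cdot> x) ` X)"
    and Sup_qmult: "\<lbrakk>a \<in> carrier Q; X \<subseteq> carrier Q\<rbrakk> \<Longrightarrow> (\<Squnion>X) \<cdot> a = \<Squnion>((\<lambda>x. x \<cdot> a) ` X)"
    and qstar_Sup: "X \<subseteq> carrier Q \<Longrightarrow> qstar Q (\<Squnion>X) = \<Squnion>(qstar Q ` X)"
    and qstar_qstar: "a \<in> carrier Q \<Longrightarrow> qstar Q (qstar Q a) = a"
    and qstar_qmult: "\<lbrakk>a \<in> carrier Q; b \<in> carrier Q\<rbrakk> \<Longrightarrow> qstar Q (a \<cdot> b) = qstar Q b \<cdot> qstar Q a"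

locale stably_gelfand_quantale = involutive_quantale +
  assumes stably_gelfand:
    "\<lbrakk>a \<in> carrier Q; a \<cdot> qstar Q a \<cdot> a \<sqsubseteq> a\<rbrakk> \<Longrightarrow> a \<cdot> qstar Q a \<cdot> a = a"

definition projection :: "('a, 'm) iquantale_scheme \<Rightarrow> 'a \<Rightarrow> bool" where
  "projection Q b \<longleftrightarrow> b \<in> carrier Q \<and> b \<cdot>\<^bsub>Q\<^esub> b = b \<and> qstar Q b = b"

text \<open>
  A map \<open>p : Q \<rightarrow> R\<close> of involutive quantales is a homomorphism \<open>p\<^sup>* : R \<rightarrow> Q\<close>. We represent \<open>p\<close> by
  the function \<open>p\<^sup>*\<close>, which is required to be \<open>undefined\<close> outside the carrier of \<open>R\<close>, so that
  equality of maps is equality of HOL functions. Likewise, locales are represented below by their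
  frames, and maps of locales by their inverse image homomorphisms.
\<close>

definition iq_maps :: "('a, 'm) iquantale_scheme \<Rightarrow> ('b, 'n) iquantale_scheme \<Rightarrow> ('b \<Rightarrow> 'a) set" where
  "iq_maps Q R = {p \<in> carrier R \<rightarrow>\<^sub>E carrier Q.
     (\<forall>X. X \<subseteq> carrier R \<longrightarrow> p (\<Squnion>\<^bsub>R\<^esub> X) = \<Squnion>\<^bsub>Q\<^esub> (p ` X)) \<and>
     (\<forall>x\<in>carrier R. \<forall>y\<in>carrier R. p (x \<cdot>\<^bsub>R\<^esub> y) = p x \<cdot>\<^bsub>Q\<^esub> p y) \<and>
     (\<forall>x\<in>carrier R. p (qstar R x) = qstar Q (p x))}"

definition uiq_maps :: "('a, 'm) uiquantale_scheme \<Rightarrow> ('b, 'n) uiquantale_scheme \<Rightarrow> ('b \<Rightarrow> 'a) set" where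
  "uiq_maps Q R = {p \<in> iq_maps Q R. p (qunit R) = qunit Q}"

text \<open>\<open>iq_comp R k p\<close> is \<open>k \<circ> p\<close> for \<open>k\<close> with codomain \<open>R\<close>: \<open>(k \<circ> p)\<^sup>* = p\<^sup>* \<circ> k\<^sup>*\<close>.\<close>

definition iq_comp :: "('c, 'm) iquantale_scheme \<Rightarrow> ('c \<Rightarrow> 'b) \<Rightarrow> ('b \<Rightarrow> 'a) \<Rightarrow> ('c \<Rightarrow> 'a)" where
  "iq_comp R k p = compose (carrier R) p k"

definition iq_surjection :: "('b, 'm) iquantale_scheme \<Rightarrow> ('b \<Rightarrow> 'a) \<Rightarrow> bool" where
  "iq_surjection R p \<longleftrightarrow> inj_on p (carrier R)"


section \<open>Pseudogroups and their quantales\<close>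

text \<open>
  The following notions are those of an inverse semigroup \<open>S\<close>. Since every pseudogroup has a unit
  (the join of its idempotents), the library's \<open>monoid\<close> records serve as the carrier structure.
\<close>

definition idems :: "('a, 'm) monoid_scheme \<Rightarrow> 'a set" where
  "idems S = {s \<in> carrier S. s \<otimes>\<^bsub>S\<^esub> s = s}"

definition sg_inv :: "('a, 'm) monoid_scheme \<Rightarrow> 'a \<Rightarrow> 'a" where
  "sg_inv S s = (THE t. t \<in> carrier S \<and> s \<otimes>\<^bsub>S\<^esub> t \<otimes>\<^bsub>S\<^esub> s = s \<and> t \<otimes>\<^bsub>S\<^esub> s \<otimes>\<^bsub>S\<^esub> t = t)"

definition natural_order :: "('a, 'm) monoid_scheme \<Rightarrow> 'a gorder" where
  "natural_order S =
     \<lparr>carrier = carrier S, eq = (=), le = (\<lambda>s t. \<exists>f\<in>idems S. s = f \<otimes>\<^bsub>S\<^esub> t)\<rparr>"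

definition sg_compatible :: "('a, 'm) monoid_scheme \<Rightarrow> 'a set \<Rightarrow> bool" where
  "sg_compatible S Y \<longleftrightarrow> Y \<subseteq> carrier S \<and>
     (\<forall>s\<in>Y. \<forall>t\<in>Y. s \<otimes>\<^bsub>S\<^esub> sg_inv S t \<in> idems S \<and> sg_inv S s \<otimes>\<^bsub>S\<^esub> t \<in> idems S)"

definition compatible_ideal :: "('a, 'm) monoid_scheme \<Rightarrow> 'a set \<Rightarrow> bool" where
  "compatible_ideal S J \<longleftrightarrow> J \<subseteq> carrier S \<and>
     (\<forall>s\<in>carrier S. \<forall>t\<in>J. s \<sqsubseteq>\<^bsub>natural_order S\<^esub> t \<longrightarrow> s \<in> J) \<and>
     (\<forall>Y. Y \<subseteq> J \<longrightarrow> sg_compatible S Y \<longrightarrow> \<Squnion>\<^bsub>natural_order S\<^esub> Y \<in> J)"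

definition ideal_quantale :: "('a, 'm) monoid_scheme \<Rightarrow> 'a set uiquantale" where
  "ideal_quantale S =
     \<lparr>carrier = {J. compatible_ideal S J}, eq = (=), le = (\<subseteq>),
      qmult = (\<lambda>J K. \<Inter>{L. compatible_ideal S L \<and> (\<forall>s\<in>J. \<forall>t\<in>K. s \<otimes>\<^bsub>S\<^esub> t \<in> L)}),
      qstar = (\<lambda>J. sg_inv S ` J),
      qunit = idems S\<rparr>"

definition proj_pseudogroup :: "('a, 'm) iquantale_scheme \<Rightarrow> 'a \<Rightarrow> 'a monoid" where
  "proj_pseudogroup Q b =
     \<lparr>carrier = {s \<in> carrier Q. qstar Q s \<cdot>\<^bsub>Q\<^esub> s \<sqsubseteq>\<^bsub>Q\<^esub> b \<and> s \<cdot>\<^bsub>Q\<^esub> qstar Q s \<sqsubseteq>\<^bsub>Q\<^esub> b \<and>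
                     s \<cdot>\<^bsub>Q\<^esub> b \<sqsubseteq>\<^bsub>Q\<^esub> s \<and> b \<cdot>\<^bsub>Q\<^esub> s \<sqsubseteq>\<^bsub>Q\<^esub> s},
      mult = qmult Q, one = b\<rparr>"

text \<open>
  The groupoid \<open>\<G>\<^sub>b(Q)\<close> only enters through its quantale, which by definition is the quantale of
  compatible ideals of the pseudogroup of \<open>b\<close>. Joins in that quantale are those of the inclusion
  order, whereas \<open>proj_map\<close> takes joins in \<open>Q\<close>.
\<close>

definition proj_quantale :: "('a, 'm) iquantale_scheme \<Rightarrow> 'a \<Rightarrow> 'a set uiquantale" where
  "proj_quantale Q b = ideal_quantale (proj_pseudogroup Q b)"

definition proj_map :: "('a, 'm) iquantale_scheme \<Rightarrow> 'a \<Rightarrow> 'a set \<Rightarrow> 'a" where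
  "proj_map Q b = (\<lambda>J\<in>carrier (proj_quantale Q b). \<Squnion>\<^bsub>Q\<^esub> J)"


section \<open>Locales\<close>

locale frame = complete_lattice L for L (structure) +
  assumes meet_Sup: "\<lbrakk>x \<in> carrier L; X \<subseteq> carrier L\<rbrakk> \<Longrightarrow> x \<sqinter> (\<Squnion>X) = \<Squnion>((\<lambda>y. x \<sqinter> y) ` X)"

definition frame_hom :: "('a, 'm) gorder_scheme \<Rightarrow> ('b, 'n) gorder_scheme \<Rightarrow> ('a \<Rightarrow> 'b) set" where
  "frame_hom L M = {f \<in> carrier L \<rightarrow> carrier M.
     (\<forall>X. X \<subseteq> carrier L \<longrightarrow> f (\<Squnion>\<^bsub>L\<^esub> X) = \<Squnion>\<^bsub>M\<^esub> (f ` X)) \<and>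
     (\<forall>x\<in>carrier L. \<forall>y\<in>carrier L. f (x \<sqinter>\<^bsub>L\<^esub> y) = f x \<sqinter>\<^bsub>M\<^esub> f y) \<and>
     f \<top>\<^bsub>L\<^esub> = \<top>\<^bsub>M\<^esub>}"

text \<open>
  For \<open>f : X \<rightarrow> Y\<close> given by \<open>f\<^sup>* : Y \<rightarrow> X\<close>, this is the formula for the left adjoint \<open>f\<^sub>!\<close> of \<open>f\<^sup>*\<close>,
  which yields the adjoint whenever the latter exists.
\<close>

definition direct_image :: "('x, 'm) gorder_scheme \<Rightarrow> ('y, 'n) gorder_scheme \<Rightarrow> ('y \<Rightarrow> 'x) \<Rightarrow> 'x \<Rightarrow> 'y" where
  "direct_image X Y f x = \<Sqinter>\<^bsub>Y\<^esub> {y \<in> carrier Y. x \<sqsubseteq>\<^bsub>X\<^esub> f y}"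

text \<open>
  A map \<open>f : X \<rightarrow> Y\<close> is a local homeomorphism if \<open>X\<close> is covered by open sublocales \<open>U\<close> which \<open>f\<close>
  restricts to isomorphisms onto open sublocales \<open>V\<close> of \<open>Y\<close>. The open sublocale \<open>U\<close> is the frame
  of elements below \<open>U\<close>, and the restriction \<open>U \<rightarrow> V\<close> of \<open>f\<close> has inverse image \<open>y \<mapsto> f\<^sup>* y \<sqinter> U\<close>.
\<close>

definition local_homeomorphism ::
    "('x, 'm) gorder_scheme \<Rightarrow> ('y, 'n) gorder_scheme \<Rightarrow> ('y \<Rightarrow> 'x) \<Rightarrow> bool" where
  "local_homeomorphism X Y f \<longleftrightarrow> f \<in> frame_hom Y X \<and>
     (\<exists>\<C>. \<C> \<subseteq> carrier X \<and> \<Squnion>\<^bsub>X\<^esub> \<C> = \<top>\<^bsub>X\<^esub> \<and>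
        (\<forall>U\<in>\<C>. \<exists>V\<in>carrier Y. U \<sqsubseteq>\<^bsub>X\<^esub> f V \<and>
           bij_betw (\<lambda>y. f y \<sqinter>\<^bsub>X\<^esub> U) {y \<in> carrier Y. y \<sqsubseteq>\<^bsub>Y\<^esub> V} {x \<in> carrier X. x \<sqsubseteq>\<^bsub>X\<^esub> U}))"

text \<open>
  The pullback of maps of locales \<open>f : A \<rightarrow> C\<close> and \<open>g : B \<rightarrow> C\<close>, i.e. the pushout of the frame
  homomorphisms \<open>f\<^sup>*\<close> and \<open>g\<^sup>*\<close>: the frame \<open>A \<otimes>\<^sub>C B\<close> generated by symbols \<open>x \<otimes> y\<close> subject to
  \<open>(x \<otimes> y) \<sqinter> (x' \<otimes> y') = (x \<sqinter> x') \<otimes> (y \<sqinter> y')\<close>, \<open>\<top> \<otimes> \<top> = \<top>\<close>, preservation of arbitrary joins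
  in each variable, and \<open>(f\<^sup>* c \<sqinter> x) \<otimes> y = x \<otimes> (g\<^sup>* c \<sqinter> y)\<close>. Its elements are the downwards closed
  subsets of \<open>A \<times> B\<close> that respect these relations, where a subset \<open>J\<close> stands for the join of all the
  \<open>x \<otimes> y\<close> with \<open>(x, y) \<in> J\<close>. Joins indexed by the empty set are included.
\<close>

definition pb_ideal ::
    "'a gorder \<Rightarrow> 'b gorder \<Rightarrow> 'c gorder \<Rightarrow> ('c \<Rightarrow> 'a) \<Rightarrow> ('c \<Rightarrow> 'b) \<Rightarrow> ('a \<times> 'b) set \<Rightarrow> bool" where
  "pb_ideal A B C f g J \<longleftrightarrow> J \<subseteq> carrier A \<times> carrier B \<and>
     (\<forall>x\<in>carrier A. \<forall>y\<in>carrier B. \<forall>(x', y')\<in>J. x \<sqsubseteq>\<^bsub>A\<^esub> x' \<and> y \<sqsubseteq>\<^bsub>B\<^esub> y' \<longrightarrow> (x, y) \<in> J) \<and>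
     (\<forall>X y. X \<subseteq> carrier A \<longrightarrow> y \<in> carrier B \<longrightarrow> X \<times> {y} \<subseteq> J \<longrightarrow> (\<Squnion>\<^bsub>A\<^esub> X, y) \<in> J) \<and>
     (\<forall>x Y. x \<in> carrier A \<longrightarrow> Y \<subseteq> carrier B \<longrightarrow> {x} \<times> Y \<subseteq> J \<longrightarrow> (x, \<Squnion>\<^bsub>B\<^esub> Y) \<in> J) \<and>
     (\<forall>x\<in>carrier A. \<forall>y\<in>carrier B. \<forall>c\<in>carrier C.
        (f c \<sqinter>\<^bsub>A\<^esub> x, y) \<in> J \<longleftrightarrow> (x, g c \<sqinter>\<^bsub>B\<^esub> y) \<in> J)"

definition pullback ::
    "'a gorder \<Rightarrow> 'b gorder \<Rightarrow> 'c gorder \<Rightarrow> ('c \<Rightarrow> 'a) \<Rightarrow> ('c \<Rightarrow> 'b) \<Rightarrow> ('a \<times> 'b) set gorder" where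
  "pullback A B C f g = \<lparr>carrier = {J. pb_ideal A B C f g J}, eq = (=), le = (\<subseteq>)\<rparr>"

definition pb_tensor ::
    "'a gorder \<Rightarrow> 'b gorder \<Rightarrow> 'c gorder \<Rightarrow> ('c \<Rightarrow> 'a) \<Rightarrow> ('c \<Rightarrow> 'b) \<Rightarrow> 'a \<Rightarrow> 'b \<Rightarrow> ('a \<times> 'b) set" where
  "pb_tensor A B C f g x y = \<Inter>{J. pb_ideal A B C f g J \<and> (x, y) \<in> J}"

definition pb_proj1 ::
    "'a gorder \<Rightarrow> 'b gorder \<Rightarrow> 'c gorder \<Rightarrow> ('c \<Rightarrow> 'a) \<Rightarrow> ('c \<Rightarrow> 'b) \<Rightarrow> 'a \<Rightarrow> ('a \<times> 'b) set" where
  "pb_proj1 A B C f g x = pb_tensor A B C f g x \<top>\<^bsub>B\<^esub>"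

definition pb_proj2 ::
    "'a gorder \<Rightarrow> 'b gorder \<Rightarrow> 'c gorder \<Rightarrow> ('c \<Rightarrow> 'a) \<Rightarrow> ('c \<Rightarrow> 'b) \<Rightarrow> 'b \<Rightarrow> ('a \<times> 'b) set" where
  "pb_proj2 A B C f g y = pb_tensor A B C f g \<top>\<^bsub>A\<^esub> y"

text \<open>
  The inverse image of \<open>\<langle>h, k\<rangle> : X \<rightarrow> A \<times>\<^sub>C B\<close>, for \<open>h : X \<rightarrow> A\<close> and \<open>k : X \<rightarrow> B\<close> with
  \<open>f \<circ> h = g \<circ> k\<close>: it sends \<open>x \<otimes> y\<close> to \<open>h\<^sup>* x \<sqinter> k\<^sup>* y\<close>.
\<close>

definition pairing ::
    "('x, 'm) gorder_scheme \<Rightarrow> ('a \<Rightarrow> 'x) \<Rightarrow> ('b \<Rightarrow> 'x) \<Rightarrow> ('a \<times> 'b) set \<Rightarrow> 'x" where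
  "pairing X h k J = \<Squnion>\<^bsub>X\<^esub> ((\<lambda>(x, y). h x \<sqinter>\<^bsub>X\<^esub> k y) ` J)"


section \<open>Localic etale groupoids and their quantales\<close>

text \<open>
  The maps \<open>d, r : G\<^sub>1 \<rightarrow> G\<^sub>0\<close>, \<open>u : G\<^sub>0 \<rightarrow> G\<^sub>1\<close>, \<open>i : G\<^sub>1 \<rightarrow> G\<^sub>1\<close> and \<open>m : G\<^sub>2 \<rightarrow> G\<^sub>1\<close> are given by their
  inverse images. Arrows are composed from left to right: \<open>G\<^sub>2\<close> is the locale of pairs \<open>(g, h)\<close>
  with \<open>r g = d h\<close>, and \<open>m (g, h) = g h\<close> has domain \<open>d g\<close> and codomain \<open>r h\<close>.
\<close>

record ('o, 'a) groupoid_data =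
  objs :: "'o gorder"
  arrs :: "'a gorder"
  dmap :: "'o \<Rightarrow> 'a"
  rmap :: "'o \<Rightarrow> 'a"
  umap :: "'a \<Rightarrow> 'o"
  imap :: "'a \<Rightarrow> 'a"
  mmap :: "'a \<Rightarrow> ('a \<times> 'a) set"

definition pairs2 :: "('o, 'a) groupoid_data \<Rightarrow> ('a \<times> 'a) set gorder" where
  "pairs2 G = pullback (arrs G) (arrs G) (objs G) (rmap G) (dmap G)"

definition fst2 :: "('o, 'a) groupoid_data \<Rightarrow> 'a \<Rightarrow> ('a \<times> 'a) set" where
  "fst2 G = pb_proj1 (arrs G) (arrs G) (objs G) (rmap G) (dmap G)"

definition snd2 :: "('o, 'a) groupoid_data \<Rightarrow> 'a \<Rightarrow> ('a \<times> 'a) set" where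
  "snd2 G = pb_proj2 (arrs G) (arrs G) (objs G) (rmap G) (dmap G)"

text \<open>Composable triples, encoded as \<open>(g, (h, k))\<close> with \<open>(h, k)\<close> in \<open>G\<^sub>2\<close>.\<close>

definition triples :: "('o, 'a) groupoid_data \<Rightarrow> ('a \<times> ('a \<times> 'a) set) set gorder" where
  "triples G = pullback (arrs G) (pairs2 G) (objs G) (rmap G) (\<lambda>c. fst2 G (dmap G c))"

definition head3 :: "('o, 'a) groupoid_data \<Rightarrow> 'a \<Rightarrow> ('a \<times> ('a \<times> 'a) set) set" where
  "head3 G = pb_proj1 (arrs G) (pairs2 G) (objs G) (rmap G) (\<lambda>c. fst2 G (dmap G c))"

definition tail3 :: "('o, 'a) groupoid_data \<Rightarrow> ('a \<times> 'a) set \<Rightarrow> ('a \<times> ('a \<times> 'a) set) set" where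
  "tail3 G = pb_proj2 (arrs G) (pairs2 G) (objs G) (rmap G) (\<lambda>c. fst2 G (dmap G c))"

text \<open>
  The groupoid axioms below are the usual equations between maps of locales, each read off on
  inverse images; the equation is recalled in the margin of those involving a pairing.
\<close>

locale localic_groupoid =
  fixes G :: "('o, 'a) groupoid_data"
  assumes objs_frame: "frame (objs G)"
    and arrs_frame: "frame (arrs G)"
    and dmap_hom: "dmap G \<in> frame_hom (objs G) (arrs G)"
    and rmap_hom: "rmap G \<in> frame_hom (objs G) (arrs G)"
    and umap_hom: "umap G \<in> frame_hom (arrs G) (objs G)"
    and imap_hom: "imap G \<in> frame_hom (arrs G) (arrs G)"
    and mmap_hom: "mmap G \<in> frame_hom (arrs G) (pairs2 G)"
    and d_u: "a \<in> carrier (objs G) \<Longrightarrow> umap G (dmap G a) = a"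
    and r_u: "a \<in> carrier (objs G) \<Longrightarrow> umap G (rmap G a) = a"
    and d_m: "a \<in> carrier (objs G) \<Longrightarrow> mmap G (dmap G a) = fst2 G (dmap G a)"
    and r_m: "a \<in> carrier (objs G) \<Longrightarrow> mmap G (rmap G a) = snd2 G (rmap G a)"
    and unit_left: \<comment> \<open>\<open>m (u (d g), g) = g\<close>\<close>
      "x \<in> carrier (arrs G) \<Longrightarrow>
         pairing (arrs G) (\<lambda>y. dmap G (umap G y)) (\<lambda>y. y) (mmap G x) = x"
    and unit_right: \<comment> \<open>\<open>m (g, u (r g)) = g\<close>\<close>
      "x \<in> carrier (arrs G) \<Longrightarrow>
         pairing (arrs G) (\<lambda>y. y) (\<lambda>y. rmap G (umap G y)) (mmap G x) = x"
    and assoc: \<comment> \<open>\<open>m (g, m (h, k)) = m (m (g, h), k)\<close>\<close>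
      "x \<in> carrier (arrs G) \<Longrightarrow>
         pairing (triples G) (head3 G) (\<lambda>y. tail3 G (mmap G y)) (mmap G x) =
         pairing (triples G)
           (\<lambda>y. pairing (triples G) (head3 G) (\<lambda>z. tail3 G (fst2 G z)) (mmap G y))
           (\<lambda>y. tail3 G (snd2 G y)) (mmap G x)"
    and d_i: "a \<in> carrier (objs G) \<Longrightarrow> imap G (dmap G a) = rmap G a"
    and r_i: "a \<in> carrier (objs G) \<Longrightarrow> imap G (rmap G a) = dmap G a"
    and inverse_right: \<comment> \<open>\<open>m (g, i g) = u (d g)\<close>\<close>
      "x \<in> carrier (arrs G) \<Longrightarrow>
         pairing (arrs G) (\<lambda>y. y) (imap G) (mmap G x) = dmap G (umap G x)"
    and inverse_left: \<comment> \<open>\<open>m (i g, g) = u (r g)\<close>\<close>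
      "x \<in> carrier (arrs G) \<Longrightarrow>
         pairing (arrs G) (imap G) (\<lambda>y. y) (mmap G x) = rmap G (umap G x)"

locale localic_etale_groupoid = localic_groupoid +
  assumes d_local_homeo: "local_homeomorphism (arrs G) (objs G) (dmap G)"

text \<open>
  The canonical map \<open>\<O>(G\<^sub>1) \<otimes> \<O>(G\<^sub>1) \<rightarrow> \<O>(G\<^sub>2)\<close> sends \<open>x \<otimes> y\<close> to the meet of the inverse images of
  \<open>x\<close> and \<open>y\<close> under the two projections, so that \<open>x \<cdot> y = m\<^sub>!(\<pi>\<^sub>1\<^sup>* x \<sqinter> \<pi>\<^sub>2\<^sup>* y)\<close>.
\<close>

definition groupoid_quantale :: "('o, 'a) groupoid_data \<Rightarrow> 'a uiquantale" (\<open>\<O>\<close>) where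
  "\<O> G =
     \<lparr>carrier = carrier (arrs G), eq = eq (arrs G), le = le (arrs G),
      qmult = (\<lambda>x y. direct_image (pairs2 G) (arrs G) (mmap G) (fst2 G x \<sqinter>\<^bsub>pairs2 G\<^esub> snd2 G y)),
      qstar = imap G,
      qunit = direct_image (objs G) (arrs G) (umap G) \<top>\<^bsub>objs G\<^esub>\<rparr>"

end

theory Submission
  imports Defs "HOL.Hull"
begin

text \<open>
  Write \<open>R\<close> for \<open>\<O> G\<close> and \<open>e\<close> for its unit. The frame \<open>R\<close> is covered by its partial units, the elements
  \<open>s\<close> with \<open>s\<^sup>* s \<le> e\<close> and \<open>s s\<^sup>* \<le> e\<close>, and the homomorphism \<open>q\<^sup>* : R \<rightarrow> Q\<close> sends each of them into the
  pseudogroup \<open>\<I>\<^sub>b(Q)\<close> of the projection \<open>b = q\<^sup>* e\<close>. Since \<open>Q\<close> is stably Gelfand, the elements of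
  \<open>\<I>\<^sub>b(Q)\<close> satisfy \<open>s s\<^sup>* s = s\<close>; it follows that the inverse of \<open>s\<close> is \<open>s\<^sup>*\<close>, that the idempotents are
  the elements below \<open>b\<close>, and that the natural order and the joins of compatible sets are those of \<open>Q\<close>.

  If \<open>k\<close> is a unital factorization of \<open>q\<close> and \<open>s\<close> is a partial unit, then the ideal \<open>J = k\<^sup>* s\<close> satisfies
  \<open>J\<^sup>* J, J J\<^sup>* \<subseteq> E\<close>, so that \<open>J\<close> is a compatible set. Hence it contains its join, which is \<open>q\<^sup>* s\<close>, and
  \<open>k\<^sup>* s\<close> is the principal ideal of \<open>q\<^sup>* s\<close>. As partial units cover, \<open>k\<close> is unique
  (\<open>factorization_unique\<close>). Conversely, let \<open>k\<^sup>* x\<close> be the compatible ideal generated by the elements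
  \<open>q\<^sup>* s\<close> of \<open>\<I>\<^sub>b(Q)\<close> with \<open>s \<le> x\<close>. It preserves joins because \<open>R\<close> is a frame: if \<open>s \<le> \<Squnion>X\<close>, then
  \<open>q\<^sup>* s\<close> is the join of the compatible set of the \<open>q\<^sup>* (s \<sqinter> x)\<close> with \<open>x\<close> in \<open>X\<close>. It preserves products
  because each \<open>x y\<close> is the join of products of partial units (\<open>factor_mult\<close>). If \<open>q\<^sup>* = \<phi>\<^sub>b \<circ> k\<^sup>*\<close> is
  injective, then so is \<open>k\<^sup>*\<close>.

  It remains to derive from the groupoid axioms that \<open>R\<close> is a frame with a unit, an involution and a
  join-preserving multiplication, covered by partial units (\<open>partial_unit_quantale\<close>). For this, the
  universal property of the pullback \<open>G\<^sub>2\<close> turns the groupoid axioms into the laws of a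
  groupoid for the generalized arrows \<open>X \<rightarrow> G\<^sub>1\<close>, and the arguments can be carried out as if \<open>G\<close> had
  points. Two generalized arrows with the same domain that lie in an open part \<open>U\<close> on which \<open>d\<close> is
  injective are equal (\<open>bisection_unique\<close>); this yields the unit \<open>e\<close> as the open image of \<open>u\<close>, the partial
  units, and, through \<open>bisection_product\<close>, the left adjoint \<open>m\<^sub>!\<close> on which the multiplication rests.
\<close>


section \<open>Complete lattices and frames\<close>

lemma (in partial_order) sup_eqI:
  assumes "X \<subseteq> carrier L" "s \<in> carrier L"
    and "\<And>x. x \<in> X \<Longrightarrow> x \<sqsubseteq> s"
    and "\<And>z. \<lbrakk>z \<in> carrier L; \<And>x. x \<in> X \<Longrightarrow> x \<sqsubseteq> z\<rbrakk> \<Longrightarrow> s \<sqsubseteq> z"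
  shows "\<Squnion>X = s"
proof -
  have "least L s (Upper L X)"
    using assms by (intro least_UpperI) (auto simp: Upper_def subset_iff)
  then show ?thesis
    unfolding sup_def by (blast intro: some_equality least_unique)
qed

lemma (in partial_order) inf_eqI:
  assumes "X \<subseteq> carrier L" "s \<in> carrier L"
    and "\<And>x. x \<in> X \<Longrightarrow> s \<sqsubseteq> x"
    and "\<And>z. \<lbrakk>z \<in> carrier L; \<And>x. x \<in> X \<Longrightarrow> z \<sqsubseteq> x\<rbrakk> \<Longrightarrow> z \<sqsubseteq> s"
  shows "\<Sqinter>X = s"
proof -
  have "greatest L s (Lower L X)"
    using assms by (intro greatest_LowerI) (auto simp: Lower_def subset_iff)
  then show ?thesis
    unfolding inf_def by (blast intro: some_equality greatest_unique)
qed

lemma (in partial_order) meet_eqI: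
  assumes "x \<in> carrier L" "y \<in> carrier L" "s \<in> carrier L" "s \<sqsubseteq> x" "s \<sqsubseteq> y"
    and "\<And>z. \<lbrakk>z \<in> carrier L; z \<sqsubseteq> x; z \<sqsubseteq> y\<rbrakk> \<Longrightarrow> z \<sqsubseteq> s"
  shows "x \<sqinter> y = s"
  unfolding meet_def by (rule inf_eqI) (use assms in auto)

lemma (in partial_order) top_eqI:
  assumes "s \<in> carrier L" "\<And>z. z \<in> carrier L \<Longrightarrow> z \<sqsubseteq> s"
  shows "\<top> = s"
proof -
  have "greatest L s (carrier L)"
    using assms by (auto simp: greatest_def)
  then show ?thesis
    unfolding top_def by (blast intro: some_equality greatest_unique)
qed

lemma (in complete_lattice) sup_le_iff:
  assumes "X \<subseteq> carrier L" "z \<in> carrier L"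
  shows "\<Squnion>X \<sqsubseteq> z \<longleftrightarrow> (\<forall>x\<in>X. x \<sqsubseteq> z)"
proof
  assume "\<Squnion>X \<sqsubseteq> z"
  then show "\<forall>x\<in>X. x \<sqsubseteq> z"
    using assms by (meson le_trans subsetD sup_closed sup_upper)
qed (use assms in \<open>auto intro: sup_least\<close>)

lemma (in complete_lattice) sup_mono:
  assumes "X \<subseteq> Y" "Y \<subseteq> carrier L"
  shows "\<Squnion>X \<sqsubseteq> \<Squnion>Y"
proof (rule sup_least)
  show "x \<sqsubseteq> \<Squnion>Y" if "x \<in> X" for x
    using assms that by (intro sup_upper) auto
qed (use assms in auto)

lemma (in complete_lattice) le_meet_iff:
  assumes "x \<in> carrier L" "y \<in> carrier L" "z \<in> carrier L"
  shows "z \<sqsubseteq> x \<sqinter> y \<longleftrightarrow> z \<sqsubseteq> x \<and> z \<sqsubseteq> y"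
proof
  assume "z \<sqsubseteq> x \<sqinter> y"
  then show "z \<sqsubseteq> x \<and> z \<sqsubseteq> y"
    using le_trans[OF _ meet_left[OF assms(1,2)]] le_trans[OF _ meet_right[OF assms(1,2)]] assms by auto
qed (use assms in \<open>auto intro: meet_le\<close>)

lemma (in complete_lattice) meet_mono:
  assumes "x \<sqsubseteq> x'" "y \<sqsubseteq> y'" "x \<in> carrier L" "y \<in> carrier L" "x' \<in> carrier L" "y' \<in> carrier L"
  shows "x \<sqinter> y \<sqsubseteq> x' \<sqinter> y'"
  using le_trans[OF meet_left[OF assms(3,4)] assms(1)] le_trans[OF meet_right[OF assms(3,4)] assms(2)] assms
  by (simp add: le_meet_iff)

lemma (in complete_lattice) meet_absorb:
  assumes "x \<in> carrier L" "y \<in> carrier L" "x \<sqsubseteq> y"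
  shows "x \<sqinter> y = x" and "y \<sqinter> x = x"
  using assms by (auto intro!: meet_eqI)

lemma (in complete_lattice) meet_top:
  assumes "x \<in> carrier L"
  shows "x \<sqinter> \<top> = x" and "\<top> \<sqinter> x = x"
  using assms by (auto intro!: meet_absorb)

lemma (in complete_lattice) le_iff_meet:
  assumes "x \<in> carrier L" "y \<in> carrier L"
  shows "x \<sqsubseteq> y \<longleftrightarrow> x \<sqinter> y = x"
  using assms meet_absorb(1) meet_right by metis

lemma (in complete_lattice) meet_meet_swap:
  assumes "a \<in> carrier L" "b \<in> carrier L" "c \<in> carrier L" "d \<in> carrier L"
  shows "(a \<sqinter> b) \<sqinter> (c \<sqinter> d) = (a \<sqinter> c) \<sqinter> (b \<sqinter> d)"
  using assms by (metis meet_assoc meet_closed meet_comm)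

lemma (in complete_lattice) meet_meet_distrib:
  assumes "a \<in> carrier L" "b \<in> carrier L" "c \<in> carrier L"
  shows "(a \<sqinter> b) \<sqinter> c = (a \<sqinter> c) \<sqinter> (b \<sqinter> c)"
  using meet_meet_swap[of a b c c] meet_absorb[of c c] assms by simp

lemma (in frame) Sup_meet:
  assumes "x \<in> carrier L" "X \<subseteq> carrier L"
  shows "(\<Squnion>X) \<sqinter> x = \<Squnion>((\<lambda>y. y \<sqinter> x) ` X)"
  using meet_Sup[OF assms] by (simp add: meet_comm)

lemma (in frame) Sup_meet_Sup_le:
  assumes "X \<subseteq> carrier L" "Y \<subseteq> carrier L" "z \<in> carrier L"
    and "\<And>x y. \<lbrakk>x \<in> X; y \<in> Y\<rbrakk> \<Longrightarrow> x \<sqinter> y \<sqsubseteq> z"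
  shows "\<Squnion>X \<sqinter> \<Squnion>Y \<sqsubseteq> z"
proof -
  have "\<Squnion>X \<sqinter> y \<sqsubseteq> z" if "y \<in> Y" for y
    using that assms by (subst Sup_meet) (auto simp: subset_iff intro!: sup_least)
  then show ?thesis
    using assms by (subst meet_Sup) (auto simp: subset_iff intro!: sup_least)
qed

text \<open>Families of sets closed under intersection, ordered by inclusion.\<close>

locale closure_system =
  fixes L :: "('a set, 'm) gorder_scheme" (structure) and T :: "'a set"
  assumes eq_eq: "eq L = (=)"
    and le_subset: "le L = (\<subseteq>)"
    and whole: "T \<in> carrier L"
    and bounded: "J \<in> carrier L \<Longrightarrow> J \<subseteq> T"
    and Inter_closed: "\<lbrakk>F \<subseteq> carrier L; F \<noteq> {}\<rbrakk> \<Longrightarrow> \<Inter>F \<in> carrier L"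
begin

sublocale complete_lattice L
proof -
  interpret partial_order L
    by unfold_locales (auto simp: eq_eq le_subset)
  show "complete_lattice L"
  proof (rule complete_lattice_criterion1)
    show "\<exists>g. greatest L g (carrier L)"
      using whole bounded by (auto simp: greatest_def le_subset)
    show "\<exists>i. greatest L i (Lower L F)" if "F \<subseteq> carrier L" "F \<noteq> {}" for F
      using Inter_closed[OF that] that
      by (intro exI[of _ "\<Inter>F"]) (auto simp: greatest_def Lower_def le_subset)
  qed
qed

lemma meet_eq:
  assumes "J \<in> carrier L" "K \<in> carrier L"
  shows "J \<sqinter> K = J \<inter> K"
  using Inter_closed[of "{J, K}"] assms by (intro meet_eqI) (auto simp: le_subset)

lemma top_eq: "\<top> = T"
  using whole bounded by (intro top_eqI) (auto simp: le_subset)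

end

text \<open>The open sublocale given by \<open>z\<close>, represented by its frame of elements below \<open>z\<close>.\<close>

definition below :: "('a, 'm) gorder_scheme \<Rightarrow> 'a \<Rightarrow> ('a, 'm) gorder_scheme" where
  "below L z = L\<lparr>carrier := {x \<in> carrier L. x \<sqsubseteq>\<^bsub>L\<^esub> z}\<rparr>"

lemma carrier_below [simp]: "carrier (below L z) = {x \<in> carrier L. x \<sqsubseteq>\<^bsub>L\<^esub> z}"
  and le_below [simp]: "le (below L z) = le L"
  and eq_below [simp]: "eq (below L z) = eq L"
  by (simp_all add: below_def)

lemma (in complete_lattice) below_top: "below L \<top> = L"
proof -
  have "{x \<in> carrier L. x \<sqsubseteq> \<top>} = carrier L"
    by auto
  then show ?thesis
    by (simp add: below_def)
qed

context frame
begin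

context
  fixes z
  assumes z: "z \<in> carrier L"
begin

lemma partial_order_below: "partial_order (below L z)"
  by unfold_locales (auto simp: eq_is_equal intro: le_trans)

lemma Sup_below:
  assumes "X \<subseteq> carrier (below L z)"
  shows "\<Squnion>\<^bsub>below L z\<^esub> X = \<Squnion>X"
proof -
  have "X \<subseteq> carrier L" using assms by auto
  with assms z show ?thesis
    by (intro partial_order.sup_eqI[OF partial_order_below]) (auto intro: sup_upper sup_least)
qed

lemma meet_below:
  assumes "x \<in> carrier (below L z)" "y \<in> carrier (below L z)"
  shows "x \<sqinter>\<^bsub>below L z\<^esub> y = x \<sqinter> y"
  using assms z
  by (intro partial_order.meet_eqI[OF partial_order_below])
    (auto intro: meet_left meet_right meet_le le_trans[OF meet_left])

lemma top_below: "\<top>\<^bsub>below L z\<^esub> = z"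
  using z by (intro partial_order.top_eqI[OF partial_order_below]) auto

lemma frame_below: "frame (below L z)"
proof -
  interpret M: partial_order "below L z" by (rule partial_order_below)
  interpret M: complete_lattice "below L z"
  proof (rule M.complete_lattice_criterion1)
    show "\<exists>g. greatest (below L z) g (carrier (below L z))"
      using z by (auto simp: greatest_def)
    show "\<exists>i. greatest (below L z) i (Lower (below L z) X)"
      if "X \<subseteq> carrier (below L z)" and ne: "X \<noteq> {}" for X
    proof (intro exI[of _ "\<Sqinter>X"] greatest_LowerI)
      have X: "X \<subseteq> carrier L" using that by auto
      obtain x where "x \<in> X" using ne by blast
      then have "\<Sqinter>X \<sqsubseteq> z"
        using that X z by (intro le_trans[OF inf_lower[OF X \<open>x \<in> X\<close>]]) auto
      then show "\<Sqinter>X \<in> carrier (below L z)"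
        using X by simp
    qed (use that in \<open>auto intro!: inf_lower inf_greatest simp: Lower_def\<close>)
  qed
  show ?thesis
  proof
    fix x X assume x: "x \<in> carrier (below L z)" and X: "X \<subseteq> carrier (below L z)"
    have "\<Squnion>X \<in> carrier (below L z)"
      using M.sup_closed[OF X] by (simp add: Sup_below[OF X])
    moreover have "(\<lambda>y. x \<sqinter>\<^bsub>below L z\<^esub> y) ` X = (\<lambda>y. x \<sqinter> y) ` X"
      using x X by (intro image_cong) (auto simp: meet_below)
    moreover have "(\<lambda>y. x \<sqinter> y) ` X \<subseteq> carrier (below L z)"
      using x X z by (auto intro!: le_trans[OF meet_left, of x _ z])
    ultimately show "x \<sqinter>\<^bsub>below L z\<^esub> (\<Squnion>\<^bsub>below L z\<^esub> X) = \<Squnion>\<^bsub>below L z\<^esub> ((\<lambda>y. x \<sqinter>\<^bsub>below L z\<^esub> y) ` X)"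
      using x X meet_Sup[of x X] by (simp add: Sup_below meet_below subset_iff)
  qed
qed

end

end


subsection \<open>Frame homomorphisms\<close>

text \<open>A homomorphism \<open>f\<close> of frames, i.e. the inverse image of a map of locales \<open>M \<rightarrow> L\<close>.\<close>

locale frame_morphism = dom: frame L + cod: frame M
  for L :: "('a, 'm) gorder_scheme" and M :: "('b, 'n) gorder_scheme" and f :: "'a \<Rightarrow> 'b" +
  assumes hom: "f \<in> frame_hom L M"
begin

lemma closed [simp]: "x \<in> carrier L \<Longrightarrow> f x \<in> carrier M"
  and hom_Sup: "X \<subseteq> carrier L \<Longrightarrow> f (\<Squnion>\<^bsub>L\<^esub> X) = \<Squnion>\<^bsub>M\<^esub> (f ` X)"
  and hom_meet: "\<lbrakk>x \<in> carrier L; y \<in> carrier L\<rbrakk> \<Longrightarrow> f (x \<sqinter>\<^bsub>L\<^esub> y) = f x \<sqinter>\<^bsub>M\<^esub> f y"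
  and hom_top: "f \<top>\<^bsub>L\<^esub> = \<top>\<^bsub>M\<^esub>"
  using hom by (auto simp: frame_hom_def)

lemma hom_mono:
  assumes "x \<in> carrier L" "y \<in> carrier L" "x \<sqsubseteq>\<^bsub>L\<^esub> y"
  shows "f x \<sqsubseteq>\<^bsub>M\<^esub> f y"
  using assms by (metis closed cod.le_iff_meet dom.le_iff_meet hom_meet)

end

lemma frame_homI:
  assumes "\<And>x. x \<in> carrier L \<Longrightarrow> f x \<in> carrier M"
    and "\<And>X. X \<subseteq> carrier L \<Longrightarrow> f (\<Squnion>\<^bsub>L\<^esub> X) = \<Squnion>\<^bsub>M\<^esub> (f ` X)"
    and "\<And>x y. \<lbrakk>x \<in> carrier L; y \<in> carrier L\<rbrakk> \<Longrightarrow> f (x \<sqinter>\<^bsub>L\<^esub> y) = f x \<sqinter>\<^bsub>M\<^esub> f y"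
    and "f \<top>\<^bsub>L\<^esub> = \<top>\<^bsub>M\<^esub>"
  shows "f \<in> frame_hom L M"
  using assms by (auto simp: frame_hom_def)

lemma frame_hom_comp:
  assumes "f \<in> frame_hom L M" "g \<in> frame_hom M N"
  shows "(\<lambda>x. g (f x)) \<in> frame_hom L N"
proof (rule frame_homI)
  fix X assume X: "X \<subseteq> carrier L"
  then have "f ` X \<subseteq> carrier M"
    using assms by (auto simp: frame_hom_def)
  then show "g (f (\<Squnion>\<^bsub>L\<^esub> X)) = \<Squnion>\<^bsub>N\<^esub> ((\<lambda>x. g (f x)) ` X)"
    using assms X by (simp add: frame_hom_def image_image)
qed (use assms in \<open>auto simp: frame_hom_def Pi_iff\<close>)

lemma frame_hom_ident: "(\<lambda>x. x) \<in> frame_hom L L"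
  by (rule frame_homI) auto

text \<open>The inclusion of an open sublocale has the inverse image \<open>x \<mapsto> x \<sqinter> z\<close>.\<close>

lemma (in frame) frame_hom_restrict:
  assumes "z \<in> carrier L"
  shows "(\<lambda>x. x \<sqinter> z) \<in> frame_hom L (below L z)"
proof (rule frame_homI)
  show "x \<in> carrier L \<Longrightarrow> x \<sqinter> z \<in> carrier (below L z)" for x
    using assms by (simp add: meet_right)
  fix X assume X: "X \<subseteq> carrier L"
  have "(\<lambda>y. y \<sqinter> z) ` X \<subseteq> carrier (below L z)"
    using X assms by (auto intro: meet_right)
  then show "(\<Squnion>X) \<sqinter> z = \<Squnion>\<^bsub>below L z\<^esub> ((\<lambda>x. x \<sqinter> z) ` X)"
    using X assms Sup_meet[of z X] by (simp only: Sup_below)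
next
  fix x y assume "x \<in> carrier L" "y \<in> carrier L"
  then show "(x \<sqinter> y) \<sqinter> z = (x \<sqinter> z) \<sqinter>\<^bsub>below L z\<^esub> (y \<sqinter> z)"
    using assms by (subst meet_below) (auto intro: meet_right meet_meet_distrib)
qed (use assms in \<open>simp add: top_below meet_top\<close>)

text \<open>The restriction of a map of locales to an open part \<open>z\<close> of its codomain.\<close>

lemma (in frame_morphism) frame_hom_below:
  assumes "z \<in> carrier L"
  shows "f \<in> frame_hom (below L z) (below M (f z))"
proof (rule frame_homI)
  show *: "x \<in> carrier (below L z) \<Longrightarrow> f x \<in> carrier (below M (f z))" for x
    using assms by (auto intro: hom_mono)
  fix X assume X: "X \<subseteq> carrier (below L z)"
  then have "f ` X \<subseteq> carrier (below M (f z))"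
    using * by blast
  with X show "f (\<Squnion>\<^bsub>below L z\<^esub> X) = \<Squnion>\<^bsub>below M (f z)\<^esub> (f ` X)"
    using assms hom_Sup[of X] by (simp only: closed dom.Sup_below cod.Sup_below) auto
next
  fix x y assume xy: "x \<in> carrier (below L z)" "y \<in> carrier (below L z)"
  then have "f x \<in> carrier (below M (f z))" "f y \<in> carrier (below M (f z))"
    using assms by (auto intro: hom_mono)
  with xy show "f (x \<sqinter>\<^bsub>below L z\<^esub> y) = f x \<sqinter>\<^bsub>below M (f z)\<^esub> f y"
    using assms hom_meet[of x y] by (simp only: closed dom.meet_below cod.meet_below) auto
qed (use assms in \<open>simp add: dom.top_below cod.top_below\<close>)


section \<open>The pseudogroup of a projection\<close>

context involutive_quantale
begin

lemma qmult_mono: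
  assumes "a \<sqsubseteq> a'" "c \<sqsubseteq> c'" and cl: "a \<in> carrier Q" "a' \<in> carrier Q" "c \<in> carrier Q" "c' \<in> carrier Q"
  shows "a \<cdot> c \<sqsubseteq> a' \<cdot> c'"
proof -
  have "\<Squnion>{c, c'} = c'" "\<Squnion>{a, a'} = a'"
    using assms by (auto intro!: sup_eqI)
  then have "a \<cdot> c' = \<Squnion>{a \<cdot> c, a \<cdot> c'}" "a' \<cdot> c' = \<Squnion>{a \<cdot> c', a' \<cdot> c'}"
    using qmult_Sup[of a "{c, c'}"] Sup_qmult[of c' "{a, a'}"] cl by simp_all
  then have "a \<cdot> c \<sqsubseteq> a \<cdot> c'" "a \<cdot> c' \<sqsubseteq> a' \<cdot> c'"
    using sup_upper[of "{a \<cdot> c, a \<cdot> c'}" "a \<cdot> c"] sup_upper[of "{a \<cdot> c', a' \<cdot> c'}" "a \<cdot> c'"] cl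
    by (simp_all add: qmult_closed)
  then show ?thesis
    by (rule le_trans) (simp_all add: cl qmult_closed)
qed

lemma qstar_mono:
  assumes "a \<sqsubseteq> c" and cl: "a \<in> carrier Q" "c \<in> carrier Q"
  shows "qstar Q a \<sqsubseteq> qstar Q c"
proof -
  have "\<Squnion>{a, c} = c"
    using assms by (auto intro!: sup_eqI)
  then have "qstar Q c = \<Squnion>{qstar Q a, qstar Q c}"
    using qstar_Sup[of "{a, c}"] cl by simp
  then show ?thesis
    using sup_upper[of "{qstar Q a, qstar Q c}" "qstar Q a"] cl by (simp add: qstar_closed)
qed

end

text \<open>A stably Gelfand quantale with a projection \<open>b\<close>; \<open>S\<close> is the pseudogroup \<open>\<I>\<^sub>b(Q)\<close>.\<close>

locale gelfand_projection = stably_gelfand_quantale Q for Q (structure) +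
  fixes b
  assumes projection: "projection Q b"
begin

abbreviation star where "star \<equiv> qstar Q"
abbreviation "S \<equiv> proj_pseudogroup Q b"

lemmas closed = qmult_closed qstar_closed

lemma b_closed: "b \<in> carrier Q" and b_b: "b \<cdot> b = b" and star_b: "star b = b"
  using projection by (simp_all add: projection_def)

lemma mult_S: "s \<otimes>\<^bsub>S\<^esub> t = s \<cdot> t"
  by (simp add: proj_pseudogroup_def)

lemma carrier_S: "s \<in> carrier S \<longleftrightarrow>
    s \<in> carrier Q \<and> star s \<cdot> s \<sqsubseteq> b \<and> s \<cdot> star s \<sqsubseteq> b \<and> s \<cdot> b \<sqsubseteq> s \<and> b \<cdot> s \<sqsubseteq> s"
  by (simp add: proj_pseudogroup_def)

lemma S_subset: "carrier S \<subseteq> carrier Q"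
  by (auto simp: carrier_S)

lemma S_Q: "s \<in> carrier S \<Longrightarrow> s \<in> carrier Q"
  by (simp add: carrier_S)

lemma S_regular:
  assumes s: "s \<in> carrier S"
  shows "s \<cdot> star s \<cdot> s = s"
proof (rule stably_gelfand)
  have "s \<cdot> star s \<cdot> s \<sqsubseteq> b \<cdot> s"
    using s b_closed by (intro qmult_mono) (auto simp: carrier_S closed)
  also have "\<dots> \<sqsubseteq> s"
    using s by (simp add: carrier_S)
  finally show "s \<cdot> star s \<cdot> s \<sqsubseteq> s"
    using s b_closed by (simp add: carrier_S closed)
qed (rule S_Q[OF s])

lemma S_mult_b:
  assumes s: "s \<in> carrier S"
  shows "s \<cdot> b = s"
proof (rule le_antisym)
  have "s \<cdot> (star s \<cdot> s) \<sqsubseteq> s \<cdot> b"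
    using s b_closed by (intro qmult_mono) (auto simp: carrier_S closed)
  then show "s \<sqsubseteq> s \<cdot> b"
    using S_regular[OF s] S_Q[OF s] by (simp add: qmult_assoc closed)
qed (use s b_closed in \<open>auto simp: carrier_S closed\<close>)

lemma b_mult_S:
  assumes s: "s \<in> carrier S"
  shows "b \<cdot> s = s"
proof (rule le_antisym)
  have "(s \<cdot> star s) \<cdot> s \<sqsubseteq> b \<cdot> s"
    using s b_closed by (intro qmult_mono) (auto simp: carrier_S closed)
  then show "s \<sqsubseteq> b \<cdot> s"
    using S_regular[OF s] by simp
qed (use s b_closed in \<open>auto simp: carrier_S closed\<close>)

lemma S_star:
  assumes s: "s \<in> carrier S"
  shows "star s \<in> carrier S"
proof -
  have "star s \<cdot> b = star s" "b \<cdot> star s = star s"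
    using qstar_qmult[of b s] qstar_qmult[of s b] S_mult_b[OF s] b_mult_S[OF s] S_Q[OF s] b_closed
    by (simp_all add: star_b)
  then show ?thesis
    using s by (simp add: carrier_S closed qstar_qstar)
qed

lemma conj_le_b:
  assumes s: "s \<in> carrier S" and a: "a \<in> carrier Q" "a \<sqsubseteq> b"
  shows "s \<cdot> a \<cdot> star s \<sqsubseteq> b"
proof -
  have "s \<cdot> a \<cdot> star s \<sqsubseteq> s \<cdot> b \<cdot> star s"
    using s a b_closed by (intro qmult_mono) (auto simp: S_Q closed)
  also have "\<dots> \<sqsubseteq> b"
    using s by (simp add: S_mult_b) (simp add: carrier_S)
  finally show ?thesis
    using s a b_closed by (simp add: S_Q closed)
qed

lemma conj_star_le_b:
  assumes "s \<in> carrier S" "a \<in> carrier Q" "a \<sqsubseteq> b"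
  shows "star s \<cdot> a \<cdot> s \<sqsubseteq> b"
  using conj_le_b[OF S_star assms(2,3)] assms(1) by (simp add: qstar_qstar S_Q)

lemma S_mult:
  assumes s: "s \<in> carrier S" and t: "t \<in> carrier S"
  shows "s \<cdot> t \<in> carrier S"
proof -
  have cl: "s \<in> carrier Q" "t \<in> carrier Q"
    using s t by (auto simp: S_Q)
  have "star t \<cdot> (star s \<cdot> s) \<cdot> t \<sqsubseteq> b" "s \<cdot> (t \<cdot> star t) \<cdot> star s \<sqsubseteq> b"
    using s t by (auto intro!: conj_star_le_b conj_le_b simp: closed carrier_S)
  moreover have "s \<cdot> t \<cdot> b = s \<cdot> t" "b \<cdot> (s \<cdot> t) = s \<cdot> t"
    using cl b_closed S_mult_b[OF t] b_mult_S[OF s] by (simp_all add: qmult_assoc) (simp add: qmult_assoc[symmetric])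
  ultimately show ?thesis
    using cl by (simp add: carrier_S closed qstar_qmult qmult_assoc)
qed

lemma b_S: "b \<in> carrier S"
  using b_closed by (simp add: carrier_S b_b star_b)

lemma le_b_idempotent:
  assumes a: "a \<in> carrier S" and le: "a \<sqsubseteq> b"
  shows "star a = a" "a \<cdot> a = a"
proof -
  have cl: "a \<in> carrier Q"
    using a by (rule S_Q)
  have star_le: "star a \<sqsubseteq> b"
    using qstar_mono[OF le cl b_closed] by (simp add: star_b)
  have "a = a \<cdot> star a"
  proof (rule le_antisym)
    have "(a \<cdot> star a) \<cdot> a \<sqsubseteq> (a \<cdot> star a) \<cdot> b"
      using le cl b_closed by (intro qmult_mono) (auto simp: closed)
    then show "a \<sqsubseteq> a \<cdot> star a"
      using S_regular[OF a] S_mult_b[OF S_star[OF a]] cl b_closed by (simp add: qmult_assoc closed)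
    have "a \<cdot> star a \<sqsubseteq> a \<cdot> b"
      using star_le cl b_closed by (intro qmult_mono) (auto simp: closed)
    then show "a \<cdot> star a \<sqsubseteq> a"
      by (simp add: S_mult_b[OF a])
  qed (auto simp: cl closed)
  then have "star a = star (a \<cdot> star a)"
    by simp
  also have "\<dots> = a \<cdot> star a"
    using cl by (simp add: qstar_qmult qstar_qstar closed)
  finally show "star a = a"
    using \<open>a = a \<cdot> star a\<close> by simp
  with \<open>a = a \<cdot> star a\<close> show "a \<cdot> a = a"
    by simp
qed

lemma idempotent_le_b:
  assumes f: "f \<in> carrier S" and ff: "f \<cdot> f = f"
  shows "f \<sqsubseteq> b"
proof -
  have cl: "f \<in> carrier Q"
    using f by (rule S_Q)
  have "star f \<cdot> star f = star f"
    using qstar_qmult[OF cl cl] ff by simp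
  \<comment> \<open>\<open>f = f f\<^sup>* f = f (f f)\<^sup>* f\<close>\<close>
  then have "f = (f \<cdot> star f) \<cdot> (star f \<cdot> f)"
    using S_regular[OF f] cl
    by (metis closed(1,2) qmult_assoc)
  also have "\<dots> \<sqsubseteq> b \<cdot> b"
    using f b_closed by (intro qmult_mono) (auto simp: closed carrier_S)
  finally show ?thesis
    by (simp add: b_b)
qed

lemma idems_S: "idems S = {a \<in> carrier S. a \<sqsubseteq> b}"
  using le_b_idempotent idempotent_le_b by (auto simp: idems_def mult_S)

lemma idems_commute:
  assumes a: "a \<in> carrier S" "a \<sqsubseteq> b" and c: "c \<in> carrier S" "c \<sqsubseteq> b"
  shows "a \<cdot> c = c \<cdot> a"
proof -
  have "a \<cdot> c \<sqsubseteq> b \<cdot> b"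
    using a c b_closed by (intro qmult_mono) (auto simp: S_Q)
  then have "star (a \<cdot> c) = a \<cdot> c"
    using a c by (intro le_b_idempotent S_mult) (simp_all add: b_b)
  then show ?thesis
    using a c by (simp add: qstar_qmult S_Q le_b_idempotent)
qed

lemma star_mult_S: "s \<in> carrier S \<Longrightarrow> star s \<cdot> s \<in> carrier S \<and> star s \<cdot> s \<sqsubseteq> b"
  and mult_star_S: "s \<in> carrier S \<Longrightarrow> s \<cdot> star s \<in> carrier S \<and> s \<cdot> star s \<sqsubseteq> b"
  using S_mult S_star by (auto simp: carrier_S)

lemma sg_inv_S:
  assumes s: "s \<in> carrier S"
  shows "sg_inv S s = star s"
  unfolding sg_inv_def mult_S
proof (rule the_equality)
  show "star s \<in> carrier S \<and> s \<cdot> star s \<cdot> s = s \<and> star s \<cdot> s \<cdot> star s = star s"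
    using S_regular[OF s] S_regular[OF S_star[OF s]] S_star[OF s] s by (simp add: qstar_qstar S_Q)
next
  fix t assume t: "t \<in> carrier S \<and> s \<cdot> t \<cdot> s = s \<and> t \<cdot> s \<cdot> t = t"
  have cl: "s \<in> carrier Q" "t \<in> carrier Q" "star s \<in> carrier Q"
    using s t by (auto simp: S_Q closed)
  have st: "(s \<cdot> t) \<cdot> (s \<cdot> t) = s \<cdot> t" and ts: "(t \<cdot> s) \<cdot> (t \<cdot> s) = t \<cdot> s"
    using t cl by (simp_all add: qmult_assoc[symmetric] closed)
  note st_b = idempotent_le_b[OF S_mult[OF s conjunct1[OF t]] st]
    and ts_b = idempotent_le_b[OF S_mult[OF conjunct1[OF t] s] ts]
  have c1: "(s \<cdot> star s) \<cdot> (s \<cdot> t) = (s \<cdot> t) \<cdot> (s \<cdot> star s)"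
    using mult_star_S[OF s] S_mult[OF s conjunct1[OF t]] st_b by (intro idems_commute) auto
  have c2: "(star s \<cdot> s) \<cdot> (t \<cdot> s) = (t \<cdot> s) \<cdot> (star s \<cdot> s)"
    using star_mult_S[OF s] S_mult[OF conjunct1[OF t] s] ts_b by (intro idems_commute) auto
  have "s \<cdot> t = s \<cdot> star s"
  proof -
    have "s \<cdot> t = (s \<cdot> star s) \<cdot> (s \<cdot> t)"
      using S_regular[OF s] cl by (simp add: qmult_assoc[symmetric] closed)
    also have "\<dots> = s \<cdot> star s"
      using t cl unfolding c1 by (simp add: qmult_assoc[symmetric] closed)
    finally show ?thesis .
  qed
  moreover have "t \<cdot> s = star s \<cdot> s"
  proof -
    have "star s \<cdot> s = (star s \<cdot> s) \<cdot> (t \<cdot> s)"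
      using t cl by (simp add: qmult_assoc closed)
    also have "\<dots> = t \<cdot> (s \<cdot> star s \<cdot> s)"
      using cl unfolding c2 by (simp add: qmult_assoc closed)
    finally show ?thesis
      using S_regular[OF s] by simp
  qed
  ultimately have "t = star s \<cdot> s \<cdot> star s"
    using t cl by (metis qmult_assoc)
  then show "t = star s"
    using S_regular[OF S_star[OF s]] cl by (simp add: qstar_qstar)
qed

lemma natural_order_iff:
  assumes s: "s \<in> carrier S" and t: "t \<in> carrier S"
  shows "s \<sqsubseteq>\<^bsub>natural_order S\<^esub> t \<longleftrightarrow> s \<sqsubseteq> t"
proof
  have cl: "s \<in> carrier Q" "t \<in> carrier Q"
    using s t by (auto simp: S_Q)
  {
    assume "s \<sqsubseteq>\<^bsub>natural_order S\<^esub> t"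
    then obtain f where f: "f \<in> carrier S" "f \<sqsubseteq> b" "s = f \<cdot> t"
      by (auto simp: natural_order_def mult_S idems_S)
    then have "f \<cdot> t \<sqsubseteq> b \<cdot> t"
      using cl b_closed by (intro qmult_mono) (auto simp: S_Q)
    then show "s \<sqsubseteq> t"
      using f by (simp add: b_mult_S[OF t])
  }
  assume le: "s \<sqsubseteq> t"
  have "s = (s \<cdot> star s) \<cdot> t"
  proof (rule le_antisym)
    have "(s \<cdot> star s) \<cdot> s \<sqsubseteq> (s \<cdot> star s) \<cdot> t"
      using le cl by (intro qmult_mono) (auto simp: closed)
    then show "s \<sqsubseteq> (s \<cdot> star s) \<cdot> t"
      by (simp add: S_regular[OF s])
    have "star s \<cdot> t \<sqsubseteq> star t \<cdot> t"
      using le cl qstar_mono by (intro qmult_mono) (auto simp: closed)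
    also have "\<dots> \<sqsubseteq> b"
      using t by (simp add: carrier_S)
    finally have "s \<cdot> (star s \<cdot> t) \<sqsubseteq> s \<cdot> b"
      using cl b_closed by (intro qmult_mono) (auto simp: closed)
    then show "(s \<cdot> star s) \<cdot> t \<sqsubseteq> s"
      using cl by (simp add: S_mult_b[OF s] qmult_assoc closed)
  qed (auto simp: cl closed)
  then show "s \<sqsubseteq>\<^bsub>natural_order S\<^esub> t"
    using mult_star_S[OF s] by (auto simp: natural_order_def mult_S idems_S)
qed

lemma sg_compatible_iff:
  "sg_compatible S Y \<longleftrightarrow> Y \<subseteq> carrier S \<and> (\<forall>s\<in>Y. \<forall>t\<in>Y. s \<cdot> star t \<sqsubseteq> b \<and> star s \<cdot> t \<sqsubseteq> b)"
  using S_mult S_star by (auto simp: sg_compatible_def mult_S idems_S sg_inv_S subset_iff)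

lemma sg_compatible_bounded:
  assumes "t \<in> carrier S" "Y \<subseteq> carrier S" "\<And>s. s \<in> Y \<Longrightarrow> s \<sqsubseteq> t"
  shows "sg_compatible S Y"
  unfolding sg_compatible_iff
proof (intro conjI ballI)
  fix s s' assume "s \<in> Y" "s' \<in> Y"
  then have s: "s \<in> carrier Q" "s \<sqsubseteq> t" and s': "s' \<in> carrier Q" "s' \<sqsubseteq> t" and t: "t \<in> carrier Q"
    using assms by (auto simp: S_Q)
  have "s \<cdot> star s' \<sqsubseteq> t \<cdot> star t" "star s \<cdot> s' \<sqsubseteq> star t \<cdot> t"
    using s s' t qstar_mono by (auto intro!: qmult_mono simp: closed)
  then show "s \<cdot> star s' \<sqsubseteq> b" "star s \<cdot> s' \<sqsubseteq> b"
    using assms(1) s s' t le_trans[of _ "t \<cdot> star t" b] le_trans[of _ "star t \<cdot> t" b] b_closed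
    by (simp_all add: carrier_S closed)
qed (rule assms)

lemma compatible_Sup_S:
  assumes "sg_compatible S Y"
  shows "\<Squnion>Y \<in> carrier S"
proof -
  have Y: "Y \<subseteq> carrier Q" and comp: "\<And>s t. \<lbrakk>s \<in> Y; t \<in> Y\<rbrakk> \<Longrightarrow> s \<cdot> star t \<sqsubseteq> b \<and> star s \<cdot> t \<sqsubseteq> b"
    and b: "\<And>s. s \<in> Y \<Longrightarrow> s \<cdot> b = s" "\<And>s. s \<in> Y \<Longrightarrow> b \<cdot> s = s"
    using assms S_subset S_mult_b b_mult_S by (auto simp: sg_compatible_iff subset_iff)
  have sY: "star ` Y \<subseteq> carrier Q" and cl: "\<Squnion>Y \<in> carrier Q"
    using Y by (auto simp: closed)
  have 1: "star s \<cdot> \<Squnion>Y \<sqsubseteq> b" "s \<cdot> \<Squnion>(star ` Y) \<sqsubseteq> b" if "s \<in> Y" for s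
    using that Y sY comp b_closed
    by (auto simp: qmult_Sup image_image closed subset_iff intro!: sup_least)
  have "star (\<Squnion>Y) \<cdot> \<Squnion>Y \<sqsubseteq> b"
    using 1 Y sY cl b_closed
    by (simp add: qstar_Sup Sup_qmult) (auto simp: closed intro!: sup_least)
  moreover have "\<Squnion>Y \<cdot> star (\<Squnion>Y) \<sqsubseteq> b"
    using 1 Y sY cl b_closed
    by (simp add: qstar_Sup Sup_qmult) (auto simp: closed intro!: sup_least)
  moreover have "\<Squnion>Y \<cdot> b = \<Squnion>Y" "b \<cdot> \<Squnion>Y = \<Squnion>Y"
    using Y b b_closed by (simp_all add: qmult_Sup Sup_qmult)
  ultimately show ?thesis
    using cl by (simp add: carrier_S)
qed

lemma natural_order_Sup:
  assumes "sg_compatible S Y"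
  shows "\<Squnion>\<^bsub>natural_order S\<^esub> Y = \<Squnion>Y"
proof -
  have cN: "carrier (natural_order S) = carrier S" and eqN: "eq (natural_order S) = (=)"
    by (simp_all add: natural_order_def)
  interpret N: partial_order "natural_order S"
    by unfold_locales (auto simp: cN eqN natural_order_iff S_Q intro: le_trans)
  have Y: "Y \<subseteq> carrier S" "Y \<subseteq> carrier Q"
    using assms S_subset by (auto simp: sg_compatible_iff)
  show ?thesis
  proof (rule N.sup_eqI)
    fix x assume x: "x \<in> Y"
    then show "x \<sqsubseteq>\<^bsub>natural_order S\<^esub> \<Squnion>Y"
      using Y compatible_Sup_S[OF assms] sup_upper[OF Y(2) x] by (auto simp: natural_order_iff)
  next
    fix z assume "z \<in> carrier (natural_order S)" and z: "\<And>x. x \<in> Y \<Longrightarrow> x \<sqsubseteq>\<^bsub>natural_order S\<^esub> z"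
    then have zS: "z \<in> carrier S"
      by (simp add: cN)
    have "x \<sqsubseteq> z" if "x \<in> Y" for x
      using z[OF that] natural_order_iff[of x z] zS Y that by auto
    then show "\<Squnion>Y \<sqsubseteq>\<^bsub>natural_order S\<^esub> z"
      using zS Y compatible_Sup_S[OF assms] by (simp add: natural_order_iff sup_least S_Q)
  qed (use Y compatible_Sup_S[OF assms] in \<open>auto simp: cN\<close>)
qed

lemma compatible_ideal_iff:
  "compatible_ideal S J \<longleftrightarrow> J \<subseteq> carrier S \<and>
     (\<forall>s\<in>carrier S. \<forall>t\<in>J. s \<sqsubseteq> t \<longrightarrow> s \<in> J) \<and>
     (\<forall>Y. Y \<subseteq> J \<longrightarrow> sg_compatible S Y \<longrightarrow> \<Squnion>Y \<in> J)"
  unfolding compatible_ideal_def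
  by (intro conj_cong refl ball_cong all_cong) (auto simp: natural_order_iff natural_order_Sup subset_iff)

lemma compatible_idealI:
  assumes "J \<subseteq> carrier S" "\<And>s t. \<lbrakk>s \<in> carrier S; t \<in> J; s \<sqsubseteq> t\<rbrakk> \<Longrightarrow> s \<in> J"
    and "\<And>Y. \<lbrakk>Y \<subseteq> J; sg_compatible S Y; \<Squnion>Y \<in> carrier S\<rbrakk> \<Longrightarrow> \<Squnion>Y \<in> J"
  shows "compatible_ideal S J"
  using assms compatible_Sup_S by (simp add: compatible_ideal_iff)

lemma compatible_idealD:
  assumes "compatible_ideal S J"
  shows "J \<subseteq> carrier S" "\<lbrakk>s \<in> carrier S; t \<in> J; s \<sqsubseteq> t\<rbrakk> \<Longrightarrow> s \<in> J"
    and "\<lbrakk>Y \<subseteq> J; sg_compatible S Y\<rbrakk> \<Longrightarrow> \<Squnion>Y \<in> J"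
  using assms unfolding compatible_ideal_iff by (simp_all, blast)

lemma compatible_ideal_le:
  assumes "z \<in> carrier Q"
  shows "compatible_ideal S {a \<in> carrier S. a \<sqsubseteq> z}"
proof (rule compatible_idealI)
  fix s t assume "s \<in> carrier S" "t \<in> {a \<in> carrier S. a \<sqsubseteq> z}" "s \<sqsubseteq> t"
  then show "s \<in> {a \<in> carrier S. a \<sqsubseteq> z}"
    using assms le_trans[of s t z] by (simp add: S_Q)
next
  fix Y assume "Y \<subseteq> {a \<in> carrier S. a \<sqsubseteq> z}" "\<Squnion>Y \<in> carrier S"
  then show "\<Squnion>Y \<in> {a \<in> carrier S. a \<sqsubseteq> z}"
    using assms S_subset by (auto intro!: sup_least)
qed auto

lemma compatible_ideal_mult:
  assumes L: "compatible_ideal S L" and t: "t \<in> carrier S"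
  shows "compatible_ideal S {a \<in> carrier S. a \<cdot> t \<in> L}" (is "compatible_ideal S ?R")
proof (rule compatible_idealI)
  fix a c assume "a \<in> carrier S" "c \<in> ?R" "a \<sqsubseteq> c"
  then show "a \<in> ?R"
    using t by (auto intro!: compatible_idealD(2)[OF L, of _ "c \<cdot> t"] qmult_mono S_mult simp: S_Q)
next
  fix Y assume Y: "Y \<subseteq> ?R" "sg_compatible S Y" "\<Squnion>Y \<in> carrier S"
  have "sg_compatible S ((\<lambda>a. a \<cdot> t) ` Y)"
  proof (rule sg_compatible_bounded[OF S_mult[OF Y(3) t]])
    fix s assume "s \<in> (\<lambda>a. a \<cdot> t) ` Y"
    then show "s \<sqsubseteq> \<Squnion>Y \<cdot> t"
      using Y t S_subset by (auto intro!: qmult_mono sup_upper simp: S_Q subset_iff)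
  qed (use Y t S_mult in auto)
  then have "\<Squnion>((\<lambda>a. a \<cdot> t) ` Y) \<in> L"
    using Y(1) by (intro compatible_idealD(3)[OF L]) auto
  moreover have "\<Squnion>Y \<cdot> t = \<Squnion>((\<lambda>a. a \<cdot> t) ` Y)"
    using Y(1) S_subset t by (intro Sup_qmult) auto
  ultimately show "\<Squnion>Y \<in> ?R"
    using Y(3) by simp
qed auto

lemma compatible_ideal_star:
  assumes L: "compatible_ideal S L"
  shows "compatible_ideal S {a \<in> carrier S. star a \<in> L}" (is "compatible_ideal S ?R")
proof (rule compatible_idealI)
  fix a c assume "a \<in> carrier S" "c \<in> ?R" "a \<sqsubseteq> c"
  then show "a \<in> ?R"
    by (auto intro!: compatible_idealD(2)[OF L, of _ "star c"] qstar_mono S_star simp: S_Q)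
next
  fix Y assume Y: "Y \<subseteq> ?R" "sg_compatible S Y" "\<Squnion>Y \<in> carrier S"
  have "sg_compatible S (star ` Y)"
  proof (rule sg_compatible_bounded[OF S_star[OF Y(3)]])
    fix s assume "s \<in> star ` Y"
    then show "s \<sqsubseteq> star (\<Squnion>Y)"
      using Y S_subset by (auto intro!: qstar_mono sup_upper simp: S_Q subset_iff)
  qed (use Y S_star in auto)
  then have "\<Squnion>(star ` Y) \<in> L"
    using Y(1) by (intro compatible_idealD(3)[OF L]) auto
  moreover have "star (\<Squnion>Y) = \<Squnion>(star ` Y)"
    using Y(1) S_subset by (intro qstar_Sup) auto
  ultimately show "\<Squnion>Y \<in> ?R"
    using Y(3) by simp
qed auto

lemma star_image:
  assumes "J \<subseteq> carrier S"
  shows "sg_inv S ` J = {a \<in> carrier S. star a \<in> J}"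
proof -
  have "sg_inv S ` J = star ` J"
    using assms by (intro image_cong) (auto simp: sg_inv_S)
  also have "\<dots> = {a \<in> carrier S. star a \<in> J}"
  proof
    show "star ` J \<subseteq> {a \<in> carrier S. star a \<in> J}"
      using assms S_star by (auto simp: qstar_qstar S_Q subset_iff)
    show "{a \<in> carrier S. star a \<in> J} \<subseteq> star ` J"
    proof
      fix a assume "a \<in> {a \<in> carrier S. star a \<in> J}"
      then have "star (star a) = a" "star a \<in> J"
        by (auto simp: qstar_qstar S_Q)
      then show "a \<in> star ` J"
        by (metis imageI)
    qed
  qed
  finally show ?thesis .
qed


subsection \<open>The quantale of compatible ideals\<close>

abbreviation "PQ \<equiv> proj_quantale Q b"

lemma carrier_PQ: "J \<in> carrier PQ \<longleftrightarrow> compatible_ideal S J"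
  and le_PQ: "le PQ = (\<subseteq>)"
  and qunit_PQ: "qunit PQ = {a \<in> carrier S. a \<sqsubseteq> b}"
  by (simp_all add: proj_quantale_def ideal_quantale_def idems_S)

lemma qstar_PQ: "J \<in> carrier PQ \<Longrightarrow> qstar PQ J = {a \<in> carrier S. star a \<in> J}"
  using star_image[OF compatible_idealD(1)] carrier_PQ
  by (simp add: proj_quantale_def ideal_quantale_def)

lemma qmult_PQ: "J \<cdot>\<^bsub>PQ\<^esub> K = compatible_ideal S hull {s \<cdot> t |s t. s \<in> J \<and> t \<in> K}"
  unfolding proj_quantale_def ideal_quantale_def hull_def mult_S
  by simp (rule arg_cong[of _ _ Inter], auto)

sublocale PQ: closure_system PQ "carrier S"
proof
  show "carrier S \<in> carrier PQ"
    unfolding carrier_PQ by (rule compatible_idealI) auto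
  show "\<Inter>F \<in> carrier PQ" if F: "F \<subseteq> carrier PQ" "F \<noteq> {}" for F
    unfolding carrier_PQ
  proof (rule compatible_idealI)
    have ideal: "compatible_ideal S J" if "J \<in> F" for J
      using that F(1) carrier_PQ by auto
    obtain J where "J \<in> F"
      using F(2) by blast
    then show "\<Inter>F \<subseteq> carrier S"
      using compatible_idealD(1)[OF ideal] by blast
    show "s \<in> \<Inter>F" if "s \<in> carrier S" "t \<in> \<Inter>F" "s \<sqsubseteq> t" for s t
    proof
      fix J assume "J \<in> F"
      then show "s \<in> J"
        using compatible_idealD(2)[OF ideal that(1) _ that(3)] that(2) by simp
    qed
    show "\<Squnion>Y \<in> \<Inter>F" if "Y \<subseteq> \<Inter>F" "sg_compatible S Y" for Y
      using that ideal by (auto intro!: compatible_idealD(3))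
  qed
qed (auto simp: carrier_PQ compatible_idealD(1), simp_all add: proj_quantale_def ideal_quantale_def)

lemma hull_PQ:
  assumes "X \<subseteq> carrier S"
  shows "compatible_ideal S hull X \<in> carrier PQ"
  unfolding hull_def using assms PQ.whole
  by (intro PQ.Inter_closed) (auto simp: carrier_PQ)

lemma mult_subset_S:
  assumes "X \<subseteq> carrier S" "Y \<subseteq> carrier S"
  shows "{s \<cdot> t |s t. s \<in> X \<and> t \<in> Y} \<subseteq> carrier S"
  using assms S_mult by auto

text \<open>
  Ideals can be multiplied on generators: for a compatible ideal \<open>L\<close> the elements \<open>a\<close> with \<open>a t\<close> in
  \<open>L\<close> form a compatible ideal, and so do those with \<open>t a\<close> in \<open>L\<close>.
\<close>

lemma hull_mult_subset:
  assumes X: "X \<subseteq> carrier S" and Y: "Y \<subseteq> carrier S" and L: "L \<in> carrier PQ"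
    and XY: "\<And>s t. \<lbrakk>s \<in> X; t \<in> Y\<rbrakk> \<Longrightarrow> s \<cdot> t \<in> L"
  shows "(compatible_ideal S hull X) \<cdot>\<^bsub>PQ\<^esub> (compatible_ideal S hull Y) \<subseteq> L"
proof -
  have L': "compatible_ideal S L"
    using L by (simp add: carrier_PQ)
  have XS: "compatible_ideal S hull X \<subseteq> carrier S" and YS: "compatible_ideal S hull Y \<subseteq> carrier S"
    using hull_PQ[OF X] hull_PQ[OF Y] PQ.bounded by auto
  have 1: "s \<cdot> t \<in> L" if "s \<in> compatible_ideal S hull X" "t \<in> Y" for s t
  proof -
    have "compatible_ideal S hull X \<subseteq> {a \<in> carrier S. a \<cdot> t \<in> L}"
      using X Y XY that(2) by (intro hull_minimal compatible_ideal_mult[OF L']) auto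
    then show ?thesis
      using that(1) by auto
  qed
  have 2: "s \<cdot> t \<in> L" if s: "s \<in> compatible_ideal S hull X" and t: "t \<in> compatible_ideal S hull Y" for s t
  proof -
    \<comment> \<open>The \<open>a\<close> with \<open>s a\<close> in \<open>L\<close>, which are those with \<open>(a\<^sup>* s\<^sup>*)\<^sup>*\<close> in \<open>L\<close>.\<close>
    have sS: "s \<in> carrier S"
      using s XS by auto
    let ?L = "{a \<in> carrier S. star a \<in> {a \<in> carrier S. a \<cdot> star s \<in> {a \<in> carrier S. star a \<in> L}}}"
    have "compatible_ideal S ?L"
      by (intro compatible_ideal_star compatible_ideal_mult L' S_star sS)
    moreover have L_eq: "a \<in> ?L \<longleftrightarrow> s \<cdot> a \<in> L" if "a \<in> carrier S" for a
      using that sS S_star S_mult by (auto simp: qstar_qmult qstar_qstar S_Q closed)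
    ultimately have "compatible_ideal S hull Y \<subseteq> ?L"
      using Y 1[OF s] by (intro hull_minimal) blast+
    then show ?thesis
      using t L_eq YS by blast
  qed
  show ?thesis
    unfolding qmult_PQ using 2 by (intro hull_minimal L') auto
qed

lemma Sup_hull:
  assumes X: "X \<subseteq> carrier S"
  shows "\<Squnion>(compatible_ideal S hull X) = \<Squnion>X"
proof (rule le_antisym)
  have XQ: "X \<subseteq> carrier Q" and HQ: "compatible_ideal S hull X \<subseteq> carrier Q"
    using X PQ.bounded[OF hull_PQ[OF X]] S_subset by auto
  show "\<Squnion>X \<in> carrier Q" "\<Squnion>(compatible_ideal S hull X) \<in> carrier Q"
    using XQ HQ by auto
  show "\<Squnion>X \<sqsubseteq> \<Squnion>(compatible_ideal S hull X)"
    using hull_subset HQ by (rule sup_mono)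
  have "compatible_ideal S hull X \<subseteq> {a \<in> carrier S. a \<sqsubseteq> \<Squnion>X}"
    using X XQ sup_upper[OF XQ] by (intro hull_minimal compatible_ideal_le) auto
  then show "\<Squnion>(compatible_ideal S hull X) \<sqsubseteq> \<Squnion>X"
    using XQ HQ by (intro sup_least) auto
qed

text \<open>A compatible ideal that is a compatible set contains its own join, and so is principal.\<close>

lemma PQ_principal:
  assumes J: "J \<in> carrier PQ" and comp: "sg_compatible S J"
  shows "J = {a \<in> carrier S. a \<sqsubseteq> \<Squnion>J}"
proof -
  have J': "compatible_ideal S J"
    using J by (simp add: carrier_PQ)
  have "\<Squnion>J \<in> J"
    using compatible_idealD(3)[OF J' order_refl comp] .
  then have "a \<in> J" if "a \<in> carrier S" "a \<sqsubseteq> \<Squnion>J" for a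
    using compatible_idealD(2)[OF J' that(1) _ that(2)] by simp
  moreover have "J \<subseteq> carrier S" "J \<subseteq> carrier Q"
    using compatible_idealD(1)[OF J'] S_subset by auto
  ultimately show ?thesis
    by (auto intro: sup_upper)
qed

end


section \<open>The universal property\<close>

text \<open>
  The properties of the quantale of an etale groupoid on which the universal property rests: it is a
  frame, its multiplication preserves joins and has a unit, and it is covered by its partial units.
  Associativity of the multiplication and antimultiplicativity of the involution are not included: these
  laws are applied in \<open>Q\<close> only.
\<close>

locale partial_unit_quantale = frame R for R :: "('a, 'm) uiquantale_scheme" (structure) +
  assumes mult_closed: "\<lbrakk>x \<in> carrier R; y \<in> carrier R\<rbrakk> \<Longrightarrow> x \<cdot> y \<in> carrier R"
    and star_closed: "x \<in> carrier R \<Longrightarrow> qstar R x \<in> carrier R"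
    and unit_closed: "qunit R \<in> carrier R"
    and mult_Sup: "\<lbrakk>x \<in> carrier R; Y \<subseteq> carrier R\<rbrakk> \<Longrightarrow> x \<cdot> \<Squnion>Y = \<Squnion>((\<lambda>y. x \<cdot> y) ` Y)"
    and Sup_mult: "\<lbrakk>y \<in> carrier R; X \<subseteq> carrier R\<rbrakk> \<Longrightarrow> \<Squnion>X \<cdot> y = \<Squnion>((\<lambda>x. x \<cdot> y) ` X)"
    and star_star: "x \<in> carrier R \<Longrightarrow> qstar R (qstar R x) = x"
    and star_mono: "\<lbrakk>x \<in> carrier R; y \<in> carrier R; x \<sqsubseteq> y\<rbrakk> \<Longrightarrow> qstar R x \<sqsubseteq> qstar R y"
    and mult_unit: "x \<in> carrier R \<Longrightarrow> x \<cdot> qunit R = x"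
    and unit_mult: "x \<in> carrier R \<Longrightarrow> qunit R \<cdot> x = x"
    and star_unit: "qstar R (qunit R) = qunit R"
    and cover: "x \<in> carrier R \<Longrightarrow>
      \<Squnion>{s \<in> carrier R. s \<sqsubseteq> x \<and> qstar R s \<cdot> s \<sqsubseteq> qunit R \<and> s \<cdot> qstar R s \<sqsubseteq> qunit R} = x"

lemma (in partial_unit_quantale) mult_mono:
  assumes "x \<sqsubseteq> x'" "y \<sqsubseteq> y'"
    and cl: "x \<in> carrier R" "x' \<in> carrier R" "y \<in> carrier R" "y' \<in> carrier R"
  shows "x \<cdot> y \<sqsubseteq> x' \<cdot> y'"
proof -
  have "\<Squnion>{x, x'} = x'" "\<Squnion>{y, y'} = y'"
    using assms by (auto intro!: sup_eqI)
  then have "x' \<cdot> y = \<Squnion>{x \<cdot> y, x' \<cdot> y}" "x' \<cdot> y' = \<Squnion>{x' \<cdot> y, x' \<cdot> y'}"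
    using Sup_mult[of y "{x, x'}"] mult_Sup[of x' "{y, y'}"] cl by simp_all
  then have "x \<cdot> y \<sqsubseteq> x' \<cdot> y" "x' \<cdot> y \<sqsubseteq> x' \<cdot> y'"
    using sup_upper[of "{x \<cdot> y, x' \<cdot> y}" "x \<cdot> y"] sup_upper[of "{x' \<cdot> y, x' \<cdot> y'}" "x' \<cdot> y"] cl
    by (simp_all add: mult_closed)
  then show ?thesis
    by (rule le_trans) (simp_all add: cl mult_closed)
qed

lemma iq_mapsD:
  assumes "p \<in> iq_maps Q R"
  shows "x \<in> carrier R \<Longrightarrow> p x \<in> carrier Q"
    and "X \<subseteq> carrier R \<Longrightarrow> p (\<Squnion>\<^bsub>R\<^esub> X) = \<Squnion>\<^bsub>Q\<^esub> (p ` X)"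
    and "\<lbrakk>x \<in> carrier R; y \<in> carrier R\<rbrakk> \<Longrightarrow> p (x \<cdot>\<^bsub>R\<^esub> y) = p x \<cdot>\<^bsub>Q\<^esub> p y"
    and "x \<in> carrier R \<Longrightarrow> p (qstar R x) = qstar Q (p x)"
    and "p \<in> extensional (carrier R)"
  using assms by (auto simp: iq_maps_def PiE_def)

lemma iq_maps_mono:
  assumes "p \<in> iq_maps Q R" "complete_lattice Q" "complete_lattice R"
    and xy: "x \<in> carrier R" "y \<in> carrier R" "x \<sqsubseteq>\<^bsub>R\<^esub> y"
  shows "p x \<sqsubseteq>\<^bsub>Q\<^esub> p y"
proof -
  interpret Q: complete_lattice Q by fact
  interpret R: complete_lattice R by fact
  have "\<Squnion>\<^bsub>R\<^esub> {x, y} = y"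
    using xy by (intro R.sup_eqI) auto
  then have "p y = \<Squnion>\<^bsub>Q\<^esub> {p x, p y}"
    using iq_mapsD(2)[OF assms(1), of "{x, y}"] xy by simp
  then show ?thesis
    using Q.sup_upper[of "{p x, p y}" "p x"] iq_mapsD(1)[OF assms(1)] xy by simp
qed

lemma projection_unit_image:
  assumes "partial_unit_quantale R" and q: "q \<in> iq_maps Q R"
  shows "projection Q (q (qunit R))"
proof -
  interpret R: partial_unit_quantale R by fact
  note e = R.unit_closed
  have "q (qunit R) \<cdot>\<^bsub>Q\<^esub> q (qunit R) = q (qunit R)"
    using iq_mapsD(3)[OF q e e] by (simp add: R.mult_unit e)
  moreover have "qstar Q (q (qunit R)) = q (qunit R)"
    using iq_mapsD(4)[OF q e] by (simp add: R.star_unit)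
  ultimately show ?thesis
    using iq_mapsD(1)[OF q e] by (simp add: projection_def)
qed

text \<open>A map \<open>q : Q \<rightarrow> R\<close>, to be factored through \<open>proj_map Q b\<close> for the projection \<open>b = q\<^sup>* e\<close>.\<close>

locale quantale_map_factorization =
  gelfand_projection Q "q (qunit R)" + R: partial_unit_quantale R
  for Q :: "('q, 'm) iquantale_scheme" (structure) and R :: "('a, 'n) uiquantale_scheme"
    and q :: "'a \<Rightarrow> 'q" +
  assumes q: "q \<in> iq_maps Q R"
begin

abbreviation "e \<equiv> qunit R"

lemmas q_closed = iq_mapsD(1)[OF q]
  and q_Sup = iq_mapsD(2)[OF q]
  and q_mult = iq_mapsD(3)[OF q]
  and q_star = iq_mapsD(4)[OF q]
  and q_mono = iq_maps_mono[OF q complete_lattice_axioms R.complete_lattice_axioms]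

text \<open>The partial units of \<open>R\<close>.\<close>

definition punits :: "'a set" where
  "punits = {s \<in> carrier R. qstar R s \<cdot>\<^bsub>R\<^esub> s \<sqsubseteq>\<^bsub>R\<^esub> e \<and> s \<cdot>\<^bsub>R\<^esub> qstar R s \<sqsubseteq>\<^bsub>R\<^esub> e}"

lemma punits_closed: "punits \<subseteq> carrier R"
  by (auto simp: punits_def)

lemma Sup_punits: "x \<in> carrier R \<Longrightarrow> \<Squnion>\<^bsub>R\<^esub> {s \<in> punits. s \<sqsubseteq>\<^bsub>R\<^esub> x} = x"
  using R.cover[of x] by (simp add: punits_def conj_ac)

lemma q_punit:
  assumes s: "s \<in> punits"
  shows "q s \<in> carrier S"
proof -
  have cl: "s \<in> carrier R" "qstar R s \<in> carrier R"
    using s R.star_closed by (auto simp: punits_def)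
  have "q (qstar R s \<cdot>\<^bsub>R\<^esub> s) \<sqsubseteq> q e" "q (s \<cdot>\<^bsub>R\<^esub> qstar R s) \<sqsubseteq> q e"
    using s cl by (auto intro!: q_mono simp: punits_def R.mult_closed R.unit_closed)
  moreover have "q s \<cdot> q e = q s" "q e \<cdot> q s = q s"
    using cl q_mult[of s e] q_mult[of e s] by (simp_all add: R.unit_closed R.mult_unit R.unit_mult)
  ultimately show ?thesis
    using cl q_closed by (simp add: carrier_S q_mult q_star)
qed

lemma q_below_S:
  assumes s: "q s \<in> carrier S" "s \<in> carrier R" and t: "t \<in> carrier R" "t \<sqsubseteq>\<^bsub>R\<^esub> s"
  shows "q t \<in> carrier S"
proof -
  have le: "q t \<sqsubseteq> q s" and cl: "q t \<in> carrier Q" "q s \<in> carrier Q" "q e \<in> carrier Q"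
    using s t q_mono q_closed R.unit_closed by auto
  have "star (q t) \<cdot> q t \<sqsubseteq> star (q s) \<cdot> q s" "q t \<cdot> star (q t) \<sqsubseteq> q s \<cdot> star (q s)"
    using le cl qstar_mono by (auto intro!: qmult_mono simp: closed)
  then have "star (q t) \<cdot> q t \<sqsubseteq> q e" "q t \<cdot> star (q t) \<sqsubseteq> q e"
    using s(1) cl le_trans[of _ "star (q s) \<cdot> q s" "q e"] le_trans[of _ "q s \<cdot> star (q s)" "q e"]
    by (simp_all add: carrier_S closed)
  moreover have "q t \<cdot> q e = q t" "q e \<cdot> q t = q t"
    using t q_mult[of t e] q_mult[of e t] by (simp_all add: R.unit_closed R.mult_unit R.unit_mult)
  ultimately show ?thesis
    using cl by (simp add: carrier_S)
qed

text \<open>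
  Generators of the ideal assigned to \<open>x\<close>. They are taken from all \<open>s \<le> x\<close> with \<open>q\<^sup>* s\<close> in the
  pseudogroup, rather than from the partial units only: the set of these \<open>s\<close> is closed under
  multiplication and involution simply because the pseudogroup is.
\<close>

definition gens :: "'a \<Rightarrow> 'q set" where
  "gens x = {q s |s. s \<in> carrier R \<and> s \<sqsubseteq>\<^bsub>R\<^esub> x \<and> q s \<in> carrier S}"

text \<open>The factorization, given by its inverse image \<open>R \<rightarrow> \<L>\<^sup>\<or>(S)\<close>.\<close>

definition factor :: "'a \<Rightarrow> 'q set" where
  "factor = (\<lambda>x\<in>carrier R. compatible_ideal S hull gens x)"

lemma gens_S: "gens x \<subseteq> carrier S"
  by (auto simp: gens_def)

lemma factor_eq: "x \<in> carrier R \<Longrightarrow> factor x = compatible_ideal S hull gens x"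
  by (simp add: factor_def)

lemma factor_closed: "x \<in> carrier R \<Longrightarrow> factor x \<in> carrier PQ"
  by (simp add: factor_eq hull_PQ gens_S)

lemma factor_ideal: "x \<in> carrier R \<Longrightarrow> compatible_ideal S (factor x)"
  using factor_closed carrier_PQ by blast

lemma factor_least:
  assumes "x \<in> carrier R" "L \<in> carrier PQ"
    and "\<And>s. \<lbrakk>s \<in> carrier R; s \<sqsubseteq>\<^bsub>R\<^esub> x; q s \<in> carrier S\<rbrakk> \<Longrightarrow> q s \<in> L"
  shows "factor x \<subseteq> L"
  unfolding factor_eq[OF assms(1)] using assms(2,3)
  by (intro hull_minimal) (auto simp: gens_def carrier_PQ)

lemma factor_mem: "\<lbrakk>x \<in> carrier R; s \<in> carrier R; s \<sqsubseteq>\<^bsub>R\<^esub> x; q s \<in> carrier S\<rbrakk> \<Longrightarrow> q s \<in> factor x"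
  unfolding factor_eq by (rule hull_inc) (auto simp: gens_def)

lemma factor_mono:
  assumes "x \<in> carrier R" "y \<in> carrier R" "x \<sqsubseteq>\<^bsub>R\<^esub> y"
  shows "factor x \<subseteq> factor y"
  using assms by (intro factor_least factor_closed factor_mem) (auto intro: R.le_trans)

lemma factor_Sup:
  assumes X: "X \<subseteq> carrier R"
  shows "factor (\<Squnion>\<^bsub>R\<^esub> X) = \<Squnion>\<^bsub>PQ\<^esub> (factor ` X)"
proof
  have FX: "factor ` X \<subseteq> carrier PQ"
    using X factor_closed by auto
  have Sup_X: "\<Squnion>\<^bsub>R\<^esub> X \<in> carrier R"
    using X by simp
  have L: "\<Squnion>\<^bsub>PQ\<^esub> (factor ` X) \<in> carrier PQ"
    using FX by simp
  show "\<Squnion>\<^bsub>PQ\<^esub> (factor ` X) \<subseteq> factor (\<Squnion>\<^bsub>R\<^esub> X)"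
  proof -
    have "factor x \<subseteq> factor (\<Squnion>\<^bsub>R\<^esub> X)" if "x \<in> X" for x
      using that X R.sup_upper[OF X that] by (intro factor_mono) auto
    then show ?thesis
      using PQ.sup_least[OF FX factor_closed[OF Sup_X]] unfolding le_PQ by blast
  qed
  show "factor (\<Squnion>\<^bsub>R\<^esub> X) \<subseteq> \<Squnion>\<^bsub>PQ\<^esub> (factor ` X)"
  proof (rule factor_least[OF Sup_X L])
    fix s assume s: "s \<in> carrier R" "s \<sqsubseteq>\<^bsub>R\<^esub> \<Squnion>\<^bsub>R\<^esub> X" "q s \<in> carrier S"
    let ?Y = "(\<lambda>x. q (s \<sqinter>\<^bsub>R\<^esub> x)) ` X"
    have meet: "s \<sqinter>\<^bsub>R\<^esub> x \<in> carrier R" "s \<sqinter>\<^bsub>R\<^esub> x \<sqsubseteq>\<^bsub>R\<^esub> s" "s \<sqinter>\<^bsub>R\<^esub> x \<sqsubseteq>\<^bsub>R\<^esub> x" "x \<in> carrier R"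
      if "x \<in> X" for x
      using that X s(1) by (auto intro: R.meet_left R.meet_right)
    have Y_S: "q (s \<sqinter>\<^bsub>R\<^esub> x) \<in> carrier S" if "x \<in> X" for x
      using q_below_S[OF s(3,1)] meet[OF that] by simp
    \<comment> \<open>Distributivity of \<open>R\<close> exhibits \<open>q\<^sup>* s\<close> as a join of elements of the ideals \<open>factor x\<close>.\<close>
    have "q s = \<Squnion>?Y"
    proof -
      have "q s = q (s \<sqinter>\<^bsub>R\<^esub> \<Squnion>\<^bsub>R\<^esub> X)"
        using s Sup_X by (simp add: R.meet_absorb)
      also have "s \<sqinter>\<^bsub>R\<^esub> \<Squnion>\<^bsub>R\<^esub> X = \<Squnion>\<^bsub>R\<^esub> ((\<lambda>x. s \<sqinter>\<^bsub>R\<^esub> x) ` X)"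
        using s X by (simp add: R.meet_Sup)
      also have "q \<dots> = \<Squnion>?Y"
        using meet by (subst q_Sup) (auto simp: image_image)
      finally show ?thesis .
    qed
    moreover have "sg_compatible S ?Y"
      using Y_S meet s by (intro sg_compatible_bounded[OF s(3)]) (auto intro: q_mono)
    moreover have "?Y \<subseteq> \<Squnion>\<^bsub>PQ\<^esub> (factor ` X)"
    proof
      fix a assume "a \<in> ?Y"
      then obtain x where x: "x \<in> X" "a = q (s \<sqinter>\<^bsub>R\<^esub> x)" by auto
      then have "a \<in> factor x"
        using meet[OF x(1)] Y_S by (auto intro: factor_mem)
      then show "a \<in> \<Squnion>\<^bsub>PQ\<^esub> (factor ` X)"
        using PQ.sup_upper[OF FX imageI[OF x(1)]] by (auto simp: le_PQ)
    qed
    ultimately show "q s \<in> \<Squnion>\<^bsub>PQ\<^esub> (factor ` X)"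
      using L compatible_idealD(3)[of "\<Squnion>\<^bsub>PQ\<^esub> (factor ` X)" ?Y] by (simp add: carrier_PQ)
  qed
qed

lemma factor_mult:
  assumes x: "x \<in> carrier R" and y: "y \<in> carrier R"
  shows "factor (x \<cdot>\<^bsub>R\<^esub> y) = factor x \<cdot>\<^bsub>PQ\<^esub> factor y"
proof
  have xy: "x \<cdot>\<^bsub>R\<^esub> y \<in> carrier R"
    using x y by (rule R.mult_closed)
  show "factor x \<cdot>\<^bsub>PQ\<^esub> factor y \<subseteq> factor (x \<cdot>\<^bsub>R\<^esub> y)"
    unfolding factor_eq[OF x] factor_eq[OF y]
  proof (rule hull_mult_subset[OF gens_S gens_S factor_closed[OF xy]])
    fix a c assume "a \<in> gens x" "c \<in> gens y"
    then obtain s t where s: "s \<in> carrier R" "s \<sqsubseteq>\<^bsub>R\<^esub> x" "q s \<in> carrier S" "a = q s"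
      and t: "t \<in> carrier R" "t \<sqsubseteq>\<^bsub>R\<^esub> y" "q t \<in> carrier S" "c = q t"
      by (auto simp: gens_def)
    then have "q (s \<cdot>\<^bsub>R\<^esub> t) \<in> factor (x \<cdot>\<^bsub>R\<^esub> y)"
      using S_mult x y by (intro factor_mem[OF xy] R.mult_mono) (auto simp: q_mult R.mult_closed)
    then show "a \<cdot> c \<in> factor (x \<cdot>\<^bsub>R\<^esub> y)"
      using s t by (simp add: q_mult)
  qed
  have prod_S: "{a \<cdot> c |a c. a \<in> factor x \<and> c \<in> factor y} \<subseteq> carrier S"
    using PQ.bounded[OF factor_closed[OF x]] PQ.bounded[OF factor_closed[OF y]] by (rule mult_subset_S)
  have prod: "factor x \<cdot>\<^bsub>PQ\<^esub> factor y \<in> carrier PQ"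
    unfolding qmult_PQ using prod_S by (rule hull_PQ)
  let ?P = "\<lambda>x. {s \<in> punits. s \<sqsubseteq>\<^bsub>R\<^esub> x}"
  have P: "?P z \<subseteq> carrier R" for z
    using punits_closed by auto
  let ?M = "{s \<cdot>\<^bsub>R\<^esub> t |s t. s \<in> ?P x \<and> t \<in> ?P y}"
  have M: "?M \<subseteq> carrier R"
    using P R.mult_closed by blast
  have "x \<cdot>\<^bsub>R\<^esub> y \<sqsubseteq>\<^bsub>R\<^esub> \<Squnion>\<^bsub>R\<^esub> ?M"
  proof -
    have "s \<cdot>\<^bsub>R\<^esub> y \<sqsubseteq>\<^bsub>R\<^esub> \<Squnion>\<^bsub>R\<^esub> ?M" if "s \<in> ?P x" for s
    proof -
      have s: "s \<in> carrier R"
        using that P by blast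
      have "s \<cdot>\<^bsub>R\<^esub> \<Squnion>\<^bsub>R\<^esub> (?P y) \<sqsubseteq>\<^bsub>R\<^esub> \<Squnion>\<^bsub>R\<^esub> ?M"
        unfolding R.mult_Sup[OF s P] using M that by (intro R.sup_mono) auto
      then show ?thesis
        by (simp only: Sup_punits[OF y])
    qed
    then have "\<Squnion>\<^bsub>R\<^esub> (?P x) \<cdot>\<^bsub>R\<^esub> y \<sqsubseteq>\<^bsub>R\<^esub> \<Squnion>\<^bsub>R\<^esub> ?M"
      unfolding R.Sup_mult[OF y P] using M y subsetD[OF punits_closed] R.mult_closed
      by (intro R.sup_least) auto
    then show ?thesis
      by (simp only: Sup_punits[OF x])
  qed
  then have "factor (x \<cdot>\<^bsub>R\<^esub> y) \<subseteq> \<Squnion>\<^bsub>PQ\<^esub> (factor ` ?M)"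
    using factor_mono[OF xy R.sup_closed[OF M]] by (simp only: factor_Sup[OF M])
  also have "\<dots> \<subseteq> factor x \<cdot>\<^bsub>PQ\<^esub> factor y"
  proof -
    have FM: "factor ` ?M \<subseteq> carrier PQ"
      using M factor_closed by blast
    have "factor (s \<cdot>\<^bsub>R\<^esub> t) \<subseteq> factor x \<cdot>\<^bsub>PQ\<^esub> factor y" if "s \<in> ?P x" "t \<in> ?P y" for s t
    proof -
      have s: "s \<in> carrier R" "s \<sqsubseteq>\<^bsub>R\<^esub> x" "q s \<in> carrier S" and t: "t \<in> carrier R" "t \<sqsubseteq>\<^bsub>R\<^esub> y" "q t \<in> carrier S"
        using that punits_closed q_punit by auto
      have "q s \<cdot> q t \<in> factor x \<cdot>\<^bsub>PQ\<^esub> factor y"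
        unfolding qmult_PQ using factor_mem[OF x s] factor_mem[OF y t] by (intro hull_inc) auto
      then have le: "a \<in> factor x \<cdot>\<^bsub>PQ\<^esub> factor y" if "a \<in> carrier S" "a \<sqsubseteq> q s \<cdot> q t" for a
        using that prod compatible_idealD(2)[of "factor x \<cdot>\<^bsub>PQ\<^esub> factor y"] by (simp add: carrier_PQ)
      have "q v \<sqsubseteq> q s \<cdot> q t" if "v \<in> carrier R" "v \<sqsubseteq>\<^bsub>R\<^esub> s \<cdot>\<^bsub>R\<^esub> t" for v
        using q_mono[OF that(1) _ that(2)] s t by (simp add: q_mult R.mult_closed)
      with le show ?thesis
        using s t by (intro factor_least prod) (auto simp: R.mult_closed)
    qed
    then have "K \<sqsubseteq>\<^bsub>PQ\<^esub> factor x \<cdot>\<^bsub>PQ\<^esub> factor y" if "K \<in> factor ` ?M" for K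
      using that by (auto simp: le_PQ)
    then show ?thesis
      using PQ.sup_least[OF FM prod] by (simp only: le_PQ)
  qed
  finally show "factor (x \<cdot>\<^bsub>R\<^esub> y) \<subseteq> factor x \<cdot>\<^bsub>PQ\<^esub> factor y" .
qed

lemma factor_star:
  assumes x: "x \<in> carrier R"
  shows "factor (qstar R x) = qstar PQ (factor x)"
proof -
  have le: "factor (qstar R y) \<subseteq> {a \<in> carrier S. star a \<in> factor y}" if y: "y \<in> carrier R" for y
  proof (rule factor_least)
    show "{a \<in> carrier S. star a \<in> factor y} \<in> carrier PQ"
      unfolding carrier_PQ by (rule compatible_ideal_star[OF factor_ideal[OF y]])
    fix s assume s: "s \<in> carrier R" "s \<sqsubseteq>\<^bsub>R\<^esub> qstar R y" "q s \<in> carrier S"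
    then have "qstar R s \<sqsubseteq>\<^bsub>R\<^esub> y"
      using R.star_mono[OF s(1) R.star_closed[OF y] s(2)] y by (simp add: R.star_star)
    then have "q (qstar R s) \<in> factor y"
      using s y S_star by (intro factor_mem) (auto simp: R.star_closed q_star)
    then show "q s \<in> {a \<in> carrier S. star a \<in> factor y}"
      using s by (simp add: q_star)
  qed (rule R.star_closed[OF y])
  have "{a \<in> carrier S. star a \<in> factor x} \<subseteq> factor (qstar R x)"
  proof
    fix a assume a: "a \<in> {a \<in> carrier S. star a \<in> factor x}"
    then have "star a \<in> factor (qstar R (qstar R x))"
      by (simp add: R.star_star x)
    then have "star (star a) \<in> factor (qstar R x)"
      using le[OF R.star_closed[OF x]] by blast
    then show "a \<in> factor (qstar R x)"
      using a by (simp add: qstar_qstar S_Q)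
  qed
  then show ?thesis
    using le[OF x] by (simp add: qstar_PQ factor_closed x)
qed

lemma factor_unit: "factor e = qunit PQ"
proof
  show "factor e \<subseteq> qunit PQ"
    unfolding qunit_PQ
    using R.unit_closed b_closed q_mono
    by (intro factor_least) (auto simp: carrier_PQ intro: compatible_ideal_le)
  have "q e \<in> factor e"
    using R.unit_closed b_S by (intro factor_mem) auto
  then show "qunit PQ \<subseteq> factor e"
    unfolding qunit_PQ using compatible_idealD(2)[OF factor_ideal[OF R.unit_closed]] by auto
qed

lemma factor_map: "factor \<in> uiq_maps PQ R"
  unfolding uiq_maps_def iq_maps_def
  using factor_closed factor_Sup factor_mult factor_star factor_unit
  by (auto simp: PiE_def extensional_def factor_def)

lemma factor_comp: "iq_comp R factor (proj_map Q (q e)) = q"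
proof (rule extensionalityI)
  show "iq_comp R factor (proj_map Q (q e)) \<in> extensional (carrier R)"
    by (simp add: iq_comp_def)
  show "q \<in> extensional (carrier R)"
    by (rule iq_mapsD(5)[OF q])
  fix x assume x: "x \<in> carrier R"
  have gQ: "gens x \<subseteq> carrier Q"
    using gens_S S_subset by blast
  have "\<Squnion>(gens x) = q x"
  proof (rule le_antisym)
    show "\<Squnion>(gens x) \<sqsubseteq> q x"
      using x gQ q_mono q_closed by (intro sup_least) (auto simp: gens_def)
    have "q x = \<Squnion>(q ` {s \<in> punits. s \<sqsubseteq>\<^bsub>R\<^esub> x})"
      using q_Sup[of "{s \<in> punits. s \<sqsubseteq>\<^bsub>R\<^esub> x}"] punits_closed by (simp add: Sup_punits[OF x] subset_iff)
    also have "\<dots> \<sqsubseteq> \<Squnion>(gens x)"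
      using gQ punits_closed q_punit by (intro sup_mono) (auto simp: gens_def)
    finally show "q x \<sqsubseteq> \<Squnion>(gens x)" .
  qed (use x q_closed gQ in auto)
  then show "iq_comp R factor (proj_map Q (q e)) x = q x"
    using x factor_closed[OF x] by (simp add: iq_comp_def compose_def proj_map_def factor_eq Sup_hull gens_S)
qed

text \<open>
  A factorization \<open>k\<close> sends a partial unit \<open>s\<close> to an ideal which is itself a compatible set, hence to
  the principal ideal of its join \<open>q\<^sup>* s\<close>.
\<close>

lemma factorization_punit:
  assumes k: "k \<in> uiq_maps PQ R" and comp: "iq_comp R k (proj_map Q (q e)) = q" and s: "s \<in> punits"
  shows "k s = {a \<in> carrier S. a \<sqsubseteq> q s}"
proof -
  have k': "k \<in> iq_maps PQ R" and ke: "k e = qunit PQ"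
    using k by (auto simp: uiq_maps_def)
  have cl: "s \<in> carrier R" "qstar R s \<in> carrier R"
    using s R.star_closed by (auto simp: punits_def)
  note ks = iq_mapsD(1)[OF k' cl(1)]
  have ksS: "k s \<subseteq> carrier S"
    by (rule PQ.bounded[OF ks])
  note mono = iq_maps_mono[OF k' PQ.complete_lattice_axioms R.complete_lattice_axioms]
  have "k (qstar R s \<cdot>\<^bsub>R\<^esub> s) \<subseteq> k e" "k (s \<cdot>\<^bsub>R\<^esub> qstar R s) \<subseteq> k e"
    using mono[of _ e] s cl by (auto simp: punits_def le_PQ R.mult_closed R.unit_closed)
  then have unit: "qstar PQ (k s) \<cdot>\<^bsub>PQ\<^esub> k s \<subseteq> qunit PQ" "k s \<cdot>\<^bsub>PQ\<^esub> qstar PQ (k s) \<subseteq> qunit PQ"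
    using cl by (simp_all add: ke iq_mapsD(3)[OF k'] iq_mapsD(4)[OF k'])
  have star_mem: "star a \<in> qstar PQ (k s)" if "a \<in> k s" for a
    using that ksS S_star by (auto simp: qstar_PQ[OF ks] qstar_qstar S_Q subset_iff)
  have "sg_compatible S (k s)"
    unfolding sg_compatible_iff
  proof (intro conjI ballI ksS)
    fix a c assume ac: "a \<in> k s" "c \<in> k s"
    have "star a \<cdot> c \<in> qstar PQ (k s) \<cdot>\<^bsub>PQ\<^esub> k s" "a \<cdot> star c \<in> k s \<cdot>\<^bsub>PQ\<^esub> qstar PQ (k s)"
      unfolding qmult_PQ using ac star_mem by (auto intro!: hull_inc)
    then show "a \<cdot> star c \<sqsubseteq> q e" "star a \<cdot> c \<sqsubseteq> q e"
      using unit by (auto simp: qunit_PQ)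
  qed
  moreover have "\<Squnion>(k s) = q s"
    using fun_cong[OF comp, of s] cl ks by (simp add: iq_comp_def compose_def proj_map_def)
  ultimately show ?thesis
    using PQ_principal[OF ks] by simp
qed

lemma factorization_unique:
  assumes k: "k \<in> uiq_maps PQ R" "iq_comp R k (proj_map Q (q e)) = q"
    and k': "k' \<in> uiq_maps PQ R" "iq_comp R k' (proj_map Q (q e)) = q"
  shows "k = k'"
proof (rule extensionalityI)
  have maps: "k \<in> iq_maps PQ R" "k' \<in> iq_maps PQ R"
    using k k' by (auto simp: uiq_maps_def)
  then show "k \<in> extensional (carrier R)" "k' \<in> extensional (carrier R)"
    by (auto dest: iq_mapsD(5))
  fix x assume x: "x \<in> carrier R"
  let ?P = "{s \<in> punits. s \<sqsubseteq>\<^bsub>R\<^esub> x}"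
  have P: "?P \<subseteq> carrier R"
    using punits_closed by auto
  have "k ` ?P = k' ` ?P"
    using factorization_punit[OF k] factorization_punit[OF k'] by (intro image_cong) auto
  then show "k x = k' x"
    using iq_mapsD(2)[OF maps(1) P] iq_mapsD(2)[OF maps(2) P] by (simp add: Sup_punits[OF x])
qed

lemma factorization_surjection:
  assumes "k \<in> uiq_maps PQ R" "iq_comp R k (proj_map Q (q e)) = q" "iq_surjection R q"
  shows "iq_surjection R k"
  unfolding iq_surjection_def
proof (rule inj_onI)
  fix x y assume xy: "x \<in> carrier R" "y \<in> carrier R" "k x = k y"
  then have "q x = q y"
    using assms(2) by (metis compose_eq iq_comp_def)
  then show "x = y"
    using assms(3) xy by (auto simp: iq_surjection_def inj_on_def)
qed

end


section \<open>Pullbacks of locales\<close>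

text \<open>Maps of locales \<open>A \<rightarrow> C\<close> and \<open>B \<rightarrow> C\<close>, given by their inverse images \<open>f\<close> and \<open>g\<close>.\<close>

locale frame_cospan = A: frame A + B: frame B + C: frame C
  for A :: "'a gorder" and B :: "'b gorder" and C :: "'c gorder"
    and f :: "'c \<Rightarrow> 'a" and g :: "'c \<Rightarrow> 'b" +
  assumes f_hom: "f \<in> frame_hom C A" and g_hom: "g \<in> frame_hom C B"
begin

sublocale f: frame_morphism C A f
  by unfold_locales (rule f_hom)

sublocale g: frame_morphism C B g
  by unfold_locales (rule g_hom)

abbreviation "PB \<equiv> pullback A B C f g"
abbreviation "tensor \<equiv> pb_tensor A B C f g"

lemma carrier_PB: "J \<in> carrier PB \<longleftrightarrow> pb_ideal A B C f g J"
  and le_PB: "le PB = (\<subseteq>)"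
  by (simp_all add: pullback_def)

lemma pb_idealI:
  assumes "J \<subseteq> carrier A \<times> carrier B"
    and "\<And>x y x' y'. \<lbrakk>x \<in> carrier A; y \<in> carrier B; (x', y') \<in> J; x \<sqsubseteq>\<^bsub>A\<^esub> x'; y \<sqsubseteq>\<^bsub>B\<^esub> y'\<rbrakk> \<Longrightarrow> (x, y) \<in> J"
    and "\<And>X y. \<lbrakk>X \<subseteq> carrier A; y \<in> carrier B; \<And>x. x \<in> X \<Longrightarrow> (x, y) \<in> J\<rbrakk> \<Longrightarrow> (\<Squnion>\<^bsub>A\<^esub> X, y) \<in> J"
    and "\<And>x Y. \<lbrakk>x \<in> carrier A; Y \<subseteq> carrier B; \<And>y. y \<in> Y \<Longrightarrow> (x, y) \<in> J\<rbrakk> \<Longrightarrow> (x, \<Squnion>\<^bsub>B\<^esub> Y) \<in> J"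
    and "\<And>x y c. \<lbrakk>x \<in> carrier A; y \<in> carrier B; c \<in> carrier C\<rbrakk> \<Longrightarrow>
           (f c \<sqinter>\<^bsub>A\<^esub> x, y) \<in> J \<longleftrightarrow> (x, g c \<sqinter>\<^bsub>B\<^esub> y) \<in> J"
  shows "pb_ideal A B C f g J"
  unfolding pb_ideal_def
proof (intro conjI)
  show "\<forall>X y. X \<subseteq> carrier A \<longrightarrow> y \<in> carrier B \<longrightarrow> X \<times> {y} \<subseteq> J \<longrightarrow> (\<Squnion>\<^bsub>A\<^esub> X, y) \<in> J"
    using assms(3) by blast
  show "\<forall>x Y. x \<in> carrier A \<longrightarrow> Y \<subseteq> carrier B \<longrightarrow> {x} \<times> Y \<subseteq> J \<longrightarrow> (x, \<Squnion>\<^bsub>B\<^esub> Y) \<in> J"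
    using assms(4) by blast
qed (use assms(1,2,5) in blast)+

lemma pb_idealD:
  assumes "pb_ideal A B C f g J"
  shows "J \<subseteq> carrier A \<times> carrier B"
    and "\<lbrakk>x \<in> carrier A; y \<in> carrier B; (x', y') \<in> J; x \<sqsubseteq>\<^bsub>A\<^esub> x'; y \<sqsubseteq>\<^bsub>B\<^esub> y'\<rbrakk> \<Longrightarrow> (x, y) \<in> J"
    and "\<lbrakk>X \<subseteq> carrier A; y \<in> carrier B; \<And>x. x \<in> X \<Longrightarrow> (x, y) \<in> J\<rbrakk> \<Longrightarrow> (\<Squnion>\<^bsub>A\<^esub> X, y) \<in> J"
    and "\<lbrakk>x \<in> carrier A; Y \<subseteq> carrier B; \<And>y. y \<in> Y \<Longrightarrow> (x, y) \<in> J\<rbrakk> \<Longrightarrow> (x, \<Squnion>\<^bsub>B\<^esub> Y) \<in> J"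
    and "\<lbrakk>x \<in> carrier A; y \<in> carrier B; c \<in> carrier C\<rbrakk> \<Longrightarrow>
           (f c \<sqinter>\<^bsub>A\<^esub> x, y) \<in> J \<longleftrightarrow> (x, g c \<sqinter>\<^bsub>B\<^esub> y) \<in> J"
proof -
  note J = assms[unfolded pb_ideal_def]
  show "J \<subseteq> carrier A \<times> carrier B"
    using J by (rule conjunct1)
  show "(x, y) \<in> J"
    if "x \<in> carrier A" "y \<in> carrier B" "(x', y') \<in> J" "x \<sqsubseteq>\<^bsub>A\<^esub> x'" "y \<sqsubseteq>\<^bsub>B\<^esub> y'"
    using J[THEN conjunct2, THEN conjunct1, THEN bspec, THEN bspec, THEN bspec, OF that(1-3)] that
    by simp
  show "(\<Squnion>\<^bsub>A\<^esub> X, y) \<in> J"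
    if "X \<subseteq> carrier A" "y \<in> carrier B" "\<And>x. x \<in> X \<Longrightarrow> (x, y) \<in> J"
    using J[THEN conjunct2, THEN conjunct2, THEN conjunct1, rule_format, OF that(1,2)] that(3)
    by auto
  show "(x, \<Squnion>\<^bsub>B\<^esub> Y) \<in> J"
    if "x \<in> carrier A" "Y \<subseteq> carrier B" "\<And>y. y \<in> Y \<Longrightarrow> (x, y) \<in> J"
    using J[THEN conjunct2, THEN conjunct2, THEN conjunct2, THEN conjunct1, rule_format, OF that(1,2)] that(3)
    by auto
  show "(f c \<sqinter>\<^bsub>A\<^esub> x, y) \<in> J \<longleftrightarrow> (x, g c \<sqinter>\<^bsub>B\<^esub> y) \<in> J"
    if "x \<in> carrier A" "y \<in> carrier B" "c \<in> carrier C"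
    using J that by simp
qed

lemma pb_ideal_Inter:
  assumes "F \<noteq> {}" "\<And>J. J \<in> F \<Longrightarrow> pb_ideal A B C f g J"
  shows "pb_ideal A B C f g (\<Inter>F)"
proof (rule pb_idealI)
  show "\<Inter>F \<subseteq> carrier A \<times> carrier B"
    using assms pb_idealD(1) by blast
next
  fix x y x' y' assume "x \<in> carrier A" "y \<in> carrier B" "(x', y') \<in> \<Inter>F" "x \<sqsubseteq>\<^bsub>A\<^esub> x'" "y \<sqsubseteq>\<^bsub>B\<^esub> y'"
  then show "(x, y) \<in> \<Inter>F"
    using assms pb_idealD(2) by blast
next
  fix X y assume "X \<subseteq> carrier A" "y \<in> carrier B" "\<And>x. x \<in> X \<Longrightarrow> (x, y) \<in> \<Inter>F"
  then show "(\<Squnion>\<^bsub>A\<^esub> X, y) \<in> \<Inter>F"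
    using assms(2) by (auto intro: pb_idealD(3))
next
  fix x Y assume "x \<in> carrier A" "Y \<subseteq> carrier B" "\<And>y. y \<in> Y \<Longrightarrow> (x, y) \<in> \<Inter>F"
  then show "(x, \<Squnion>\<^bsub>B\<^esub> Y) \<in> \<Inter>F"
    using assms(2) by (auto intro: pb_idealD(4))
next
  fix x y c assume "x \<in> carrier A" "y \<in> carrier B" "c \<in> carrier C"
  then show "(f c \<sqinter>\<^bsub>A\<^esub> x, y) \<in> \<Inter>F \<longleftrightarrow> (x, g c \<sqinter>\<^bsub>B\<^esub> y) \<in> \<Inter>F"
    using assms(2) pb_idealD(5) by blast
qed

sublocale PB: closure_system PB "carrier A \<times> carrier B"
proof
  have "pb_ideal A B C f g (carrier A \<times> carrier B)"
    by (rule pb_idealI) auto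
  then show "carrier A \<times> carrier B \<in> carrier PB"
    by (simp add: carrier_PB)
  show "\<Inter>F \<in> carrier PB" if "F \<subseteq> carrier PB" "F \<noteq> {}" for F
    using that pb_ideal_Inter[OF that(2)] by (simp add: carrier_PB subset_iff)
qed (auto simp: pullback_def pb_idealD(1))

text \<open>
  The pullback is distributive because its ideals have residuals: the ideal below describes the
  Heyting implication from \<open>x \<otimes> y\<close> to \<open>L\<close>.
\<close>

lemma pb_ideal_residual:
  assumes L: "pb_ideal A B C f g L" and xy: "x \<in> carrier A" "y \<in> carrier B"
  shows "pb_ideal A B C f g {(a, b) \<in> carrier A \<times> carrier B. (a \<sqinter>\<^bsub>A\<^esub> x, b \<sqinter>\<^bsub>B\<^esub> y) \<in> L}"
proof (rule pb_idealI)
  fix a b a' b'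
  assume "a \<in> carrier A" "b \<in> carrier B" "a \<sqsubseteq>\<^bsub>A\<^esub> a'" "b \<sqsubseteq>\<^bsub>B\<^esub> b'"
    "(a', b') \<in> {(a, b) \<in> carrier A \<times> carrier B. (a \<sqinter>\<^bsub>A\<^esub> x, b \<sqinter>\<^bsub>B\<^esub> y) \<in> L}"
  then show "(a, b) \<in> {(a, b) \<in> carrier A \<times> carrier B. (a \<sqinter>\<^bsub>A\<^esub> x, b \<sqinter>\<^bsub>B\<^esub> y) \<in> L}"
    using xy by (auto intro!: pb_idealD(2)[OF L, of _ _ "a' \<sqinter>\<^bsub>A\<^esub> x" "b' \<sqinter>\<^bsub>B\<^esub> y"] A.meet_mono B.meet_mono)
next
  fix X b assume *: "X \<subseteq> carrier A" "b \<in> carrier B"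
    "\<And>a. a \<in> X \<Longrightarrow> (a, b) \<in> {(a, b) \<in> carrier A \<times> carrier B. (a \<sqinter>\<^bsub>A\<^esub> x, b \<sqinter>\<^bsub>B\<^esub> y) \<in> L}"
  have "(\<Squnion>\<^bsub>A\<^esub> ((\<lambda>a. a \<sqinter>\<^bsub>A\<^esub> x) ` X), b \<sqinter>\<^bsub>B\<^esub> y) \<in> L"
    using * xy by (intro pb_idealD(3)[OF L]) auto
  then show "(\<Squnion>\<^bsub>A\<^esub> X, b) \<in> {(a, b) \<in> carrier A \<times> carrier B. (a \<sqinter>\<^bsub>A\<^esub> x, b \<sqinter>\<^bsub>B\<^esub> y) \<in> L}"
    using * xy by (simp add: A.Sup_meet)
next
  fix a Y assume *: "a \<in> carrier A" "Y \<subseteq> carrier B"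
    "\<And>b. b \<in> Y \<Longrightarrow> (a, b) \<in> {(a, b) \<in> carrier A \<times> carrier B. (a \<sqinter>\<^bsub>A\<^esub> x, b \<sqinter>\<^bsub>B\<^esub> y) \<in> L}"
  have "(a \<sqinter>\<^bsub>A\<^esub> x, \<Squnion>\<^bsub>B\<^esub> ((\<lambda>b. b \<sqinter>\<^bsub>B\<^esub> y) ` Y)) \<in> L"
    using * xy by (intro pb_idealD(4)[OF L]) auto
  then show "(a, \<Squnion>\<^bsub>B\<^esub> Y) \<in> {(a, b) \<in> carrier A \<times> carrier B. (a \<sqinter>\<^bsub>A\<^esub> x, b \<sqinter>\<^bsub>B\<^esub> y) \<in> L}"
    using * xy by (simp add: B.Sup_meet)
next
  fix a b c assume "a \<in> carrier A" "b \<in> carrier B" "c \<in> carrier C"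
  then show "(f c \<sqinter>\<^bsub>A\<^esub> a, b) \<in> {(a, b) \<in> carrier A \<times> carrier B. (a \<sqinter>\<^bsub>A\<^esub> x, b \<sqinter>\<^bsub>B\<^esub> y) \<in> L} \<longleftrightarrow>
    (a, g c \<sqinter>\<^bsub>B\<^esub> b) \<in> {(a, b) \<in> carrier A \<times> carrier B. (a \<sqinter>\<^bsub>A\<^esub> x, b \<sqinter>\<^bsub>B\<^esub> y) \<in> L}"
    using pb_idealD(5)[OF L, of "a \<sqinter>\<^bsub>A\<^esub> x" "b \<sqinter>\<^bsub>B\<^esub> y" c] xy
    by (simp add: A.meet_assoc B.meet_assoc)
qed auto

sublocale PB: frame PB
proof
  fix J F assume J: "J \<in> carrier PB" and F: "F \<subseteq> carrier PB"
  let ?L = "\<Squnion>\<^bsub>PB\<^esub> ((\<lambda>K. J \<sqinter>\<^bsub>PB\<^esub> K) ` F)"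
  have closed: "(\<lambda>K. J \<sqinter>\<^bsub>PB\<^esub> K) ` F \<subseteq> carrier PB"
    using J F by auto
  have L: "?L \<in> carrier PB"
    using closed by simp
  have J_ideal: "pb_ideal A B C f g J"
    using J by (simp add: carrier_PB)
  have "J \<inter> \<Squnion>\<^bsub>PB\<^esub> F \<subseteq> ?L"
  proof (rule subrelI)
    fix x y assume xy: "(x, y) \<in> J \<inter> \<Squnion>\<^bsub>PB\<^esub> F"
    then have x: "x \<in> carrier A" and y: "y \<in> carrier B"
      using pb_idealD(1)[OF J_ideal] by auto
    let ?R = "{(a, b) \<in> carrier A \<times> carrier B. (a \<sqinter>\<^bsub>A\<^esub> x, b \<sqinter>\<^bsub>B\<^esub> y) \<in> ?L}"
    have R: "?R \<in> carrier PB"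
      using pb_ideal_residual[OF _ x y] L by (simp add: carrier_PB)
    have "K \<subseteq> ?R" if K: "K \<in> F" for K
    proof (rule subrelI)
      fix a b assume ab: "(a, b) \<in> K"
      have K_ideal: "pb_ideal A B C f g K"
        using K F by (auto simp: carrier_PB)
      have a: "a \<in> carrier A" and b: "b \<in> carrier B"
        using pb_idealD(1)[OF K_ideal] ab by auto
      have "(a \<sqinter>\<^bsub>A\<^esub> x, b \<sqinter>\<^bsub>B\<^esub> y) \<in> J \<inter> K"
        using xy ab a b x y
        by (auto intro: pb_idealD(2)[OF J_ideal, of _ _ x y] pb_idealD(2)[OF K_ideal, of _ _ a b]
            A.meet_left A.meet_right B.meet_left B.meet_right)
      moreover have "J \<inter> K \<subseteq> ?L"
        using PB.sup_upper[OF closed imageI[OF K]] PB.meet_eq[OF J, of K] K F by (auto simp: le_PB)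
      ultimately show "(a, b) \<in> ?R"
        using a b by auto
    qed
    then have "\<Squnion>\<^bsub>PB\<^esub> F \<subseteq> ?R"
      using PB.sup_least[OF F R] by (auto simp: le_PB)
    then show "(x, y) \<in> ?L"
      using xy x y by (auto simp: A.meet_absorb B.meet_absorb)
  qed
  moreover have "?L \<subseteq> J \<inter> \<Squnion>\<^bsub>PB\<^esub> F"
  proof -
    have "J \<sqinter>\<^bsub>PB\<^esub> K \<subseteq> J \<sqinter>\<^bsub>PB\<^esub> \<Squnion>\<^bsub>PB\<^esub> F" if "K \<in> F" for K
      using PB.meet_mono[of J J K "\<Squnion>\<^bsub>PB\<^esub> F"] PB.sup_upper[OF F that] J F that
      by (auto simp: le_PB)
    then have "?L \<subseteq> J \<sqinter>\<^bsub>PB\<^esub> \<Squnion>\<^bsub>PB\<^esub> F"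
      using PB.sup_least[OF closed, of "J \<sqinter>\<^bsub>PB\<^esub> \<Squnion>\<^bsub>PB\<^esub> F"] J F by (auto simp: le_PB)
    then show ?thesis
      using J F by (simp add: PB.meet_eq)
  qed
  ultimately show "J \<sqinter>\<^bsub>PB\<^esub> \<Squnion>\<^bsub>PB\<^esub> F = ?L"
    using PB.meet_eq[OF J PB.sup_closed[OF F]] by blast
qed

lemma tensor_closed:
  assumes "x \<in> carrier A" "y \<in> carrier B"
  shows "tensor x y \<in> carrier PB"
proof -
  have "carrier A \<times> carrier B \<in> {J. pb_ideal A B C f g J \<and> (x, y) \<in> J}"
    using assms PB.whole by (simp add: carrier_PB)
  then show ?thesis
    unfolding carrier_PB pb_tensor_def by (intro pb_ideal_Inter) auto
qed

lemma tensor_subset_iff: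
  assumes "x \<in> carrier A" "y \<in> carrier B" "J \<in> carrier PB"
  shows "tensor x y \<subseteq> J \<longleftrightarrow> (x, y) \<in> J"
  using assms by (auto simp: pb_tensor_def carrier_PB)

lemma tensor_mem:
  assumes "x \<in> carrier A" "y \<in> carrier B"
  shows "(x, y) \<in> tensor x y"
  using tensor_subset_iff[OF assms tensor_closed[OF assms]] by simp

lemma tensor_inter:
  assumes x: "x \<in> carrier A" "x' \<in> carrier A" and y: "y \<in> carrier B" "y' \<in> carrier B"
  shows "tensor x y \<inter> tensor x' y' = tensor (x \<sqinter>\<^bsub>A\<^esub> x') (y \<sqinter>\<^bsub>B\<^esub> y')"
proof
  let ?L = "tensor (x \<sqinter>\<^bsub>A\<^esub> x') (y \<sqinter>\<^bsub>B\<^esub> y')"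
  have L: "?L \<in> carrier PB" "pb_ideal A B C f g ?L"
    using tensor_closed[of "x \<sqinter>\<^bsub>A\<^esub> x'" "y \<sqinter>\<^bsub>B\<^esub> y'"] x y by (simp_all add: carrier_PB)
  show "tensor x y \<inter> tensor x' y' \<subseteq> ?L"
  proof (rule subrelI)
    fix a b assume ab: "(a, b) \<in> tensor x y \<inter> tensor x' y'"
    then have a: "a \<in> carrier A" and b: "b \<in> carrier B"
      using PB.bounded[OF tensor_closed[OF x(1) y(1)]] by auto
    let ?R = "\<lambda>x y. {(a, b) \<in> carrier A \<times> carrier B. (a \<sqinter>\<^bsub>A\<^esub> x, b \<sqinter>\<^bsub>B\<^esub> y) \<in> ?L}"
    have "(x, y) \<in> ?R x' y'"
      using x y tensor_mem[of "x \<sqinter>\<^bsub>A\<^esub> x'" "y \<sqinter>\<^bsub>B\<^esub> y'"] by auto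
    then have "tensor x y \<subseteq> ?R x' y'"
      using pb_ideal_residual[OF L(2) x(2) y(2)] x y by (subst tensor_subset_iff) (auto simp: carrier_PB)
    then have "(a \<sqinter>\<^bsub>A\<^esub> x', b \<sqinter>\<^bsub>B\<^esub> y') \<in> ?L"
      using ab by auto
    then have "(x', y') \<in> ?R a b"
      using x y by (auto simp: meet_comm meet_comm)
    then have "tensor x' y' \<subseteq> ?R a b"
      using pb_ideal_residual[OF L(2) a b] x y by (subst tensor_subset_iff) (auto simp: carrier_PB)
    then have "(a \<sqinter>\<^bsub>A\<^esub> a, b \<sqinter>\<^bsub>B\<^esub> b) \<in> ?L"
      using ab by auto
    then show "(a, b) \<in> ?L"
      using a b by (simp add: A.meet_absorb B.meet_absorb)
  qed
  have "(x \<sqinter>\<^bsub>A\<^esub> x', y \<sqinter>\<^bsub>B\<^esub> y') \<in> tensor x y"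
    using x y tensor_closed[OF x(1) y(1)] tensor_mem[OF x(1) y(1)]
    by (auto simp: carrier_PB intro!: A.meet_left B.meet_left elim!: pb_idealD(2))
  moreover have "(x \<sqinter>\<^bsub>A\<^esub> x', y \<sqinter>\<^bsub>B\<^esub> y') \<in> tensor x' y'"
    using x y tensor_closed[OF x(2) y(2)] tensor_mem[OF x(2) y(2)]
    by (auto simp: carrier_PB intro!: A.meet_right B.meet_right elim!: pb_idealD(2))
  ultimately show "?L \<subseteq> tensor x y \<inter> tensor x' y'"
    using x y by (auto simp: tensor_subset_iff tensor_closed)
qed

lemma tensor_top: "tensor \<top>\<^bsub>A\<^esub> \<top>\<^bsub>B\<^esub> = carrier A \<times> carrier B"
proof -
  have "pb_ideal A B C f g (tensor \<top>\<^bsub>A\<^esub> \<top>\<^bsub>B\<^esub>)"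
    using tensor_closed[of "\<top>\<^bsub>A\<^esub>" "\<top>\<^bsub>B\<^esub>"] by (simp add: carrier_PB)
  then show ?thesis
    using PB.bounded[OF tensor_closed[of "\<top>\<^bsub>A\<^esub>" "\<top>\<^bsub>B\<^esub>"]] tensor_mem[of "\<top>\<^bsub>A\<^esub>" "\<top>\<^bsub>B\<^esub>"]
    by (auto elim!: pb_idealD(2))
qed

lemma tensor_mono:
  assumes "x \<in> carrier A" "x' \<in> carrier A" "y \<in> carrier B" "y' \<in> carrier B"
    and "x \<sqsubseteq>\<^bsub>A\<^esub> x'" "y \<sqsubseteq>\<^bsub>B\<^esub> y'"
  shows "tensor x y \<subseteq> tensor x' y'"
  using tensor_inter[of x x' y y'] assms by (auto simp: A.meet_absorb B.meet_absorb)

lemma proj1_hom: "pb_proj1 A B C f g \<in> frame_hom A PB"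
proof (rule frame_homI)
  show closed: "pb_proj1 A B C f g x \<in> carrier PB" if "x \<in> carrier A" for x
    using that by (simp add: pb_proj1_def tensor_closed)
  show "pb_proj1 A B C f g (\<Squnion>\<^bsub>A\<^esub> X) = \<Squnion>\<^bsub>PB\<^esub> (pb_proj1 A B C f g ` X)" if X: "X \<subseteq> carrier A" for X
  proof (rule PB.sup_eqI[symmetric])
    fix J assume J: "J \<in> carrier PB" "\<And>K. K \<in> pb_proj1 A B C f g ` X \<Longrightarrow> K \<sqsubseteq>\<^bsub>PB\<^esub> J"
    then have "(x, \<top>\<^bsub>B\<^esub>) \<in> J" if "x \<in> X" for x
      using that X tensor_subset_iff[of x "\<top>\<^bsub>B\<^esub>" J] by (auto simp: pb_proj1_def le_PB)
    then have "(\<Squnion>\<^bsub>A\<^esub> X, \<top>\<^bsub>B\<^esub>) \<in> J"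
      using J(1) X by (auto simp: carrier_PB intro: pb_idealD(3))
    then show "pb_proj1 A B C f g (\<Squnion>\<^bsub>A\<^esub> X) \<sqsubseteq>\<^bsub>PB\<^esub> J"
      using J X tensor_subset_iff[of "\<Squnion>\<^bsub>A\<^esub> X" "\<top>\<^bsub>B\<^esub>" J] by (simp add: pb_proj1_def le_PB)
  next
    fix K assume "K \<in> pb_proj1 A B C f g ` X"
    then obtain x where x: "x \<in> X" "K = pb_proj1 A B C f g x" by auto
    have vc: "x \<in> carrier A" "\<Squnion>\<^bsub>A\<^esub> X \<in> carrier A" using x X by auto
    show "K \<sqsubseteq>\<^bsub>PB\<^esub> pb_proj1 A B C f g (\<Squnion>\<^bsub>A\<^esub> X)"
      unfolding x pb_proj1_def le_PB
      using A.sup_upper[OF X x(1)] vc by (intro tensor_mono) auto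
  qed (use X closed in auto)
  show "pb_proj1 A B C f g (x \<sqinter>\<^bsub>A\<^esub> y) = pb_proj1 A B C f g x \<sqinter>\<^bsub>PB\<^esub> pb_proj1 A B C f g y"
    if "x \<in> carrier A" "y \<in> carrier A" for x y
    using that tensor_inter[of x y "\<top>\<^bsub>B\<^esub>" "\<top>\<^bsub>B\<^esub>"]
    by (simp add: pb_proj1_def PB.meet_eq tensor_closed B.meet_top)
  show "pb_proj1 A B C f g \<top>\<^bsub>A\<^esub> = \<top>\<^bsub>PB\<^esub>"
    by (simp add: pb_proj1_def tensor_top PB.top_eq)
qed

lemma proj2_hom: "pb_proj2 A B C f g \<in> frame_hom B PB"
proof (rule frame_homI)
  show closed: "pb_proj2 A B C f g y \<in> carrier PB" if "y \<in> carrier B" for y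
    using that by (simp add: pb_proj2_def tensor_closed)
  show "pb_proj2 A B C f g (\<Squnion>\<^bsub>B\<^esub> Y) = \<Squnion>\<^bsub>PB\<^esub> (pb_proj2 A B C f g ` Y)" if Y: "Y \<subseteq> carrier B" for Y
  proof (rule PB.sup_eqI[symmetric])
    fix J assume J: "J \<in> carrier PB" "\<And>K. K \<in> pb_proj2 A B C f g ` Y \<Longrightarrow> K \<sqsubseteq>\<^bsub>PB\<^esub> J"
    then have "(\<top>\<^bsub>A\<^esub>, y) \<in> J" if "y \<in> Y" for y
      using that Y tensor_subset_iff[of "\<top>\<^bsub>A\<^esub>" y J] by (auto simp: pb_proj2_def le_PB)
    then have "(\<top>\<^bsub>A\<^esub>, \<Squnion>\<^bsub>B\<^esub> Y) \<in> J"
      using J(1) Y by (auto simp: carrier_PB intro: pb_idealD(4))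
    then show "pb_proj2 A B C f g (\<Squnion>\<^bsub>B\<^esub> Y) \<sqsubseteq>\<^bsub>PB\<^esub> J"
      using J Y tensor_subset_iff[of "\<top>\<^bsub>A\<^esub>" "\<Squnion>\<^bsub>B\<^esub> Y" J] by (simp add: pb_proj2_def le_PB)
  next
    fix K assume "K \<in> pb_proj2 A B C f g ` Y"
    then obtain y where y: "y \<in> Y" "K = pb_proj2 A B C f g y" by auto
    have vc: "y \<in> carrier B" "\<Squnion>\<^bsub>B\<^esub> Y \<in> carrier B" using y Y by auto
    show "K \<sqsubseteq>\<^bsub>PB\<^esub> pb_proj2 A B C f g (\<Squnion>\<^bsub>B\<^esub> Y)"
      unfolding y pb_proj2_def le_PB
      using B.sup_upper[OF Y y(1)] vc by (intro tensor_mono) auto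
  qed (use Y closed in auto)
  show "pb_proj2 A B C f g (x \<sqinter>\<^bsub>B\<^esub> y) = pb_proj2 A B C f g x \<sqinter>\<^bsub>PB\<^esub> pb_proj2 A B C f g y"
    if "x \<in> carrier B" "y \<in> carrier B" for x y
    using that tensor_inter[of "\<top>\<^bsub>A\<^esub>" "\<top>\<^bsub>A\<^esub>" x y]
    by (simp add: pb_proj2_def PB.meet_eq tensor_closed A.meet_top)
  show "pb_proj2 A B C f g \<top>\<^bsub>B\<^esub> = \<top>\<^bsub>PB\<^esub>"
    by (simp add: pb_proj2_def tensor_top PB.top_eq)
qed

lemma proj1_f_eq_proj2_g:
  assumes c: "c \<in> carrier C"
  shows "pb_proj1 A B C f g (f c) = pb_proj2 A B C f g (g c)"
proof -
  have *: "(f c, \<top>\<^bsub>B\<^esub>) \<in> J \<longleftrightarrow> (\<top>\<^bsub>A\<^esub>, g c) \<in> J" if "J \<in> carrier PB" for J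
    using that pb_idealD(5)[of J "\<top>\<^bsub>A\<^esub>" "\<top>\<^bsub>B\<^esub>" c] c by (simp add: carrier_PB A.meet_top B.meet_top)
  then show ?thesis
    by (auto simp: pb_proj1_def pb_proj2_def pb_tensor_def carrier_PB)
qed

lemma tensor_eq:
  assumes "x \<in> carrier A" "y \<in> carrier B"
  shows "tensor x y = pb_proj1 A B C f g x \<sqinter>\<^bsub>PB\<^esub> pb_proj2 A B C f g y"
  using tensor_inter[of x "\<top>\<^bsub>A\<^esub>" "\<top>\<^bsub>B\<^esub>" y] assms
  by (simp add: pb_proj1_def pb_proj2_def PB.meet_eq tensor_closed A.meet_top B.meet_top)

text \<open>Every element is the join of the tensors that it contains.\<close>

lemma pairing_proj:
  assumes J: "J \<in> carrier PB"
  shows "pairing PB (pb_proj1 A B C f g) (pb_proj2 A B C f g) J = J"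
proof -
  have JAB: "x \<in> carrier A" "y \<in> carrier B" if "(x, y) \<in> J" for x y
    using PB.bounded[OF J] that by auto
  have "pairing PB (pb_proj1 A B C f g) (pb_proj2 A B C f g) J = \<Squnion>\<^bsub>PB\<^esub> ((\<lambda>(x, y). tensor x y) ` J)"
    unfolding pairing_def by (rule arg_cong[of _ _ "Lattice.sup PB"], rule image_cong) (auto simp: tensor_eq JAB)
  also have "\<dots> = J"
  proof (rule PB.sup_eqI)
    fix K assume K: "K \<in> carrier PB" "\<And>x. x \<in> (\<lambda>(x, y). tensor x y) ` J \<Longrightarrow> x \<sqsubseteq>\<^bsub>PB\<^esub> K"
    have "(x, y) \<in> K" if "(x, y) \<in> J" for x y
    proof -
      have "tensor x y \<subseteq> K"
        using K(2)[of "tensor x y"] that by (force simp: le_PB)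
      then show ?thesis
        using tensor_mem JAB[OF that] by auto
    qed
    then show "J \<sqsubseteq>\<^bsub>PB\<^esub> K"
      by (auto simp: le_PB)
  next
    fix K assume "K \<in> (\<lambda>(x, y). tensor x y) ` J"
    then obtain x y where "(x, y) \<in> J" "K = tensor x y" by auto
    then show "K \<sqsubseteq>\<^bsub>PB\<^esub> J"
      using J JAB by (simp add: tensor_subset_iff le_PB)
  qed (use J JAB tensor_closed in auto)
  finally show ?thesis .
qed

end

lemma pairing_cong:
  assumes "J \<subseteq> S \<times> T" "\<And>x. x \<in> S \<Longrightarrow> h x = h' x" "\<And>y. y \<in> T \<Longrightarrow> k y = k' y"
  shows "pairing X h k J = pairing X h' k' J"
  unfolding pairing_def using assms by (intro arg_cong[of _ _ "Lattice.sup X"] image_cong) auto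

lemma (in frame_morphism) hom_pairing:
  assumes "J \<subseteq> S \<times> T" "\<And>x. x \<in> S \<Longrightarrow> h x \<in> carrier L" "\<And>y. y \<in> T \<Longrightarrow> k y \<in> carrier L"
  shows "f (pairing L h k J) = pairing M (\<lambda>x. f (h x)) (\<lambda>y. f (k y)) J"
proof -
  have "f (pairing L h k J) = \<Squnion>\<^bsub>M\<^esub> (f ` (\<lambda>(x, y). h x \<sqinter>\<^bsub>L\<^esub> k y) ` J)"
    unfolding pairing_def using assms by (intro hom_Sup) auto
  also have "f ` (\<lambda>(x, y). h x \<sqinter>\<^bsub>L\<^esub> k y) ` J = (\<lambda>(x, y). f (h x) \<sqinter>\<^bsub>M\<^esub> f (k y)) ` J"
    unfolding image_image using assms by (intro image_cong) (auto intro!: hom_meet)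
  finally show ?thesis
    by (simp add: pairing_def)
qed

text \<open>
  Maps \<open>X \<rightarrow> A\<close> and \<open>X \<rightarrow> B\<close> with the same composite to \<open>C\<close>, given by their inverse images \<open>h\<close> and
  \<open>k\<close>. The map \<open>\<langle>h, k\<rangle>\<close> that they induce into the pullback has inverse image \<open>pairing X h k\<close>.
\<close>

locale frame_square = frame_cospan A B C f g + X: frame X
  for A :: "'a gorder" and B :: "'b gorder" and C :: "'c gorder" and f g
    and X :: "'x gorder" +
  fixes h :: "'a \<Rightarrow> 'x" and k :: "'b \<Rightarrow> 'x"
  assumes h_hom: "h \<in> frame_hom A X" and k_hom: "k \<in> frame_hom B X"
    and commutes: "c \<in> carrier C \<Longrightarrow> h (f c) = k (g c)"
begin

sublocale h: frame_morphism A X h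
  by unfold_locales (rule h_hom)

sublocale k: frame_morphism B X k
  by unfold_locales (rule k_hom)

lemma pairing_summands:
  assumes "J \<in> carrier PB"
  shows "(\<lambda>(x, y). h x \<sqinter>\<^bsub>X\<^esub> k y) ` J \<subseteq> carrier X"
  using PB.bounded[OF assms] by auto

lemma pairing_closed:
  assumes "J \<in> carrier PB"
  shows "pairing X h k J \<in> carrier X"
  using pairing_summands[OF assms] by (simp add: pairing_def)

text \<open>The value at \<open>z\<close> of the right adjoint of \<open>pairing X h k\<close>.\<close>

lemma pb_ideal_right_adjoint:
  assumes z: "z \<in> carrier X"
  shows "{(x, y) \<in> carrier A \<times> carrier B. h x \<sqinter>\<^bsub>X\<^esub> k y \<sqsubseteq>\<^bsub>X\<^esub> z} \<in> carrier PB"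
  unfolding carrier_PB
proof (rule pb_idealI, goal_cases)
  case (2 x y x' y')
  then have "h x \<sqinter>\<^bsub>X\<^esub> k y \<sqsubseteq>\<^bsub>X\<^esub> h x' \<sqinter>\<^bsub>X\<^esub> k y'"
    by (auto intro!: X.meet_mono h.hom_mono k.hom_mono)
  with 2 z show ?case
    by (auto intro: X.le_trans)
next
  case (3 Y y)
  then have "h (\<Squnion>\<^bsub>A\<^esub> Y) \<sqinter>\<^bsub>X\<^esub> k y = \<Squnion>\<^bsub>X\<^esub> ((\<lambda>x. h x \<sqinter>\<^bsub>X\<^esub> k y) ` Y)"
    by (subst h.hom_Sup, simp, subst X.Sup_meet) (auto simp: image_image)
  with 3 z show ?case
    by (auto intro!: X.sup_least)
next
  case (4 x Y)
  then have "h x \<sqinter>\<^bsub>X\<^esub> k (\<Squnion>\<^bsub>B\<^esub> Y) = \<Squnion>\<^bsub>X\<^esub> ((\<lambda>y. h x \<sqinter>\<^bsub>X\<^esub> k y) ` Y)"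
    by (subst k.hom_Sup, simp, subst X.meet_Sup) (auto simp: image_image)
  with 4 z show ?case
    by (auto intro!: X.sup_least)
next
  case (5 x y c)
  then have "h (f c \<sqinter>\<^bsub>A\<^esub> x) \<sqinter>\<^bsub>X\<^esub> k y = h x \<sqinter>\<^bsub>X\<^esub> k (g c \<sqinter>\<^bsub>B\<^esub> y)"
    using X.meet_assoc[of "k (g c)" "h x" "k y"] X.meet_assoc[of "h x" "k (g c)" "k y"]
    by (simp add: h.hom_meet k.hom_meet commutes meet_comm)
  with 5 show ?case
    by simp
qed auto

lemma pairing_le_iff:
  assumes J: "J \<in> carrier PB" and z: "z \<in> carrier X"
  shows "pairing X h k J \<sqsubseteq>\<^bsub>X\<^esub> z \<longleftrightarrow> J \<subseteq> {(x, y) \<in> carrier A \<times> carrier B. h x \<sqinter>\<^bsub>X\<^esub> k y \<sqsubseteq>\<^bsub>X\<^esub> z}"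
  using PB.bounded[OF J] X.sup_le_iff[OF pairing_summands[OF J] z] by (auto simp: pairing_def)

lemma pairing_tensor:
  assumes "x \<in> carrier A" "y \<in> carrier B"
  shows "pairing X h k (tensor x y) = h x \<sqinter>\<^bsub>X\<^esub> k y"
proof (rule X.le_antisym)
  show "pairing X h k (tensor x y) \<sqsubseteq>\<^bsub>X\<^esub> h x \<sqinter>\<^bsub>X\<^esub> k y"
    using assms pb_ideal_right_adjoint[of "h x \<sqinter>\<^bsub>X\<^esub> k y"]
    by (subst pairing_le_iff) (auto simp: tensor_closed tensor_subset_iff)
  show "h x \<sqinter>\<^bsub>X\<^esub> k y \<sqsubseteq>\<^bsub>X\<^esub> pairing X h k (tensor x y)"
    unfolding pairing_def
    using assms pairing_summands[OF tensor_closed[OF assms]] tensor_mem[OF assms]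
    by (intro X.sup_upper) auto
qed (use assms in \<open>auto simp: tensor_closed pairing_closed\<close>)

lemma pairing_proj1: "x \<in> carrier A \<Longrightarrow> pairing X h k (pb_proj1 A B C f g x) = h x"
  by (simp add: pb_proj1_def pairing_tensor k.hom_top X.meet_top)

lemma pairing_proj2: "y \<in> carrier B \<Longrightarrow> pairing X h k (pb_proj2 A B C f g y) = k y"
  by (simp add: pb_proj2_def pairing_tensor h.hom_top X.meet_top)

lemma pairing_hom: "pairing X h k \<in> frame_hom PB X"
proof (rule frame_homI)
  fix F assume F: "F \<subseteq> carrier PB"
  show "pairing X h k (\<Squnion>\<^bsub>PB\<^esub> F) = \<Squnion>\<^bsub>X\<^esub> (pairing X h k ` F)"
  proof (rule X.sup_eqI[symmetric])
    fix z assume z: "z \<in> carrier X" "\<And>x. x \<in> pairing X h k ` F \<Longrightarrow> x \<sqsubseteq>\<^bsub>X\<^esub> z"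
    then have "J \<subseteq> {(x, y) \<in> carrier A \<times> carrier B. h x \<sqinter>\<^bsub>X\<^esub> k y \<sqsubseteq>\<^bsub>X\<^esub> z}" if "J \<in> F" for J
      using that F z(2)[OF imageI[OF that]] pairing_le_iff[of J z] z(1) by blast
    then show "pairing X h k (\<Squnion>\<^bsub>PB\<^esub> F) \<sqsubseteq>\<^bsub>X\<^esub> z"
      using F z(1) PB.sup_least[OF F pb_ideal_right_adjoint[OF z(1)]]
      by (subst pairing_le_iff) (auto simp: le_PB)
  next
    fix x assume "x \<in> pairing X h k ` F"
    then obtain J where J: "J \<in> F" "x = pairing X h k J" by auto
    then have "J \<subseteq> \<Squnion>\<^bsub>PB\<^esub> F"
      using PB.sup_upper[OF F] by (simp add: le_PB)
    moreover have "\<Squnion>\<^bsub>PB\<^esub> F \<subseteq> {(x, y) \<in> carrier A \<times> carrier B. h x \<sqinter>\<^bsub>X\<^esub> k y \<sqsubseteq>\<^bsub>X\<^esub> pairing X h k (\<Squnion>\<^bsub>PB\<^esub> F)}"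
      using F pairing_closed[of "\<Squnion>\<^bsub>PB\<^esub> F"] by (subst pairing_le_iff[symmetric]) auto
    ultimately show "x \<sqsubseteq>\<^bsub>X\<^esub> pairing X h k (\<Squnion>\<^bsub>PB\<^esub> F)"
      using F J pairing_closed[of "\<Squnion>\<^bsub>PB\<^esub> F"] by (auto simp: pairing_le_iff)
  qed (use F pairing_closed in auto)
next
  fix J K assume J: "J \<in> carrier PB" and K: "K \<in> carrier PB"
  have JK: "J \<sqinter>\<^bsub>PB\<^esub> K \<in> carrier PB"
    using J K by simp
  show "pairing X h k (J \<sqinter>\<^bsub>PB\<^esub> K) = pairing X h k J \<sqinter>\<^bsub>X\<^esub> pairing X h k K"
  proof (rule X.le_antisym)
    have "J \<subseteq> {(x, y) \<in> carrier A \<times> carrier B. h x \<sqinter>\<^bsub>X\<^esub> k y \<sqsubseteq>\<^bsub>X\<^esub> pairing X h k J}"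
      "K \<subseteq> {(x, y) \<in> carrier A \<times> carrier B. h x \<sqinter>\<^bsub>X\<^esub> k y \<sqsubseteq>\<^bsub>X\<^esub> pairing X h k K}"
      using pairing_le_iff[OF J pairing_closed[OF J]] pairing_le_iff[OF K pairing_closed[OF K]]
        pairing_closed[OF J] pairing_closed[OF K] by auto
    then have "pairing X h k (J \<sqinter>\<^bsub>PB\<^esub> K) \<sqsubseteq>\<^bsub>X\<^esub> pairing X h k J"
      "pairing X h k (J \<sqinter>\<^bsub>PB\<^esub> K) \<sqsubseteq>\<^bsub>X\<^esub> pairing X h k K"
      using J K JK pairing_closed by (auto simp: pairing_le_iff PB.meet_eq)
    then show "pairing X h k (J \<sqinter>\<^bsub>PB\<^esub> K) \<sqsubseteq>\<^bsub>X\<^esub> pairing X h k J \<sqinter>\<^bsub>X\<^esub> pairing X h k K"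
      using J K JK pairing_closed by (simp add: X.le_meet_iff)
    have "(h x \<sqinter>\<^bsub>X\<^esub> k y) \<sqinter>\<^bsub>X\<^esub> (h x' \<sqinter>\<^bsub>X\<^esub> k y') \<sqsubseteq>\<^bsub>X\<^esub> pairing X h k (J \<sqinter>\<^bsub>PB\<^esub> K)"
      if xy: "(x, y) \<in> J" and xy': "(x', y') \<in> K" for x y x' y'
    proof -
      have cl: "x \<in> carrier A" "x' \<in> carrier A" "y \<in> carrier B" "y' \<in> carrier B"
        using PB.bounded[OF J] PB.bounded[OF K] xy xy' by auto
      have "(x \<sqinter>\<^bsub>A\<^esub> x', y \<sqinter>\<^bsub>B\<^esub> y') \<in> J \<inter> K"
        using J K xy xy' cl
        by (auto simp: carrier_PB intro: A.meet_left A.meet_right B.meet_left B.meet_right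
            elim!: pb_idealD(2))
      then have "h (x \<sqinter>\<^bsub>A\<^esub> x') \<sqinter>\<^bsub>X\<^esub> k (y \<sqinter>\<^bsub>B\<^esub> y') \<sqsubseteq>\<^bsub>X\<^esub> pairing X h k (J \<sqinter>\<^bsub>PB\<^esub> K)"
        unfolding pairing_def using J K pairing_summands[OF JK]
        by (intro X.sup_upper) (auto simp: PB.meet_eq image_iff intro!: bexI[of _ "(x \<sqinter>\<^bsub>A\<^esub> x', y \<sqinter>\<^bsub>B\<^esub> y')"])
      then show ?thesis
        using cl X.meet_meet_swap[of "h x" "k y" "h x'" "k y'"] by (simp add: h.hom_meet k.hom_meet)
    qed
    then show "pairing X h k J \<sqinter>\<^bsub>X\<^esub> pairing X h k K \<sqsubseteq>\<^bsub>X\<^esub> pairing X h k (J \<sqinter>\<^bsub>PB\<^esub> K)"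
      using pairing_summands[OF J] pairing_summands[OF K] pairing_closed[OF JK]
      by (subst (1 2) pairing_def) (intro X.Sup_meet_Sup_le, auto)
  qed (use J K JK pairing_closed in auto)
next
  have "pairing X h k (tensor \<top>\<^bsub>A\<^esub> \<top>\<^bsub>B\<^esub>) = \<top>\<^bsub>X\<^esub>"
    by (simp add: pairing_tensor h.hom_top k.hom_top X.meet_top)
  then show "pairing X h k \<top>\<^bsub>PB\<^esub> = \<top>\<^bsub>X\<^esub>"
    by (simp add: tensor_top PB.top_eq)
qed (rule pairing_closed)

end


section \<open>Generalized arrows of a localic groupoid\<close>

text \<open>
  A generalized arrow of \<open>G\<close> is a map of locales \<open>g : X \<rightarrow> G\<^sub>1\<close>, given by its inverse image; two of them
  are composable if \<open>r \<circ> g = d \<circ> h\<close>.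
\<close>

definition composable :: "('o, 'a) groupoid_data \<Rightarrow> ('a \<Rightarrow> 'x) \<Rightarrow> ('a \<Rightarrow> 'x) \<Rightarrow> bool" where
  "composable G g h \<longleftrightarrow> (\<forall>c\<in>carrier (objs G). g (rmap G c) = h (dmap G c))"

text \<open>The composite \<open>m \<circ> \<langle>g, h\<rangle>\<close> of generalized arrows.\<close>

definition gmul :: "('o, 'a) groupoid_data \<Rightarrow> 'x gorder \<Rightarrow> ('a \<Rightarrow> 'x) \<Rightarrow> ('a \<Rightarrow> 'x) \<Rightarrow> 'a \<Rightarrow> 'x" where
  "gmul G X g h x = pairing X g h (mmap G x)"

context localic_groupoid
begin

sublocale ob: frame "objs G" by (rule objs_frame)
sublocale ar: frame "arrs G" by (rule arrs_frame)
sublocale d: frame_morphism "objs G" "arrs G" "dmap G" by unfold_locales (rule dmap_hom)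
sublocale r: frame_morphism "objs G" "arrs G" "rmap G" by unfold_locales (rule rmap_hom)
sublocale u: frame_morphism "arrs G" "objs G" "umap G" by unfold_locales (rule umap_hom)
sublocale i: frame_morphism "arrs G" "arrs G" "imap G" by unfold_locales (rule imap_hom)

sublocale prs: frame_cospan "arrs G" "arrs G" "objs G" "rmap G" "dmap G"
  by unfold_locales (rule rmap_hom dmap_hom)+

sublocale p2: closure_system "pairs2 G" "carrier (arrs G) \<times> carrier (arrs G)"
  unfolding pairs2_def by (rule prs.PB.closure_system_axioms)

sublocale p2: frame "pairs2 G"
  unfolding pairs2_def by (rule prs.PB.frame_axioms)

sublocale fst2: frame_morphism "arrs G" "pairs2 G" "fst2 G"
  by unfold_locales (unfold fst2_def pairs2_def, rule prs.proj1_hom)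

sublocale snd2: frame_morphism "arrs G" "pairs2 G" "snd2 G"
  by unfold_locales (unfold snd2_def pairs2_def, rule prs.proj2_hom)

sublocale m: frame_morphism "arrs G" "pairs2 G" "mmap G" by unfold_locales (rule mmap_hom)

lemma fst2_dmap_hom: "(\<lambda>c. fst2 G (dmap G c)) \<in> frame_hom (objs G) (pairs2 G)"
  by (rule frame_hom_comp[OF dmap_hom fst2.hom])

sublocale tri: frame_cospan "arrs G" "pairs2 G" "objs G" "rmap G" "\<lambda>c. fst2 G (dmap G c)"
  by unfold_locales (rule rmap_hom fst2_dmap_hom)+

lemma fst2_rmap: "c \<in> carrier (objs G) \<Longrightarrow> fst2 G (rmap G c) = snd2 G (dmap G c)"
  unfolding fst2_def snd2_def by (rule prs.proj1_f_eq_proj2_g)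

lemma mmap_subset: "x \<in> carrier (arrs G) \<Longrightarrow> mmap G x \<subseteq> carrier (arrs G) \<times> carrier (arrs G)"
  by (rule p2.bounded) simp

lemma gmul_cong:
  assumes "x \<in> carrier (arrs G)"
    and "\<And>y. y \<in> carrier (arrs G) \<Longrightarrow> g y = g' y" "\<And>y. y \<in> carrier (arrs G) \<Longrightarrow> h y = h' y"
  shows "gmul G X g h x = gmul G X g' h' x"
  unfolding gmul_def using mmap_subset[OF assms(1)] assms(2,3) by (rule pairing_cong)

lemma gmul_natural:
  assumes "frame_morphism X Y f" "x \<in> carrier (arrs G)"
    and "g \<in> frame_hom (arrs G) X" "h \<in> frame_hom (arrs G) X"
  shows "f (gmul G X g h x) = gmul G Y (\<lambda>y. f (g y)) (\<lambda>y. f (h y)) x"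
  unfolding gmul_def
  using assms(3,4)
  by (intro frame_morphism.hom_pairing[OF assms(1) mmap_subset[OF assms(2)]]) (auto simp: frame_hom_def)

text \<open>The generic composable pair has composite \<open>m\<close>.\<close>

lemma gmul_fst2_snd2: "x \<in> carrier (arrs G) \<Longrightarrow> gmul G (pairs2 G) (fst2 G) (snd2 G) x = mmap G x"
  unfolding gmul_def pairs2_def fst2_def snd2_def
  by (rule prs.pairing_proj) (use m.closed in \<open>simp add: pairs2_def\<close>)

context
  fixes X :: "'x gorder" and g h
  assumes X: "frame X"
    and g: "g \<in> frame_hom (arrs G) X" and h: "h \<in> frame_hom (arrs G) X"
    and gh: "composable G g h"
begin

interpretation X: frame X by (rule X)
interpretation g: frame_morphism "arrs G" X g by unfold_locales (rule g)
interpretation h: frame_morphism "arrs G" X h by unfold_locales (rule h)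
interpretation gh: frame_square "arrs G" "arrs G" "objs G" "rmap G" "dmap G" X g h
  using gh by unfold_locales (auto simp: composable_def intro: g h)

lemma pair_hom: "pairing X g h \<in> frame_hom (pairs2 G) X"
  unfolding pairs2_def by (rule gh.pairing_hom)

lemma pair_fst2: "x \<in> carrier (arrs G) \<Longrightarrow> pairing X g h (fst2 G x) = g x"
  unfolding fst2_def by (rule gh.pairing_proj1)

lemma pair_snd2: "x \<in> carrier (arrs G) \<Longrightarrow> pairing X g h (snd2 G x) = h x"
  unfolding snd2_def by (rule gh.pairing_proj2)

lemma gmul_hom: "gmul G X g h \<in> frame_hom (arrs G) X"
  using frame_hom_comp[OF mmap_hom pair_hom] by (simp add: gmul_def[abs_def])

lemma gmul_dmap: "c \<in> carrier (objs G) \<Longrightarrow> gmul G X g h (dmap G c) = g (dmap G c)"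
  by (simp add: gmul_def d_m pair_fst2)

lemma gmul_meet_le:
  assumes "x \<in> carrier (arrs G)" "y \<in> carrier (arrs G)" "z \<in> carrier (arrs G)"
    and "fst2 G x \<sqinter>\<^bsub>pairs2 G\<^esub> snd2 G y \<sqsubseteq>\<^bsub>pairs2 G\<^esub> mmap G z"
  shows "g x \<sqinter>\<^bsub>X\<^esub> h y \<sqsubseteq>\<^bsub>X\<^esub> gmul G X g h z"
proof -
  interpret p: frame_morphism "pairs2 G" X "pairing X g h"
    by unfold_locales (rule pair_hom)
  show ?thesis
    using p.hom_mono[OF _ _ assms(4)] assms by (simp add: p.hom_meet pair_fst2 pair_snd2 gmul_def)
qed

end

lemma gmul_assoc:
  assumes X: "frame X" and g: "g \<in> frame_hom (arrs G) X" and h: "h \<in> frame_hom (arrs G) X"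
    and k: "k \<in> frame_hom (arrs G) X" and gh: "composable G g h" and hk: "composable G h k"
    and x: "x \<in> carrier (arrs G)"
  shows "gmul G X g (gmul G X h k) x = gmul G X (gmul G X g h) k x"
proof -
  interpret X: frame X by (rule X)
  let ?p = "pairing X h k" and ?P = "pairing X g (pairing X h k)"
  interpret p: frame_morphism "pairs2 G" X ?p
    by unfold_locales (rule pair_hom[OF X h k hk])
  interpret sq: frame_square "arrs G" "pairs2 G" "objs G" "rmap G" "\<lambda>c. fst2 G (dmap G c)" X g ?p
    using gh by unfold_locales (auto simp: pair_fst2[OF X h k hk] composable_def intro: g p.hom)
  interpret P: frame_morphism "triples G" X ?P
    unfolding triples_def by unfold_locales (rule sq.pairing_hom)
  interpret head3: frame_morphism "arrs G" "triples G" "head3 G"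
    unfolding triples_def head3_def by unfold_locales (rule tri.proj1_hom)
  interpret tail3: frame_morphism "pairs2 G" "triples G" "tail3 G"
    unfolding triples_def tail3_def by unfold_locales (rule tri.proj2_hom)
  interpret ht: frame_square "arrs G" "arrs G" "objs G" "rmap G" "dmap G" "triples G" "head3 G"
      "\<lambda>z. tail3 G (fst2 G z)"
  proof
    show "(\<lambda>z. tail3 G (fst2 G z)) \<in> frame_hom (arrs G) (triples G)"
      by (rule frame_hom_comp[OF fst2.hom tail3.hom])
    show "head3 G (rmap G c) = tail3 G (fst2 G (dmap G c))" if "c \<in> carrier (objs G)" for c
      using tri.proj1_f_eq_proj2_g[OF that] by (simp add: head3_def tail3_def)
  qed (rule head3.hom)
  have P_head: "?P (head3 G y) = g y" if "y \<in> carrier (arrs G)" for y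
    using sq.pairing_proj1[OF that] by (simp add: head3_def)
  have P_tail: "?P (tail3 G J) = ?p J" if "J \<in> carrier (pairs2 G)" for J
    using sq.pairing_proj2[OF that] by (simp add: tail3_def)
  have P_gh: "?P (pairing (triples G) (head3 G) (\<lambda>z. tail3 G (fst2 G z)) (mmap G y)) = gmul G X g h y"
    if y: "y \<in> carrier (arrs G)" for y
  proof -
    have "?P (pairing (triples G) (head3 G) (\<lambda>z. tail3 G (fst2 G z)) (mmap G y)) =
        pairing X (\<lambda>z. ?P (head3 G z)) (\<lambda>z. ?P (tail3 G (fst2 G z))) (mmap G y)"
      using mmap_subset[OF y] by (rule P.hom_pairing) auto
    also have "\<dots> = gmul G X g h y"
      unfolding gmul_def
      using mmap_subset[OF y] by (rule pairing_cong) (auto simp: P_head P_tail pair_fst2[OF X h k hk])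
    finally show ?thesis .
  qed
  have "gmul G X g (gmul G X h k) x = pairing X (\<lambda>y. ?P (head3 G y)) (\<lambda>y. ?P (tail3 G (mmap G y))) (mmap G x)"
    unfolding gmul_def
    using mmap_subset[OF x] by (rule pairing_cong) (auto simp: P_head P_tail gmul_def)
  also have "\<dots> = ?P (pairing (triples G) (head3 G) (\<lambda>y. tail3 G (mmap G y)) (mmap G x))"
    using mmap_subset[OF x] by (rule P.hom_pairing[symmetric]) auto
  also have "\<dots> = ?P (pairing (triples G)
      (\<lambda>y. pairing (triples G) (head3 G) (\<lambda>z. tail3 G (fst2 G z)) (mmap G y))
      (\<lambda>y. tail3 G (snd2 G y)) (mmap G x))"
    by (simp only: assoc[OF x])
  also have "\<dots> = pairing X
      (\<lambda>y. ?P (pairing (triples G) (head3 G) (\<lambda>z. tail3 G (fst2 G z)) (mmap G y)))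
      (\<lambda>y. ?P (tail3 G (snd2 G y))) (mmap G x)"
    using mmap_subset[OF x]
  proof (rule P.hom_pairing)
    show "pairing (triples G) (head3 G) (\<lambda>z. tail3 G (fst2 G z)) (mmap G y) \<in> carrier (triples G)"
      if "y \<in> carrier (arrs G)" for y
      using ht.pairing_closed m.closed[OF that] by (simp add: pairs2_def)
  qed auto
  also have "\<dots> = gmul G X (gmul G X g h) k x"
    unfolding gmul_def[of _ _ "gmul G X g h"]
    using mmap_subset[OF x] by (rule pairing_cong) (auto simp: P_gh P_tail pair_snd2[OF X h k hk])
  finally show ?thesis .
qed

context
  fixes X :: "'x gorder" and g
  assumes X: "frame X" and g: "g \<in> frame_hom (arrs G) X"
begin

interpretation X: frame X by (rule X)
interpretation g: frame_morphism "arrs G" X g by unfold_locales (rule g)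

lemma inv_hom: "(\<lambda>y. g (imap G y)) \<in> frame_hom (arrs G) X"
  by (rule frame_hom_comp[OF imap_hom g])

lemma gmul_unit_left: "x \<in> carrier (arrs G) \<Longrightarrow> gmul G X (\<lambda>y. g (dmap G (umap G y))) g x = g x"
  using g.hom_pairing[OF mmap_subset, of x "\<lambda>y. dmap G (umap G y)" "\<lambda>y. y"] unit_left[of x]
  by (simp add: gmul_def)

lemma gmul_unit_right: "x \<in> carrier (arrs G) \<Longrightarrow> gmul G X g (\<lambda>y. g (rmap G (umap G y))) x = g x"
  using g.hom_pairing[OF mmap_subset, of x "\<lambda>y. y" "\<lambda>y. rmap G (umap G y)"] unit_right[of x]
  by (simp add: gmul_def)

lemma gmul_inv_right:
  "x \<in> carrier (arrs G) \<Longrightarrow> gmul G X g (\<lambda>y. g (imap G y)) x = g (dmap G (umap G x))"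
  using g.hom_pairing[OF mmap_subset, of x "\<lambda>y. y" "imap G"] inverse_right[of x]
  by (simp add: gmul_def)

lemma gmul_inv_left:
  "x \<in> carrier (arrs G) \<Longrightarrow> gmul G X (\<lambda>y. g (imap G y)) g x = g (rmap G (umap G x))"
  using g.hom_pairing[OF mmap_subset, of x "imap G" "\<lambda>y. y"] inverse_left[of x]
  by (simp add: gmul_def)

lemma gmul_inv_gmul:
  assumes h: "h \<in> frame_hom (arrs G) X" and gh: "composable G g h" and x: "x \<in> carrier (arrs G)"
  shows "gmul G X (\<lambda>y. g (imap G y)) (gmul G X g h) x = h x"
proof -
  have "gmul G X (\<lambda>y. g (imap G y)) (gmul G X g h) x = gmul G X (gmul G X (\<lambda>y. g (imap G y)) g) h x"
    using gh by (intro gmul_assoc[OF X inv_hom g h _ _ x]) (auto simp: composable_def r_i)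
  also have "\<dots> = gmul G X (\<lambda>y. h (dmap G (umap G y))) h x"
    using x gh by (intro gmul_cong) (auto simp: gmul_inv_left composable_def)
  also have "\<dots> = h x"
    using g.hom_pairing x frame_morphism.hom_pairing[of "arrs G" X h, OF _ mmap_subset[OF x],
        of "\<lambda>y. dmap G (umap G y)" "\<lambda>y. y"] unit_left[OF x] h
    by (simp add: gmul_def frame_morphism_def frame_morphism_axioms_def X arrs_frame)
  finally show ?thesis .
qed

end

text \<open>\<open>(g\<^sup>-\<^sup>1)\<^sup>-\<^sup>1 = (g\<^sup>-\<^sup>1)\<^sup>-\<^sup>1 (g\<^sup>-\<^sup>1 g) = g\<close>, for the generic arrow \<open>g\<close>.\<close>

lemma imap_imap:
  assumes x: "x \<in> carrier (arrs G)"
  shows "imap G (imap G x) = x"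
proof -
  note ii = inv_hom[OF arrs_frame imap_hom]
  have "x = gmul G (arrs G) (\<lambda>y. imap G (imap G y)) (gmul G (arrs G) (imap G) (\<lambda>y. y)) x"
    by (rule gmul_inv_gmul[OF arrs_frame imap_hom frame_hom_ident _ x, symmetric])
      (simp add: composable_def r_i)
  also have "\<dots> = gmul G (arrs G) (\<lambda>y. imap G (imap G y)) (\<lambda>y. imap G (imap G (rmap G (umap G y)))) x"
    using gmul_inv_left[OF arrs_frame frame_hom_ident] x by (intro gmul_cong) (auto simp: r_i d_i)
  also have "\<dots> = imap G (imap G x)"
    by (rule gmul_unit_right[OF arrs_frame ii x])
  finally show ?thesis ..
qed

text \<open>The inverse of an identity arrow \<open>u\<close> is \<open>u\<^sup>-\<^sup>1 = u u\<^sup>-\<^sup>1 = u\<close>.\<close>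

lemma umap_imap:
  assumes x: "x \<in> carrier (arrs G)"
  shows "umap G (imap G x) = umap G x"
proof -
  note ui = inv_hom[OF objs_frame umap_hom]
  have "umap G (imap G x) = gmul G (objs G) (\<lambda>y. umap G (imap G (dmap G (umap G y)))) (\<lambda>y. umap G (imap G y)) x"
    by (rule gmul_unit_left[OF objs_frame ui x, symmetric])
  also have "\<dots> = gmul G (objs G) (umap G) (\<lambda>y. umap G (imap G y)) x"
    using x by (intro gmul_cong) (auto simp: d_i r_u)
  also have "\<dots> = umap G x"
    using gmul_inv_right[OF objs_frame umap_hom x] x by (simp add: d_u)
  finally show ?thesis .
qed

text \<open>
  An inclusion of opens of \<open>G\<^sub>2\<close> is tested on the composable pairs \<open>(g, h)\<close> with \<open>g\<close> in \<open>x\<close> and \<open>h\<close> in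
  \<open>y\<close>; it suffices to take the generic one, which lives on the open sublocale \<open>x \<otimes> y\<close> of \<open>G\<^sub>2\<close>.
\<close>

lemma le_mmapI:
  assumes x: "x \<in> carrier (arrs G)" and y: "y \<in> carrier (arrs G)" and w: "w \<in> carrier (arrs G)"
    and le: "\<And>(Z :: ('a \<times> 'a) set gorder) g h.
      \<lbrakk>frame Z; g \<in> frame_hom (arrs G) Z; h \<in> frame_hom (arrs G) Z; composable G g h;
       g x = \<top>\<^bsub>Z\<^esub>; h y = \<top>\<^bsub>Z\<^esub>\<rbrakk> \<Longrightarrow> gmul G Z g h w = \<top>\<^bsub>Z\<^esub>"
  shows "fst2 G x \<sqinter>\<^bsub>pairs2 G\<^esub> snd2 G y \<sqsubseteq>\<^bsub>pairs2 G\<^esub> mmap G w"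
proof -
  define z where "z = fst2 G x \<sqinter>\<^bsub>pairs2 G\<^esub> snd2 G y"
  define Z where "Z = below (pairs2 G) z"
  have z: "z \<in> carrier (pairs2 G)"
    using x y by (simp add: z_def)
  have Z: "frame Z" and topZ: "\<top>\<^bsub>Z\<^esub> = z"
    using z unfolding Z_def by (simp_all add: p2.frame_below p2.top_below)
  interpret Z: frame Z by (rule Z)
  interpret restr: frame_morphism "pairs2 G" Z "\<lambda>x. x \<sqinter>\<^bsub>pairs2 G\<^esub> z"
    unfolding Z_def by (intro frame_morphism.intro p2.frame_axioms p2.frame_below z
        frame_morphism_axioms.intro p2.frame_hom_restrict)
  have "gmul G Z (\<lambda>x. fst2 G x \<sqinter>\<^bsub>pairs2 G\<^esub> z) (\<lambda>x. snd2 G x \<sqinter>\<^bsub>pairs2 G\<^esub> z) w = \<top>\<^bsub>Z\<^esub>"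
  proof (rule le[OF Z])
    show "fst2 G x \<sqinter>\<^bsub>pairs2 G\<^esub> z = \<top>\<^bsub>Z\<^esub>"
      using p2.meet_absorb(2)[of z "fst2 G x"] p2.meet_left[of "fst2 G x" "snd2 G y"] x y z
      unfolding topZ z_def by simp
    show "snd2 G y \<sqinter>\<^bsub>pairs2 G\<^esub> z = \<top>\<^bsub>Z\<^esub>"
      using p2.meet_absorb(2)[of z "snd2 G y"] p2.meet_right[of "fst2 G x" "snd2 G y"] x y z
      unfolding topZ z_def by simp
  qed (simp_all add: composable_def fst2_rmap frame_hom_comp[OF fst2.hom restr.hom]
      frame_hom_comp[OF snd2.hom restr.hom])
  then have "mmap G w \<sqinter>\<^bsub>pairs2 G\<^esub> z = z"
    using gmul_natural[OF restr.frame_morphism_axioms w fst2.hom snd2.hom] gmul_fst2_snd2[OF w]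
    by (simp add: topZ)
  then show ?thesis
    using w z unfolding z_def[symmetric] by (simp add: p2.le_iff_meet meet_comm[of _ z])
qed

end


section \<open>Local bisections\<close>

text \<open>An open part of \<open>G\<^sub>1\<close> on which \<open>d\<close> is an isomorphism onto an open part of \<open>G\<^sub>0\<close>.\<close>

definition bisection :: "('o, 'a) groupoid_data \<Rightarrow> 'a \<Rightarrow> bool" where
  "bisection G U \<longleftrightarrow> U \<in> carrier (arrs G) \<and> (\<exists>V\<in>carrier (objs G). U \<sqsubseteq>\<^bsub>arrs G\<^esub> dmap G V \<and>
     bij_betw (\<lambda>y. dmap G y \<sqinter>\<^bsub>arrs G\<^esub> U) {y \<in> carrier (objs G). y \<sqsubseteq>\<^bsub>objs G\<^esub> V}
       {x \<in> carrier (arrs G). x \<sqsubseteq>\<^bsub>arrs G\<^esub> U})"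

context localic_groupoid
begin

lemma bisectionE:
  assumes "bisection G U"
  obtains V \<sigma> where "V \<in> carrier (objs G)" "U \<in> carrier (arrs G)" "U \<sqsubseteq>\<^bsub>arrs G\<^esub> dmap G V"
    and "\<forall>x\<in>carrier (arrs G). \<sigma> x \<in> carrier (objs G)"
    and "\<forall>x\<in>carrier (arrs G). \<sigma> x \<sqsubseteq>\<^bsub>objs G\<^esub> V"
    and "\<forall>x\<in>carrier (arrs G). dmap G (\<sigma> x) \<sqinter>\<^bsub>arrs G\<^esub> U = x \<sqinter>\<^bsub>arrs G\<^esub> U"
    and "\<forall>y\<in>carrier (objs G). \<forall>x\<in>carrier (arrs G). y \<sqsubseteq>\<^bsub>objs G\<^esub> V \<longrightarrow>
           dmap G y \<sqinter>\<^bsub>arrs G\<^esub> U = x \<sqinter>\<^bsub>arrs G\<^esub> U \<longrightarrow> \<sigma> x = y"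
proof -
  let ?f = "\<lambda>y. dmap G y \<sqinter>\<^bsub>arrs G\<^esub> U"
  from assms obtain V where V: "V \<in> carrier (objs G)" and U: "U \<in> carrier (arrs G)"
    and UV: "U \<sqsubseteq>\<^bsub>arrs G\<^esub> dmap G V"
    and bij: "bij_betw ?f {y \<in> carrier (objs G). y \<sqsubseteq>\<^bsub>objs G\<^esub> V} {x \<in> carrier (arrs G). x \<sqsubseteq>\<^bsub>arrs G\<^esub> U}"
    by (auto simp: bisection_def)
  define \<sigma> where "\<sigma> x = the_inv_into {y \<in> carrier (objs G). y \<sqsubseteq>\<^bsub>objs G\<^esub> V} ?f (x \<sqinter>\<^bsub>arrs G\<^esub> U)" for x
  have x: "x \<sqinter>\<^bsub>arrs G\<^esub> U \<in> ?f ` {y \<in> carrier (objs G). y \<sqsubseteq>\<^bsub>objs G\<^esub> V}" if "x \<in> carrier (arrs G)" for x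
    using that U ar.meet_right[of x U] by (simp add: bij_betw_imp_surj_on[OF bij])
  note inj = bij_betw_imp_inj_on[OF bij]
  have "\<sigma> x \<in> carrier (objs G) \<and> \<sigma> x \<sqsubseteq>\<^bsub>objs G\<^esub> V \<and> dmap G (\<sigma> x) \<sqinter>\<^bsub>arrs G\<^esub> U = x \<sqinter>\<^bsub>arrs G\<^esub> U"
    if "x \<in> carrier (arrs G)" for x
    using the_inv_into_into[OF inj x[OF that] order_refl] f_the_inv_into_f[OF inj x[OF that]]
    by (auto simp: \<sigma>_def)
  moreover have "\<sigma> x = y" if "y \<in> carrier (objs G)" "y \<sqsubseteq>\<^bsub>objs G\<^esub> V"
    "dmap G y \<sqinter>\<^bsub>arrs G\<^esub> U = x \<sqinter>\<^bsub>arrs G\<^esub> U" for x y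
    unfolding \<sigma>_def using that by (intro the_inv_into_f_eq[OF inj]) auto
  ultimately show thesis
    using V U UV by (intro that[of V \<sigma>]) auto
qed

lemma bisection_subset:
  assumes "bisection G U" and s: "s \<in> carrier (arrs G)" "s \<sqsubseteq>\<^bsub>arrs G\<^esub> U"
  shows "bisection G s"
proof -
  obtain V \<sigma> where V: "V \<in> carrier (objs G)" and U: "U \<in> carrier (arrs G)"
    and UV: "U \<sqsubseteq>\<^bsub>arrs G\<^esub> dmap G V"
    and \<sigma>: "\<forall>x\<in>carrier (arrs G). \<sigma> x \<in> carrier (objs G)"
    and \<sigma>_V: "\<forall>x\<in>carrier (arrs G). \<sigma> x \<sqsubseteq>\<^bsub>objs G\<^esub> V"
    and d_\<sigma>: "\<forall>x\<in>carrier (arrs G). dmap G (\<sigma> x) \<sqinter>\<^bsub>arrs G\<^esub> U = x \<sqinter>\<^bsub>arrs G\<^esub> U"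
    and \<sigma>_eq: "\<forall>y\<in>carrier (objs G). \<forall>x\<in>carrier (arrs G). y \<sqsubseteq>\<^bsub>objs G\<^esub> V \<longrightarrow>
           dmap G y \<sqinter>\<^bsub>arrs G\<^esub> U = x \<sqinter>\<^bsub>arrs G\<^esub> U \<longrightarrow> \<sigma> x = y"
    using assms(1) by (rule bisectionE)
  note \<sigma> = \<sigma>[rule_format] and \<sigma>_V = \<sigma>_V[rule_format] and d_\<sigma> = d_\<sigma>[rule_format]
  have \<sigma>_eqI: "\<sigma> x = y" if "y \<in> carrier (objs G)" "y \<sqsubseteq>\<^bsub>objs G\<^esub> V" "x \<in> carrier (arrs G)"
    "dmap G y \<sqinter>\<^bsub>arrs G\<^esub> U = x \<sqinter>\<^bsub>arrs G\<^esub> U" for x y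
    using \<sigma>_eq that by simp
  have s_eq: "dmap G (\<sigma> s) \<sqinter>\<^bsub>arrs G\<^esub> U = s"
    using d_\<sigma>[of s] s U by (simp add: ar.meet_absorb)
  have s_le: "s \<sqsubseteq>\<^bsub>arrs G\<^esub> dmap G (\<sigma> s)"
    using ar.meet_left[of "dmap G (\<sigma> s)" U] s U \<sigma> by (simp add: s_eq)
  have le_V: "y \<sqsubseteq>\<^bsub>objs G\<^esub> V" if "y \<in> carrier (objs G)" "y \<sqsubseteq>\<^bsub>objs G\<^esub> \<sigma> s" for y
    using that \<sigma>[OF s(1)] \<sigma>_V[OF s(1)] V ob.le_trans by blast
  have restrict: "dmap G y \<sqinter>\<^bsub>arrs G\<^esub> s = dmap G y \<sqinter>\<^bsub>arrs G\<^esub> U"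
    if y: "y \<in> carrier (objs G)" "y \<sqsubseteq>\<^bsub>objs G\<^esub> \<sigma> s" for y
  proof -
    have "dmap G y \<sqinter>\<^bsub>arrs G\<^esub> s = (dmap G y \<sqinter>\<^bsub>arrs G\<^esub> dmap G (\<sigma> s)) \<sqinter>\<^bsub>arrs G\<^esub> U"
      using y \<sigma> s U by (simp add: ar.meet_assoc s_eq)
    also have "dmap G y \<sqinter>\<^bsub>arrs G\<^esub> dmap G (\<sigma> s) = dmap G y"
      using y \<sigma> s d.hom_mono by (simp add: ar.meet_absorb)
    finally show ?thesis .
  qed
  have "bij_betw (\<lambda>y. dmap G y \<sqinter>\<^bsub>arrs G\<^esub> s) {y \<in> carrier (objs G). y \<sqsubseteq>\<^bsub>objs G\<^esub> \<sigma> s}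
      {x \<in> carrier (arrs G). x \<sqsubseteq>\<^bsub>arrs G\<^esub> s}"
  proof (rule bij_betw_byWitness[where f' = \<sigma>])
    show "\<forall>y\<in>{y \<in> carrier (objs G). y \<sqsubseteq>\<^bsub>objs G\<^esub> \<sigma> s}. \<sigma> (dmap G y \<sqinter>\<^bsub>arrs G\<^esub> s) = y"
      using U le_V by (auto simp: restrict ar.meet_assoc ar.meet_absorb intro!: \<sigma>_eqI)
    have *: "x \<sqinter>\<^bsub>arrs G\<^esub> U = x" "\<sigma> x \<sqsubseteq>\<^bsub>objs G\<^esub> \<sigma> s" if x: "x \<in> carrier (arrs G)" "x \<sqsubseteq>\<^bsub>arrs G\<^esub> s" for x
    proof -
      show xU: "x \<sqinter>\<^bsub>arrs G\<^esub> U = x"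
        using x s U ar.le_trans[OF x(2) s(2)] by (simp add: ar.meet_absorb)
      have "dmap G (\<sigma> x \<sqinter>\<^bsub>objs G\<^esub> \<sigma> s) \<sqinter>\<^bsub>arrs G\<^esub> U = dmap G (\<sigma> x) \<sqinter>\<^bsub>arrs G\<^esub> s"
        using x s U \<sigma> by (simp add: d.hom_meet ar.meet_assoc s_eq)
      also have "\<dots> = dmap G (\<sigma> x) \<sqinter>\<^bsub>arrs G\<^esub> (U \<sqinter>\<^bsub>arrs G\<^esub> s)"
        using s U by (simp add: ar.meet_absorb)
      also have "\<dots> = x \<sqinter>\<^bsub>arrs G\<^esub> U"
        using ar.meet_assoc[of "dmap G (\<sigma> x)" U s] x s U \<sigma> xU by (simp add: d_\<sigma> ar.meet_absorb)
      finally have "\<sigma> x = \<sigma> x \<sqinter>\<^bsub>objs G\<^esub> \<sigma> s"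
        using ob.le_trans[OF ob.meet_left[of "\<sigma> x" "\<sigma> s"] \<sigma>_V[OF x(1)]] x s V \<sigma>
        by (intro \<sigma>_eqI) auto
      then show "\<sigma> x \<sqsubseteq>\<^bsub>objs G\<^esub> \<sigma> s"
        using x s \<sigma> by (simp add: ob.le_iff_meet)
    qed
    show "\<forall>x\<in>{x \<in> carrier (arrs G). x \<sqsubseteq>\<^bsub>arrs G\<^esub> s}. dmap G (\<sigma> x) \<sqinter>\<^bsub>arrs G\<^esub> s = x"
      using * \<sigma> by (auto simp: restrict d_\<sigma>)
    show "\<sigma> ` {x \<in> carrier (arrs G). x \<sqsubseteq>\<^bsub>arrs G\<^esub> s} \<subseteq> {y \<in> carrier (objs G). y \<sqsubseteq>\<^bsub>objs G\<^esub> \<sigma> s}"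
      using * \<sigma> by auto
  qed (use s in \<open>auto intro: ar.meet_right\<close>)
  then show ?thesis
    using s s_le \<sigma> by (auto simp: bisection_def)
qed

text \<open>Generalized arrows in a bisection are determined by their domains.\<close>

lemma bisection_unique:
  assumes "bisection G U" and X: "frame X"
    and g: "g \<in> frame_hom (arrs G) X" and h: "h \<in> frame_hom (arrs G) X"
    and gU: "g U = \<top>\<^bsub>X\<^esub>" and hU: "h U = \<top>\<^bsub>X\<^esub>"
    and dom: "\<And>c. c \<in> carrier (objs G) \<Longrightarrow> g (dmap G c) = h (dmap G c)"
    and x: "x \<in> carrier (arrs G)"
  shows "g x = h x"
proof -
  obtain c where U: "U \<in> carrier (arrs G)"
    and c: "c \<in> carrier (objs G)" "dmap G c \<sqinter>\<^bsub>arrs G\<^esub> U = x \<sqinter>\<^bsub>arrs G\<^esub> U"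
    using assms(1) x by (blast elim: bisectionE)
  have *: "f x = f (dmap G c)" if f: "f \<in> frame_hom (arrs G) X" and fU: "f U = \<top>\<^bsub>X\<^esub>" for f
  proof -
    interpret X: frame X by (rule X)
    interpret f: frame_morphism "arrs G" X f by unfold_locales (rule f)
    have "f x = f (x \<sqinter>\<^bsub>arrs G\<^esub> U)" and "f (dmap G (c)) = f (dmap G (c) \<sqinter>\<^bsub>arrs G\<^esub> U)"
      using x U c(1) by (simp_all add: f.hom_meet fU X.meet_top)
    then show ?thesis
      by (simp add: c(2))
  qed
  show ?thesis
    using *[OF g gU] *[OF h hU] dom[OF c(1)] by simp
qed

text \<open>
  The section of \<open>d\<close> over \<open>V\<close> with image \<open>U\<close>, composed with the restriction of \<open>d\<close> to the inverse
  image of \<open>V\<close>: each arrow with domain in \<open>V\<close> is sent to the arrow of \<open>U\<close> with the same domain.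
\<close>

lemma bisection_section:
  assumes "bisection G U"
  obtains V g where "V \<in> carrier (objs G)" "U \<sqsubseteq>\<^bsub>arrs G\<^esub> dmap G V"
    and "g \<in> frame_hom (arrs G) (below (arrs G) (dmap G V))"
    and "g U = dmap G V"
    and "\<And>c. c \<in> carrier (objs G) \<Longrightarrow> g (dmap G c) = dmap G c \<sqinter>\<^bsub>arrs G\<^esub> dmap G V"
proof -
  obtain V \<sigma> where V: "V \<in> carrier (objs G)" and U: "U \<in> carrier (arrs G)"
    and UV: "U \<sqsubseteq>\<^bsub>arrs G\<^esub> dmap G V"
    and \<sigma>: "\<forall>x\<in>carrier (arrs G). \<sigma> x \<in> carrier (objs G)"
    and \<sigma>_V: "\<forall>x\<in>carrier (arrs G). \<sigma> x \<sqsubseteq>\<^bsub>objs G\<^esub> V"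
    and d_\<sigma>: "\<forall>x\<in>carrier (arrs G). dmap G (\<sigma> x) \<sqinter>\<^bsub>arrs G\<^esub> U = x \<sqinter>\<^bsub>arrs G\<^esub> U"
    and \<sigma>_eq: "\<forall>y\<in>carrier (objs G). \<forall>x\<in>carrier (arrs G). y \<sqsubseteq>\<^bsub>objs G\<^esub> V \<longrightarrow>
           dmap G y \<sqinter>\<^bsub>arrs G\<^esub> U = x \<sqinter>\<^bsub>arrs G\<^esub> U \<longrightarrow> \<sigma> x = y"
    using assms(1) by (rule bisectionE)
  note \<sigma> = \<sigma>[rule_format] and \<sigma>_V = \<sigma>_V[rule_format] and d_\<sigma> = d_\<sigma>[rule_format]
  have \<sigma>_eqI: "\<sigma> x = y" if "y \<in> carrier (objs G)" "y \<sqsubseteq>\<^bsub>objs G\<^esub> V" "x \<in> carrier (arrs G)"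
    "dmap G y \<sqinter>\<^bsub>arrs G\<^esub> U = x \<sqinter>\<^bsub>arrs G\<^esub> U" for x y
    using \<sigma>_eq that by simp
  have \<sigma>_d: "\<sigma> (dmap G c) = c \<sqinter>\<^bsub>objs G\<^esub> V" if c: "c \<in> carrier (objs G)" for c
  proof (rule \<sigma>_eqI)
    show "dmap G (c \<sqinter>\<^bsub>objs G\<^esub> V) \<sqinter>\<^bsub>arrs G\<^esub> U = dmap G c \<sqinter>\<^bsub>arrs G\<^esub> U"
      using c V U UV by (simp add: d.hom_meet ar.meet_assoc ar.meet_absorb)
  qed (use c V in \<open>auto intro: ob.meet_right\<close>)
  have \<sigma>_U: "\<sigma> U = V" and \<sigma>_top: "\<sigma> \<top>\<^bsub>arrs G\<^esub> = V"
    using V U UV by (auto intro!: \<sigma>_eqI simp: ar.meet_absorb ar.meet_top)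
  have \<sigma>_hom: "\<sigma> \<in> frame_hom (arrs G) (below (objs G) V)"
  proof (rule frame_homI)
    fix X assume X: "X \<subseteq> carrier (arrs G)"
    then have sub: "\<sigma> ` X \<subseteq> carrier (objs G)" "\<sigma> ` X \<subseteq> carrier (below (objs G) V)"
      using \<sigma> \<sigma>_V by auto
    have "\<sigma> (\<Squnion>\<^bsub>arrs G\<^esub> X) = \<Squnion>\<^bsub>objs G\<^esub> (\<sigma> ` X)"
    proof (rule \<sigma>_eqI)
      show "\<Squnion>\<^bsub>objs G\<^esub> (\<sigma> ` X) \<sqsubseteq>\<^bsub>objs G\<^esub> V"
        using sub V by (intro ob.sup_least) auto
      have "dmap G (\<Squnion>\<^bsub>objs G\<^esub> (\<sigma> ` X)) \<sqinter>\<^bsub>arrs G\<^esub> U = \<Squnion>\<^bsub>arrs G\<^esub> ((\<lambda>x. dmap G (\<sigma> x) \<sqinter>\<^bsub>arrs G\<^esub> U) ` X)"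
        using sub X U \<sigma> by (subst d.hom_Sup, simp, subst ar.Sup_meet) (auto simp: image_image)
      also have "(\<lambda>x. dmap G (\<sigma> x) \<sqinter>\<^bsub>arrs G\<^esub> U) ` X = (\<lambda>x. x \<sqinter>\<^bsub>arrs G\<^esub> U) ` X"
        using X by (intro image_cong) (auto simp: d_\<sigma>)
      also have "\<Squnion>\<^bsub>arrs G\<^esub> \<dots> = \<Squnion>\<^bsub>arrs G\<^esub> X \<sqinter>\<^bsub>arrs G\<^esub> U"
        using X U by (simp add: ar.Sup_meet)
      finally show "dmap G (\<Squnion>\<^bsub>objs G\<^esub> (\<sigma> ` X)) \<sqinter>\<^bsub>arrs G\<^esub> U = \<Squnion>\<^bsub>arrs G\<^esub> X \<sqinter>\<^bsub>arrs G\<^esub> U" .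
    qed (use sub X in auto)
    then show "\<sigma> (\<Squnion>\<^bsub>arrs G\<^esub> X) = \<Squnion>\<^bsub>below (objs G) V\<^esub> (\<sigma> ` X)"
      using V sub by (simp only: ob.Sup_below)
  next
    fix x y assume xy: "x \<in> carrier (arrs G)" "y \<in> carrier (arrs G)"
    have "\<sigma> (x \<sqinter>\<^bsub>arrs G\<^esub> y) = \<sigma> x \<sqinter>\<^bsub>objs G\<^esub> \<sigma> y"
    proof (rule \<sigma>_eqI)
      show "\<sigma> x \<sqinter>\<^bsub>objs G\<^esub> \<sigma> y \<sqsubseteq>\<^bsub>objs G\<^esub> V"
        using ob.le_trans[OF ob.meet_left[of "\<sigma> x" "\<sigma> y"] \<sigma>_V[OF xy(1)]] xy V \<sigma> by simp
      show "dmap G (\<sigma> x \<sqinter>\<^bsub>objs G\<^esub> \<sigma> y) \<sqinter>\<^bsub>arrs G\<^esub> U = x \<sqinter>\<^bsub>arrs G\<^esub> y \<sqinter>\<^bsub>arrs G\<^esub> U"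
        using xy U \<sigma> ar.meet_meet_distrib[of "dmap G (\<sigma> x)" "dmap G (\<sigma> y)" U] ar.meet_meet_distrib[of x y U]
        by (simp add: d.hom_meet d_\<sigma>)
    qed (use xy \<sigma> in auto)
    then show "\<sigma> (x \<sqinter>\<^bsub>arrs G\<^esub> y) = \<sigma> x \<sqinter>\<^bsub>below (objs G) V\<^esub> \<sigma> y"
      using xy V \<sigma> \<sigma>_V by (simp add: ob.meet_below)
  qed (use \<sigma> \<sigma>_V \<sigma>_top V in \<open>auto simp: ob.top_below\<close>)
  show thesis
  proof
    show "(\<lambda>x. dmap G (\<sigma> x)) \<in> frame_hom (arrs G) (below (arrs G) (dmap G V))"
      by (rule frame_hom_comp[OF \<sigma>_hom d.frame_hom_below[OF V]])
    show "dmap G (\<sigma> U) = dmap G V"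
      by (simp add: \<sigma>_U)
    show "dmap G (\<sigma> (dmap G c)) = dmap G c \<sqinter>\<^bsub>arrs G\<^esub> dmap G V" if "c \<in> carrier (objs G)" for c
      using that V by (simp add: \<sigma>_d d.hom_meet)
  qed (rule V UV)+
qed

text \<open>
  The product of a bisection \<open>U\<close> and an open \<open>t\<close> exists, as the least open \<open>w\<close> whose inverse image
  under \<open>m\<close> contains \<open>U \<otimes> t\<close>. It consists of the arrows \<open>k\<close> with \<open>d k\<close> in \<open>V\<close> and \<open>g\<^sup>-\<^sup>1 k\<close> in \<open>t\<close>,
  where \<open>g\<close> is the arrow of \<open>U\<close> with the same domain as \<open>k\<close>. Below, \<open>\<kappa>\<close> is the generic such \<open>k\<close> on
  the open part \<open>X\<close> of \<open>G\<^sub>1\<close> given by \<open>d\<^sup>* V\<close>, and \<open>h = g\<^sup>-\<^sup>1 \<kappa>\<close>.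
\<close>

lemma bisection_product:
  assumes "bisection G U" and t: "t \<in> carrier (arrs G)"
  obtains w where "w \<in> carrier (arrs G)"
    and "fst2 G U \<sqinter>\<^bsub>pairs2 G\<^esub> snd2 G t \<sqsubseteq>\<^bsub>pairs2 G\<^esub> mmap G w"
    and "\<And>y. \<lbrakk>y \<in> carrier (arrs G); fst2 G U \<sqinter>\<^bsub>pairs2 G\<^esub> snd2 G t \<sqsubseteq>\<^bsub>pairs2 G\<^esub> mmap G y\<rbrakk> \<Longrightarrow> w \<sqsubseteq>\<^bsub>arrs G\<^esub> y"
proof -
  have U: "U \<in> carrier (arrs G)"
    using assms(1) by (simp add: bisection_def)
  obtain V g where V: "V \<in> carrier (objs G)" and UV: "U \<sqsubseteq>\<^bsub>arrs G\<^esub> dmap G V"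
    and g: "g \<in> frame_hom (arrs G) (below (arrs G) (dmap G V))"
    and gU: "g U = dmap G V"
    and gd: "\<And>c. c \<in> carrier (objs G) \<Longrightarrow> g (dmap G c) = dmap G c \<sqinter>\<^bsub>arrs G\<^esub> dmap G V"
    using bisection_section[OF assms(1)] by metis
  define dV where "dV = dmap G V"
  define X where "X = below (arrs G) dV"
  define \<kappa> where "\<kappa> x = x \<sqinter>\<^bsub>arrs G\<^esub> dV" for x
  define h where "h = gmul G X (\<lambda>y. g (imap G y)) \<kappa>"
  have dV: "dV \<in> carrier (arrs G)"
    using V by (simp add: dV_def)
  have X: "frame X" and topX: "\<top>\<^bsub>X\<^esub> = dV"
    using dV unfolding X_def by (simp_all add: ar.frame_below ar.top_below)
  have \<kappa>: "\<kappa> \<in> frame_hom (arrs G) X"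
    unfolding \<kappa>_def[abs_def] X_def by (rule ar.frame_hom_restrict[OF dV])
  note g = g[folded dV_def, folded X_def] and gU = gU[folded dV_def] and gd = gd[folded dV_def]
  have gi: "(\<lambda>y. g (imap G y)) \<in> frame_hom (arrs G) X"
    by (rule inv_hom[OF X g])
  have gi_\<kappa>: "composable G (\<lambda>y. g (imap G y)) \<kappa>"
    by (simp add: composable_def r_i gd \<kappa>_def)
  have h: "h \<in> frame_hom (arrs G) X"
    unfolding h_def by (rule gmul_hom[OF X gi \<kappa> gi_\<kappa>])
  have g_h: "composable G g h"
    using gmul_dmap[OF X gi \<kappa> gi_\<kappa>] by (simp add: composable_def h_def d_i)
  interpret X: frame X by (rule X)
  interpret h: frame_morphism "arrs G" X h by unfold_locales (rule h)
  have ht: "h t \<in> carrier X"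
    using t by simp
  show thesis
  proof
    show w: "h t \<in> carrier (arrs G)"
      using ht by (simp add: X_def)
    show "h t \<sqsubseteq>\<^bsub>arrs G\<^esub> y"
      if y: "y \<in> carrier (arrs G)" and le: "fst2 G U \<sqinter>\<^bsub>pairs2 G\<^esub> snd2 G t \<sqsubseteq>\<^bsub>pairs2 G\<^esub> mmap G y" for y
    proof -
      have "g U \<sqinter>\<^bsub>X\<^esub> h t \<sqsubseteq>\<^bsub>X\<^esub> gmul G X g h y"
        by (rule gmul_meet_le[OF X g h g_h U t y le])
      moreover have "gmul G X g h y = \<kappa> y"
        using gmul_inv_gmul[OF X gi \<kappa> gi_\<kappa> y] unfolding h_def
        by (subst (asm) gmul_cong[OF y, of "\<lambda>y. g (imap G (imap G y))" g]) (simp_all add: imap_imap)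
      moreover have "\<kappa> y \<sqsubseteq>\<^bsub>arrs G\<^esub> y"
        using y dV by (simp add: \<kappa>_def ar.meet_left)
      ultimately have "h t \<sqsubseteq>\<^bsub>arrs G\<^esub> \<kappa> y" "\<kappa> y \<sqsubseteq>\<^bsub>arrs G\<^esub> y"
        using ht by (simp_all add: gU topX[symmetric] X.meet_top) (simp add: X_def)
      then show ?thesis
        using w y dV ar.le_trans[of "h t" "\<kappa> y" y] by (simp add: \<kappa>_def)
    qed
    show "fst2 G U \<sqinter>\<^bsub>pairs2 G\<^esub> snd2 G t \<sqsubseteq>\<^bsub>pairs2 G\<^esub> mmap G (h t)"
    proof (rule le_mmapI[OF U t w])
      fix Z :: "('a \<times> 'a) set gorder" and g' h'
      assume Z: "frame Z" and g': "g' \<in> frame_hom (arrs G) Z" and h': "h' \<in> frame_hom (arrs G) Z"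
        and g'h': "composable G g' h'" and g'U: "g' U = \<top>\<^bsub>Z\<^esub>" and h't: "h' t = \<top>\<^bsub>Z\<^esub>"
      interpret Z: frame Z by (rule Z)
      interpret g': frame_morphism "arrs G" Z g' by unfold_locales (rule g')
      let ?k = "gmul G Z g' h'"
      interpret k: frame_morphism "arrs G" Z ?k
        by unfold_locales (rule gmul_hom[OF Z g' h' g'h'])
      note k_d = gmul_dmap[OF Z g' h' g'h']
      have k_dV: "?k dV = \<top>\<^bsub>Z\<^esub>"
      proof -
        have "g' U \<sqsubseteq>\<^bsub>Z\<^esub> g' dV"
          using U dV UV by (intro g'.hom_mono) (simp_all add: dV_def)
        then have "g' dV = \<top>\<^bsub>Z\<^esub>"
          using dV by (intro Z.le_antisym) (simp_all add: g'U)
        then show ?thesis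
          using k_d[OF V] by (simp add: dV_def)
      qed
      \<comment> \<open>The composite has its domain in \<open>V\<close>, hence factors through \<open>X\<close>.\<close>
      have k_X: "frame_morphism X Z ?k"
        using k.frame_hom_below[OF dV] Z X unfolding X_def k_dV
        by (simp add: frame_morphism_def frame_morphism_axioms_def Z.below_top)
      have k_\<kappa>: "?k (\<kappa> y) = ?k y" if "y \<in> carrier (arrs G)" for y
        using that dV by (simp add: \<kappa>_def k.hom_meet k_dV Z.meet_top)
      have kg: "(\<lambda>y. ?k (g y)) \<in> frame_hom (arrs G) Z"
        by (rule frame_hom_comp[OF g frame_morphism.hom[OF k_X]])
      have k_g: "?k (g y) = g' y" if "y \<in> carrier (arrs G)" for y
      proof (rule bisection_unique[OF assms(1) Z kg g' _ g'U _ that])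
        show "?k (g U) = \<top>\<^bsub>Z\<^esub>"
          by (simp add: gU k_dV)
        show "?k (g (dmap G c)) = g' (dmap G c)" if "c \<in> carrier (objs G)" for c
          using that k_\<kappa>[of "dmap G c"] by (simp add: gd \<kappa>_def k_d)
      qed
      have "?k (h t) = gmul G Z (\<lambda>y. ?k (g (imap G y))) (\<lambda>y. ?k (\<kappa> y)) t"
        unfolding h_def by (rule gmul_natural[OF k_X t gi \<kappa>])
      also have "\<dots> = gmul G Z (\<lambda>y. g' (imap G y)) ?k t"
        using t by (intro gmul_cong) (simp_all add: k_g k_\<kappa>)
      also have "\<dots> = \<top>\<^bsub>Z\<^esub>"
        using gmul_inv_gmul[OF Z g' h' g'h' t] h't by simp
      finally show "?k (h t) = \<top>\<^bsub>Z\<^esub>" .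
    qed
  qed
qed

end


section \<open>The quantale of an etale groupoid\<close>

context localic_groupoid
begin

lemma carrier_quantale [simp]: "carrier (\<O> G) = carrier (arrs G)"
  and le_quantale [simp]: "le (\<O> G) = le (arrs G)"
  and eq_quantale [simp]: "eq (\<O> G) = eq (arrs G)"
  and qstar_quantale [simp]: "qstar (\<O> G) = imap G"
  by (simp_all add: groupoid_quantale_def)

lemma Sup_quantale [simp]: "\<Squnion>\<^bsub>\<O> G\<^esub> X = \<Squnion>\<^bsub>arrs G\<^esub> X"
  by (simp add: Lattice.sup_def least_def Upper_def)

lemma meet_quantale [simp]: "x \<sqinter>\<^bsub>\<O> G\<^esub> y = x \<sqinter>\<^bsub>arrs G\<^esub> y"
  by (simp add: meet_def Lattice.inf_def greatest_def Lower_def)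

lemma frame_quantale: "frame (\<O> G)"
proof -
  interpret Q: partial_order "\<O> G"
    by unfold_locales (auto simp: ar.eq_is_equal intro: ar.le_trans)
  show ?thesis
    using ar.sup_exists ar.inf_exists ar.meet_Sup
    by unfold_locales (simp_all add: least_def Upper_def greatest_def Lower_def)
qed

lemma qmult_quantale:
  "x \<cdot>\<^bsub>\<O> G\<^esub> y =
     \<Sqinter>\<^bsub>arrs G\<^esub> {w \<in> carrier (arrs G). fst2 G x \<sqinter>\<^bsub>pairs2 G\<^esub> snd2 G y \<sqsubseteq>\<^bsub>pairs2 G\<^esub> mmap G w}"
  by (simp add: groupoid_quantale_def direct_image_def)

lemma qunit_quantale:
  "qunit (\<O> G) = \<Sqinter>\<^bsub>arrs G\<^esub> {y \<in> carrier (arrs G). \<top>\<^bsub>objs G\<^esub> \<sqsubseteq>\<^bsub>objs G\<^esub> umap G y}"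
  by (simp add: groupoid_quantale_def direct_image_def)

lemma qmult_quantale_closed: "x \<cdot>\<^bsub>\<O> G\<^esub> y \<in> carrier (arrs G)"
  by (simp add: qmult_quantale)

lemma qunit_quantale_closed: "qunit (\<O> G) \<in> carrier (arrs G)"
  by (simp add: qunit_quantale)

lemma qmult_quantale_le:
  assumes "w \<in> carrier (arrs G)" "fst2 G x \<sqinter>\<^bsub>pairs2 G\<^esub> snd2 G y \<sqsubseteq>\<^bsub>pairs2 G\<^esub> mmap G w"
  shows "x \<cdot>\<^bsub>\<O> G\<^esub> y \<sqsubseteq>\<^bsub>arrs G\<^esub> w"
  unfolding qmult_quantale using assms by (intro ar.inf_lower) auto

lemma qmult_quantale_mono:
  assumes "x \<sqsubseteq>\<^bsub>arrs G\<^esub> x'" "y \<sqsubseteq>\<^bsub>arrs G\<^esub> y'"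
    and "x \<in> carrier (arrs G)" "y \<in> carrier (arrs G)" "x' \<in> carrier (arrs G)" "y' \<in> carrier (arrs G)"
  shows "x \<cdot>\<^bsub>\<O> G\<^esub> y \<sqsubseteq>\<^bsub>arrs G\<^esub> x' \<cdot>\<^bsub>\<O> G\<^esub> y'"
  unfolding qmult_quantale[of x' y']
proof (rule ar.inf_greatest)
  fix w assume w: "w \<in> {w \<in> carrier (arrs G). fst2 G x' \<sqinter>\<^bsub>pairs2 G\<^esub> snd2 G y' \<sqsubseteq>\<^bsub>pairs2 G\<^esub> mmap G w}"
  have "fst2 G x \<sqinter>\<^bsub>pairs2 G\<^esub> snd2 G y \<sqsubseteq>\<^bsub>pairs2 G\<^esub> fst2 G x' \<sqinter>\<^bsub>pairs2 G\<^esub> snd2 G y'"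
    using assms by (intro p2.meet_mono fst2.hom_mono snd2.hom_mono) auto
  with w assms show "x \<cdot>\<^bsub>\<O> G\<^esub> y \<sqsubseteq>\<^bsub>arrs G\<^esub> w"
    by (intro qmult_quantale_le) (auto intro: p2.le_trans)
qed (auto intro: qmult_quantale_closed)

text \<open>The identity arrows in a bisection \<open>U\<close> form the open part \<open>U \<sqinter> d\<^sup>* (u\<^sup>* U)\<close>.\<close>

lemma bisection_units:
  assumes "bisection G U" and y: "y \<in> carrier (arrs G)"
  shows "y \<sqinter>\<^bsub>arrs G\<^esub> (U \<sqinter>\<^bsub>arrs G\<^esub> dmap G (umap G U)) =
    dmap G (umap G y) \<sqinter>\<^bsub>arrs G\<^esub> (U \<sqinter>\<^bsub>arrs G\<^esub> dmap G (umap G U))"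
proof -
  have U: "U \<in> carrier (arrs G)"
    using assms(1) by (simp add: bisection_def)
  let ?a = "U \<sqinter>\<^bsub>arrs G\<^esub> dmap G (umap G U)"
  have a: "?a \<in> carrier (arrs G)"
    using U by simp
  note restr = ar.frame_hom_restrict[OF a]
  show ?thesis
  proof (rule bisection_unique[OF assms(1) ar.frame_below[OF a] restr _ _ _ _ y])
    show "(\<lambda>y. dmap G (umap G y) \<sqinter>\<^bsub>arrs G\<^esub> ?a) \<in> frame_hom (arrs G) (below (arrs G) ?a)"
      by (rule frame_hom_comp[OF frame_hom_comp[OF umap_hom dmap_hom] restr])
    show "U \<sqinter>\<^bsub>arrs G\<^esub> ?a = \<top>\<^bsub>below (arrs G) ?a\<^esub>"
      using U ar.meet_left[of U "dmap G (umap G U)"] by (simp add: ar.top_below ar.meet_absorb)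
    show "dmap G (umap G U) \<sqinter>\<^bsub>arrs G\<^esub> ?a = \<top>\<^bsub>below (arrs G) ?a\<^esub>"
      using U ar.meet_right[of U "dmap G (umap G U)"] by (simp add: ar.top_below ar.meet_absorb)
  qed (simp add: d_u)
qed

text \<open>If \<open>s\<close> is a bisection, the arrows of \<open>s\<^sup>* s\<close> are identities.\<close>

lemma bisection_star_mult_le:
  assumes s: "bisection G s" and e: "e \<in> carrier (arrs G)" "umap G e = \<top>\<^bsub>objs G\<^esub>"
  shows "imap G s \<cdot>\<^bsub>\<O> G\<^esub> s \<sqsubseteq>\<^bsub>arrs G\<^esub> e"
proof (intro qmult_quantale_le le_mmapI)
  have s': "s \<in> carrier (arrs G)"
    using s by (simp add: bisection_def)
  then show "s \<in> carrier (arrs G)" "imap G s \<in> carrier (arrs G)"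
    by auto
  fix Z :: "('a \<times> 'a) set gorder" and g h
  assume Z: "frame Z" and g: "g \<in> frame_hom (arrs G) Z" and h: "h \<in> frame_hom (arrs G) Z"
    and gh: "composable G g h" and "g (imap G s) = \<top>\<^bsub>Z\<^esub>" "h s = \<top>\<^bsub>Z\<^esub>"
  then have "g (imap G y) = h y" if y: "y \<in> carrier (arrs G)" for y
    by (intro bisection_unique[OF s Z inv_hom[OF Z g] h _ _ _ y]) (simp_all add: composable_def d_i)
  then have "gmul G Z g h e = gmul G Z g (\<lambda>y. g (imap G y)) e"
    using e by (intro gmul_cong) auto
  also have "\<dots> = \<top>\<^bsub>Z\<^esub>"
    using e g by (simp add: gmul_inv_right[OF Z g] d.hom_top) (simp add: frame_hom_def)
  finally show "gmul G Z g h e = \<top>\<^bsub>Z\<^esub>" .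
qed (rule e)+

end

context localic_etale_groupoid
begin

lemma bisection_cover:
  obtains \<C> where "\<C> \<subseteq> carrier (arrs G)" "\<Squnion>\<^bsub>arrs G\<^esub> \<C> = \<top>\<^bsub>arrs G\<^esub>" "\<forall>U\<in>\<C>. bisection G U"
proof -
  obtain \<C> where C: "\<C> \<subseteq> carrier (arrs G)" "\<Squnion>\<^bsub>arrs G\<^esub> \<C> = \<top>\<^bsub>arrs G\<^esub>"
    and homeo: "\<forall>U\<in>\<C>. \<exists>V\<in>carrier (objs G). U \<sqsubseteq>\<^bsub>arrs G\<^esub> dmap G V \<and>
           bij_betw (\<lambda>y. dmap G y \<sqinter>\<^bsub>arrs G\<^esub> U) {y \<in> carrier (objs G). y \<sqsubseteq>\<^bsub>objs G\<^esub> V}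
             {x \<in> carrier (arrs G). x \<sqsubseteq>\<^bsub>arrs G\<^esub> U}"
    using d_local_homeo unfolding local_homeomorphism_def by blast
  have "\<forall>U\<in>\<C>. bisection G U"
    using C(1) homeo unfolding bisection_def by blast
  with C show thesis
    by (rule that)
qed

text \<open>
  There is a least open \<open>e\<close> with \<open>u\<^sup>* e\<close> the top: the join of the opens of identity arrows in the
  bisections of a cover. On \<open>e\<close>, every open \<open>y\<close> agrees with \<open>d\<^sup>* (u\<^sup>* y)\<close>.
\<close>

lemma umap_qunit: "umap G (qunit (\<O> G)) = \<top>\<^bsub>objs G\<^esub>"
  and meet_qunit: "y \<in> carrier (arrs G) \<Longrightarrow>
      y \<sqinter>\<^bsub>arrs G\<^esub> qunit (\<O> G) = dmap G (umap G y) \<sqinter>\<^bsub>arrs G\<^esub> qunit (\<O> G)"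
proof -
  obtain \<C> where C: "\<C> \<subseteq> carrier (arrs G)" "\<Squnion>\<^bsub>arrs G\<^esub> \<C> = \<top>\<^bsub>arrs G\<^esub>"
    and bis: "\<forall>U\<in>\<C>. bisection G U"
    by (rule bisection_cover)
  let ?a = "\<lambda>U. U \<sqinter>\<^bsub>arrs G\<^esub> dmap G (umap G U)"
  let ?e = "\<Squnion>\<^bsub>arrs G\<^esub> (?a ` \<C>)"
  have a: "?a ` \<C> \<subseteq> carrier (arrs G)"
    using C(1) by auto
  have meet_e: "y \<sqinter>\<^bsub>arrs G\<^esub> ?e = dmap G (umap G y) \<sqinter>\<^bsub>arrs G\<^esub> ?e" if y: "y \<in> carrier (arrs G)" for y
    using y a bis by (simp add: ar.meet_Sup image_image bisection_units)
  have u_e: "umap G ?e = \<top>\<^bsub>objs G\<^esub>"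
  proof -
    have "umap G ?e = \<Squnion>\<^bsub>objs G\<^esub> ((\<lambda>U. umap G (?a U)) ` \<C>)"
      using a by (simp add: u.hom_Sup image_image)
    also have "(\<lambda>U. umap G (?a U)) ` \<C> = umap G ` \<C>"
      using C(1) by (intro image_cong) (auto simp: u.hom_meet d_u ob.meet_absorb)
    also have "\<Squnion>\<^bsub>objs G\<^esub> \<dots> = umap G (\<Squnion>\<^bsub>arrs G\<^esub> \<C>)"
      using C(1) by (simp add: u.hom_Sup)
    finally show ?thesis
      by (simp add: C(2) u.hom_top)
  qed
  have "qunit (\<O> G) = ?e"
    unfolding qunit_quantale
  proof (rule ar.inf_eqI)
    fix y assume "y \<in> {y \<in> carrier (arrs G). \<top>\<^bsub>objs G\<^esub> \<sqsubseteq>\<^bsub>objs G\<^esub> umap G y}"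
    then have y: "y \<in> carrier (arrs G)" and "umap G y = \<top>\<^bsub>objs G\<^esub>"
      by (auto intro: ob.le_antisym)
    then have "y \<sqinter>\<^bsub>arrs G\<^esub> ?e = ?e"
      using a meet_e[OF y] by (simp add: d.hom_top ar.meet_top)
    then show "?e \<sqsubseteq>\<^bsub>arrs G\<^esub> y"
      using a y by (simp add: ar.le_iff_meet meet_comm[of _ y])
  qed (use a u_e in auto)
  then show "umap G (qunit (\<O> G)) = \<top>\<^bsub>objs G\<^esub>"
    and "y \<in> carrier (arrs G) \<Longrightarrow>
      y \<sqinter>\<^bsub>arrs G\<^esub> qunit (\<O> G) = dmap G (umap G y) \<sqinter>\<^bsub>arrs G\<^esub> qunit (\<O> G)"
    using u_e meet_e by simp_all
qed

lemma qunit_le: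
  assumes "y \<in> carrier (arrs G)" "umap G y = \<top>\<^bsub>objs G\<^esub>"
  shows "qunit (\<O> G) \<sqsubseteq>\<^bsub>arrs G\<^esub> y"
  unfolding qunit_quantale using assms by (intro ar.inf_lower) auto

text \<open>A generalized arrow in \<open>e\<close> is the identity arrow of its domain.\<close>

lemma unit_arrow:
  assumes X: "frame X" and g: "g \<in> frame_hom (arrs G) X" and e: "g (qunit (\<O> G)) = \<top>\<^bsub>X\<^esub>"
    and y: "y \<in> carrier (arrs G)"
  shows "g (dmap G (umap G y)) = g y"
proof -
  interpret X: frame X by (rule X)
  interpret g: frame_morphism "arrs G" X g by unfold_locales (rule g)
  have "g (z \<sqinter>\<^bsub>arrs G\<^esub> qunit (\<O> G)) = g z" if "z \<in> carrier (arrs G)" for z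
    using that by (simp add: g.hom_meet qunit_quantale_closed e X.meet_top)
  then show ?thesis
    using meet_qunit[OF y] y by (metis d.closed u.closed)
qed

text \<open>
  The unit of the adjunction between \<open>m\<^sub>!\<close> and \<open>m\<^sup>*\<close>, on the tensors \<open>x \<otimes> y\<close>. As bisections cover,
  \<open>bisection_product\<close> yields it for arbitrary \<open>x\<close>.
\<close>

lemma le_mmap_qmult:
  assumes x: "x \<in> carrier (arrs G)" and y: "y \<in> carrier (arrs G)"
  shows "fst2 G x \<sqinter>\<^bsub>pairs2 G\<^esub> snd2 G y \<sqsubseteq>\<^bsub>pairs2 G\<^esub> mmap G (x \<cdot>\<^bsub>\<O> G\<^esub> y)"
proof -
  obtain \<C> where C: "\<C> \<subseteq> carrier (arrs G)" "\<Squnion>\<^bsub>arrs G\<^esub> \<C> = \<top>\<^bsub>arrs G\<^esub>"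
    and bis: "\<forall>U\<in>\<C>. bisection G U"
    by (rule bisection_cover)
  have *: "fst2 G U \<sqinter>\<^bsub>pairs2 G\<^esub> snd2 G y \<sqsubseteq>\<^bsub>pairs2 G\<^esub> mmap G (U \<cdot>\<^bsub>\<O> G\<^esub> y)" if U: "bisection G U" for U
  proof -
    obtain w where w: "w \<in> carrier (arrs G)"
      "fst2 G U \<sqinter>\<^bsub>pairs2 G\<^esub> snd2 G y \<sqsubseteq>\<^bsub>pairs2 G\<^esub> mmap G w"
      "\<And>z. \<lbrakk>z \<in> carrier (arrs G); fst2 G U \<sqinter>\<^bsub>pairs2 G\<^esub> snd2 G y \<sqsubseteq>\<^bsub>pairs2 G\<^esub> mmap G z\<rbrakk> \<Longrightarrow> w \<sqsubseteq>\<^bsub>arrs G\<^esub> z"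
      using bisection_product[OF U y] by metis
    then have "U \<cdot>\<^bsub>\<O> G\<^esub> y = w"
      unfolding qmult_quantale by (intro ar.inf_eqI) auto
    then show ?thesis
      using w(2) by simp
  qed
  have "fst2 G (x \<sqinter>\<^bsub>arrs G\<^esub> U) \<sqinter>\<^bsub>pairs2 G\<^esub> snd2 G y \<sqsubseteq>\<^bsub>pairs2 G\<^esub> mmap G (x \<cdot>\<^bsub>\<O> G\<^esub> y)" if "U \<in> \<C>" for U
  proof -
    have U: "U \<in> carrier (arrs G)"
      using that C(1) by auto
    have "bisection G (x \<sqinter>\<^bsub>arrs G\<^esub> U)"
      using bisection_subset[of U "x \<sqinter>\<^bsub>arrs G\<^esub> U"] ar.meet_right[of x U] that bis x U by simp
    note *[OF this]
    moreover have "mmap G ((x \<sqinter>\<^bsub>arrs G\<^esub> U) \<cdot>\<^bsub>\<O> G\<^esub> y) \<sqsubseteq>\<^bsub>pairs2 G\<^esub> mmap G (x \<cdot>\<^bsub>\<O> G\<^esub> y)"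
      using x y U by (intro m.hom_mono qmult_quantale_mono qmult_quantale_closed ar.meet_left) auto
    ultimately show ?thesis
      by (rule p2.le_trans) (use x y U qmult_quantale_closed in auto)
  qed
  moreover have "fst2 G x = \<Squnion>\<^bsub>pairs2 G\<^esub> ((\<lambda>U. fst2 G (x \<sqinter>\<^bsub>arrs G\<^esub> U)) ` \<C>)"
  proof -
    have "x = \<Squnion>\<^bsub>arrs G\<^esub> ((\<lambda>U. x \<sqinter>\<^bsub>arrs G\<^esub> U) ` \<C>)"
      using x C by (simp add: ar.meet_Sup[symmetric] ar.meet_top)
    then have "fst2 G x = fst2 G (\<Squnion>\<^bsub>arrs G\<^esub> ((\<lambda>U. x \<sqinter>\<^bsub>arrs G\<^esub> U) ` \<C>))"
      by simp
    also have "\<dots> = \<Squnion>\<^bsub>pairs2 G\<^esub> (fst2 G ` (\<lambda>U. x \<sqinter>\<^bsub>arrs G\<^esub> U) ` \<C>)"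
      using x C(1) by (intro fst2.hom_Sup) auto
    finally show ?thesis
      by (simp add: image_image)
  qed
  moreover have "(\<lambda>U. fst2 G (x \<sqinter>\<^bsub>arrs G\<^esub> U)) ` \<C> \<subseteq> carrier (pairs2 G)"
    using x C(1) by auto
  ultimately show ?thesis
    using x y C(1) by (simp add: p2.Sup_meet image_image) (auto intro!: p2.sup_least simp: qmult_quantale_closed)
qed

lemma qmult_le_iff:
  assumes "x \<in> carrier (arrs G)" "y \<in> carrier (arrs G)" "w \<in> carrier (arrs G)"
  shows "x \<cdot>\<^bsub>\<O> G\<^esub> y \<sqsubseteq>\<^bsub>arrs G\<^esub> w \<longleftrightarrow>
    fst2 G x \<sqinter>\<^bsub>pairs2 G\<^esub> snd2 G y \<sqsubseteq>\<^bsub>pairs2 G\<^esub> mmap G w"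
proof
  assume "x \<cdot>\<^bsub>\<O> G\<^esub> y \<sqsubseteq>\<^bsub>arrs G\<^esub> w"
  then have "mmap G (x \<cdot>\<^bsub>\<O> G\<^esub> y) \<sqsubseteq>\<^bsub>pairs2 G\<^esub> mmap G w"
    using assms by (intro m.hom_mono) (auto intro: qmult_quantale_closed)
  then show "fst2 G x \<sqinter>\<^bsub>pairs2 G\<^esub> snd2 G y \<sqsubseteq>\<^bsub>pairs2 G\<^esub> mmap G w"
    using assms qmult_quantale_closed by (intro p2.le_trans[OF le_mmap_qmult]) auto
qed (use assms in \<open>auto intro: qmult_quantale_le\<close>)

lemma qmult_quantale_Sup:
  assumes x: "x \<in> carrier (arrs G)" and Y: "Y \<subseteq> carrier (arrs G)"
  shows "x \<cdot>\<^bsub>\<O> G\<^esub> \<Squnion>\<^bsub>arrs G\<^esub> Y = \<Squnion>\<^bsub>arrs G\<^esub> ((\<lambda>y. x \<cdot>\<^bsub>\<O> G\<^esub> y) ` Y)"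
proof (rule ar.sup_eqI[symmetric])
  fix w assume w: "w \<in> carrier (arrs G)" "\<And>z. z \<in> (\<lambda>y. x \<cdot>\<^bsub>\<O> G\<^esub> y) ` Y \<Longrightarrow> z \<sqsubseteq>\<^bsub>arrs G\<^esub> w"
  have "fst2 G x \<sqinter>\<^bsub>pairs2 G\<^esub> snd2 G y \<sqsubseteq>\<^bsub>pairs2 G\<^esub> mmap G w" if "y \<in> Y" for y
    using w(2)[OF imageI[OF that]] x Y w(1) that by (subst qmult_le_iff[symmetric]) auto
  then have "fst2 G x \<sqinter>\<^bsub>pairs2 G\<^esub> snd2 G (\<Squnion>\<^bsub>arrs G\<^esub> Y) \<sqsubseteq>\<^bsub>pairs2 G\<^esub> mmap G w"
    using x Y w(1) by (subst snd2.hom_Sup, simp, subst p2.meet_Sup) (auto intro!: p2.sup_least)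
  then show "x \<cdot>\<^bsub>\<O> G\<^esub> \<Squnion>\<^bsub>arrs G\<^esub> Y \<sqsubseteq>\<^bsub>arrs G\<^esub> w"
    using x Y w(1) by (simp add: qmult_le_iff)
next
  fix z assume "z \<in> (\<lambda>y. x \<cdot>\<^bsub>\<O> G\<^esub> y) ` Y"
  then obtain y where y: "y \<in> Y" and z: "z = x \<cdot>\<^bsub>\<O> G\<^esub> y" by auto
  show "z \<sqsubseteq>\<^bsub>arrs G\<^esub> x \<cdot>\<^bsub>\<O> G\<^esub> \<Squnion>\<^bsub>arrs G\<^esub> Y"
    unfolding z using x y Y ar.sup_upper[OF Y y] by (intro qmult_quantale_mono) auto
qed (auto intro: qmult_quantale_closed)

lemma Sup_qmult_quantale:
  assumes y: "y \<in> carrier (arrs G)" and X: "X \<subseteq> carrier (arrs G)"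
  shows "\<Squnion>\<^bsub>arrs G\<^esub> X \<cdot>\<^bsub>\<O> G\<^esub> y = \<Squnion>\<^bsub>arrs G\<^esub> ((\<lambda>x. x \<cdot>\<^bsub>\<O> G\<^esub> y) ` X)"
proof (rule ar.sup_eqI[symmetric])
  fix w assume w: "w \<in> carrier (arrs G)" "\<And>z. z \<in> (\<lambda>x. x \<cdot>\<^bsub>\<O> G\<^esub> y) ` X \<Longrightarrow> z \<sqsubseteq>\<^bsub>arrs G\<^esub> w"
  have "fst2 G x \<sqinter>\<^bsub>pairs2 G\<^esub> snd2 G y \<sqsubseteq>\<^bsub>pairs2 G\<^esub> mmap G w" if "x \<in> X" for x
    using w(2)[OF imageI[OF that]] y X w(1) that by (subst qmult_le_iff[symmetric]) auto
  then have "fst2 G (\<Squnion>\<^bsub>arrs G\<^esub> X) \<sqinter>\<^bsub>pairs2 G\<^esub> snd2 G y \<sqsubseteq>\<^bsub>pairs2 G\<^esub> mmap G w"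
    using y X w(1) by (subst fst2.hom_Sup, simp, subst p2.Sup_meet) (auto intro!: p2.sup_least)
  then show "\<Squnion>\<^bsub>arrs G\<^esub> X \<cdot>\<^bsub>\<O> G\<^esub> y \<sqsubseteq>\<^bsub>arrs G\<^esub> w"
    using y X w(1) by (simp add: qmult_le_iff)
next
  fix z assume "z \<in> (\<lambda>x. x \<cdot>\<^bsub>\<O> G\<^esub> y) ` X"
  then obtain x where x: "x \<in> X" and z: "z = x \<cdot>\<^bsub>\<O> G\<^esub> y" by auto
  show "z \<sqsubseteq>\<^bsub>arrs G\<^esub> \<Squnion>\<^bsub>arrs G\<^esub> X \<cdot>\<^bsub>\<O> G\<^esub> y"
    unfolding z using x y X ar.sup_upper[OF X x] by (intro qmult_quantale_mono) auto
qed (auto intro: qmult_quantale_closed)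

lemma qmult_qunit:
  assumes x: "x \<in> carrier (arrs G)"
  shows "x \<cdot>\<^bsub>\<O> G\<^esub> qunit (\<O> G) = x"
proof (rule ar.le_antisym)
  note e = qunit_quantale_closed
  show "x \<cdot>\<^bsub>\<O> G\<^esub> qunit (\<O> G) \<sqsubseteq>\<^bsub>arrs G\<^esub> x"
  proof (intro qmult_quantale_le le_mmapI)
    fix Z :: "('b \<times> 'b) set gorder" and g h
    assume Z: "frame Z" and g: "g \<in> frame_hom (arrs G) Z" and h: "h \<in> frame_hom (arrs G) Z"
      and gh: "composable G g h" and gx: "g x = \<top>\<^bsub>Z\<^esub>" and he: "h (qunit (\<O> G)) = \<top>\<^bsub>Z\<^esub>"
    have "gmul G Z g h x = gmul G Z g (\<lambda>y. g (rmap G (umap G y))) x"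
      using x gh unit_arrow[OF Z h he] by (intro gmul_cong) (auto simp: composable_def)
    then show "gmul G Z g h x = \<top>\<^bsub>Z\<^esub>"
      using gmul_unit_right[OF Z g x] gx by simp
  qed (use x e in auto)
  have "x \<sqinter>\<^bsub>arrs G\<^esub> rmap G (umap G (qunit (\<O> G))) \<sqsubseteq>\<^bsub>arrs G\<^esub>
      gmul G (arrs G) (\<lambda>y. y) (\<lambda>y. rmap G (umap G y)) (x \<cdot>\<^bsub>\<O> G\<^esub> qunit (\<O> G))"
    by (rule gmul_meet_le[OF arrs_frame frame_hom_ident frame_hom_comp[OF umap_hom rmap_hom] _ x e
          qmult_quantale_closed le_mmap_qmult[OF x e]]) (simp add: composable_def d_u)
  then show "x \<sqsubseteq>\<^bsub>arrs G\<^esub> x \<cdot>\<^bsub>\<O> G\<^esub> qunit (\<O> G)"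
    using gmul_unit_right[OF arrs_frame frame_hom_ident qmult_quantale_closed] x
    by (simp add: umap_qunit r.hom_top ar.meet_top)
qed (use x in \<open>auto intro: qmult_quantale_closed\<close>)

lemma qunit_qmult:
  assumes x: "x \<in> carrier (arrs G)"
  shows "qunit (\<O> G) \<cdot>\<^bsub>\<O> G\<^esub> x = x"
proof (rule ar.le_antisym)
  note e = qunit_quantale_closed
  show "qunit (\<O> G) \<cdot>\<^bsub>\<O> G\<^esub> x \<sqsubseteq>\<^bsub>arrs G\<^esub> x"
  proof (intro qmult_quantale_le le_mmapI)
    fix Z :: "('b \<times> 'b) set gorder" and g h
    assume Z: "frame Z" and g: "g \<in> frame_hom (arrs G) Z" and h: "h \<in> frame_hom (arrs G) Z"
      and gh: "composable G g h" and ge: "g (qunit (\<O> G)) = \<top>\<^bsub>Z\<^esub>" and hx: "h x = \<top>\<^bsub>Z\<^esub>"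
    have "g y = h (dmap G (umap G y))" if "y \<in> carrier (arrs G)" for y
      using that gh unit_arrow[OF Z g ge, of y] unit_arrow[OF Z g ge, of "rmap G (umap G y)"]
      by (simp add: composable_def r_u)
    then have "gmul G Z g h x = gmul G Z (\<lambda>y. h (dmap G (umap G y))) h x"
      using x by (intro gmul_cong) auto
    then show "gmul G Z g h x = \<top>\<^bsub>Z\<^esub>"
      using gmul_unit_left[OF Z h x] hx by simp
  qed (use x e in auto)
  have "dmap G (umap G (qunit (\<O> G))) \<sqinter>\<^bsub>arrs G\<^esub> x \<sqsubseteq>\<^bsub>arrs G\<^esub>
      gmul G (arrs G) (\<lambda>y. dmap G (umap G y)) (\<lambda>y. y) (qunit (\<O> G) \<cdot>\<^bsub>\<O> G\<^esub> x)"
    by (rule gmul_meet_le[OF arrs_frame frame_hom_comp[OF umap_hom dmap_hom] frame_hom_ident _ e x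
          qmult_quantale_closed le_mmap_qmult[OF e x]]) (simp add: composable_def r_u)
  then show "x \<sqsubseteq>\<^bsub>arrs G\<^esub> qunit (\<O> G) \<cdot>\<^bsub>\<O> G\<^esub> x"
    using gmul_unit_left[OF arrs_frame frame_hom_ident qmult_quantale_closed] x
    by (simp add: umap_qunit d.hom_top ar.meet_top)
qed (use x in \<open>auto intro: qmult_quantale_closed\<close>)

lemma imap_qunit: "imap G (qunit (\<O> G)) = qunit (\<O> G)"
proof (rule ar.le_antisym)
  note e = qunit_quantale_closed
  show le: "qunit (\<O> G) \<sqsubseteq>\<^bsub>arrs G\<^esub> imap G (qunit (\<O> G))"
    using e by (intro qunit_le) (auto simp: umap_imap umap_qunit)
  show "imap G (qunit (\<O> G)) \<sqsubseteq>\<^bsub>arrs G\<^esub> qunit (\<O> G)"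
    using i.hom_mono[OF _ _ le] e by (simp add: imap_imap)
qed (use qunit_quantale_closed in auto)

text \<open>
  An open \<open>s\<close> such that \<open>s\<close> and \<open>i\<^sup>* s\<close> are bisections is a partial unit. Such \<open>s\<close> cover \<open>G\<^sub>1\<close>: meet two
  members of a cover by bisections after inverting one of them.
\<close>

lemma partial_units_cover:
  assumes x: "x \<in> carrier (arrs G)"
  shows "\<Squnion>\<^bsub>arrs G\<^esub> {s \<in> carrier (arrs G). s \<sqsubseteq>\<^bsub>arrs G\<^esub> x \<and>
      imap G s \<cdot>\<^bsub>\<O> G\<^esub> s \<sqsubseteq>\<^bsub>arrs G\<^esub> qunit (\<O> G) \<and> s \<cdot>\<^bsub>\<O> G\<^esub> imap G s \<sqsubseteq>\<^bsub>arrs G\<^esub> qunit (\<O> G)} = x"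
    (is "\<Squnion>\<^bsub>arrs G\<^esub> ?S = x")
proof (rule ar.le_antisym)
  have S: "?S \<subseteq> carrier (arrs G)" by auto
  show "\<Squnion>\<^bsub>arrs G\<^esub> ?S \<sqsubseteq>\<^bsub>arrs G\<^esub> x"
    using x by (intro ar.sup_least) auto
  obtain \<C> where C: "\<C> \<subseteq> carrier (arrs G)" "\<Squnion>\<^bsub>arrs G\<^esub> \<C> = \<top>\<^bsub>arrs G\<^esub>"
    and bis: "\<forall>U\<in>\<C>. bisection G U"
    by (rule bisection_cover)
  have le: "(x \<sqinter>\<^bsub>arrs G\<^esub> U) \<sqinter>\<^bsub>arrs G\<^esub> imap G W \<sqsubseteq>\<^bsub>arrs G\<^esub> \<Squnion>\<^bsub>arrs G\<^esub> ?S" if "U \<in> \<C>" "W \<in> \<C>" for U W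
  proof (rule ar.sup_upper[OF S])
    let ?s = "(x \<sqinter>\<^bsub>arrs G\<^esub> U) \<sqinter>\<^bsub>arrs G\<^esub> imap G W"
    have U: "U \<in> carrier (arrs G)" "bisection G U" and W: "W \<in> carrier (arrs G)" "bisection G W"
      using that C(1) bis by auto
    have s: "?s \<in> carrier (arrs G)"
      using x U W by simp
    have s_xU: "?s \<sqsubseteq>\<^bsub>arrs G\<^esub> x \<sqinter>\<^bsub>arrs G\<^esub> U" and s_W: "?s \<sqsubseteq>\<^bsub>arrs G\<^esub> imap G W"
      using x U W by (auto intro: ar.meet_left ar.meet_right)
    have "bisection G ?s"
      using s_xU s x U by (intro bisection_subset[OF U(2) s]) (auto simp: ar.le_meet_iff)
    moreover have "bisection G (imap G ?s)"
      using i.hom_mono[OF s _ s_W] s W by (intro bisection_subset[OF W(2) i.closed[OF s]]) (simp add: imap_imap)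
    ultimately show "?s \<in> ?S"
      using bisection_star_mult_le[of ?s "qunit (\<O> G)"] bisection_star_mult_le[of "imap G ?s" "qunit (\<O> G)"]
        s s_xU x U by (simp add: imap_imap umap_qunit qunit_quantale_closed ar.le_meet_iff)
  qed
  have "\<Squnion>\<^bsub>arrs G\<^esub> ((\<lambda>U. x \<sqinter>\<^bsub>arrs G\<^esub> U) ` \<C>) \<sqinter>\<^bsub>arrs G\<^esub> \<Squnion>\<^bsub>arrs G\<^esub> (imap G ` \<C>) \<sqsubseteq>\<^bsub>arrs G\<^esub> \<Squnion>\<^bsub>arrs G\<^esub> ?S"
    using le S x C(1) by (intro ar.Sup_meet_Sup_le) auto
  then show "x \<sqsubseteq>\<^bsub>arrs G\<^esub> \<Squnion>\<^bsub>arrs G\<^esub> ?S"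
    using x C by (simp add: ar.meet_Sup[symmetric] i.hom_Sup[symmetric] i.hom_top ar.meet_top)
qed (use x in auto)

end


context localic_etale_groupoid
begin

lemma partial_unit_quantale: "partial_unit_quantale (\<O> G)"
proof (rule partial_unit_quantale.intro)
  show "partial_unit_quantale_axioms (\<O> G)"
  proof (rule partial_unit_quantale_axioms.intro, goal_cases)
    case (11 x)
    then show ?case
      using partial_units_cover[of x] by simp
  qed (auto simp: qmult_quantale_closed qunit_quantale_closed qmult_quantale_Sup Sup_qmult_quantale
      imap_imap qmult_qunit qunit_qmult imap_qunit intro: i.hom_mono)
qed (rule frame_quantale)

end

theorem theorem6p1:
  fixes Q :: "('q, 'm) iquantale_scheme"
    and G :: "('o, 'a) groupoid_data"
    and q :: "'a \<Rightarrow> 'q"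
    and b :: 'q
  assumes "stably_gelfand_quantale Q"
    and "localic_etale_groupoid G"
    and "q \<in> iq_maps Q (\<O> G)"
    and "b = q (qunit (\<O> G))"
  shows "projection Q b \<and>
    (\<exists>!k. k \<in> uiq_maps (proj_quantale Q b) (\<O> G) \<and> iq_comp (\<O> G) k (proj_map Q b) = q) \<and>
    (\<forall>k. k \<in> uiq_maps (proj_quantale Q b) (\<O> G) \<and> iq_comp (\<O> G) k (proj_map Q b) = q \<longrightarrow>
       iq_surjection (\<O> G) q \<longrightarrow> iq_surjection (\<O> G) k)"
proof -
  interpret Q: stably_gelfand_quantale Q by fact
  interpret G: localic_etale_groupoid G by fact
  note R = G.partial_unit_quantale
  have b: "projection Q b"
    unfolding assms(4) by (rule projection_unit_image[OF R assms(3)])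
  interpret F: quantale_map_factorization Q "\<O> G" q
    by (intro quantale_map_factorization.intro gelfand_projection.intro gelfand_projection_axioms.intro
        quantale_map_factorization_axioms.intro assms R Q.stably_gelfand_quantale_axioms)
      (use b assms(4) in simp)
  show ?thesis
    unfolding assms(4)
    using b F.factor_map F.factor_comp F.factorization_unique F.factorization_surjection
    by (intro conjI ex1I[of _ F.factor]) (auto simp: assms(4))
qed

end
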